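(* Let $X$ be a Banach space, let $\Gamma:[0,1]\to cb(X)$ be Henstock integrable (resp. $\mathcal{H}$-integrable) in $cb(X)$, and let $\Phi_\Gamma$ be its Henstock (resp. $\mathcal{H}$-) integral, regarded as a function of closed subintervals of $[0,1]$. If the variation $\widetilde{\Phi}_\Gamma[0,1]$ is finite, then $\Gamma$ is McShane integrable (resp. Birkhoff integrable) in $cb(X)$.
   Context: $X$ is a (real) Banach space; $cb(X)$ is the family of all nonempty closed convex bounded subsets of $X$ with Hausdorff metric $d_H$; for $C\in cb(X)$ set $\|C\|=\sup\{\|x\|:x\in C\}$. Sums of sets are Minkowski sums. A partition of $[0,1]$ is a finite collection $\{(I_1,t_1),\dots,(I_p,t_p)\}$ with $I_i$ nonoverlapping closed subintervals of $[0,1]$ whose union is $[0,1]$ and $t_i\in[0,1]$; it is a Perron partition if $t_i\in I_i$ for all $i$. A gauge is a positive function $\delta$ on $[0,1]$; a partition is $\delta$-fine if $I_i\subset(t_i-\delta(t_i),t_i+\delta(t_i))$ for all $i$. $\Gamma:[0,1]\to cb(X)$ is Henstock (resp. McShane) integrable in $cb(X)$ if there is $\Phi_\Gamma([0,1])\in cb(X)$ such that for every $\varepsilon>0$ there is a gauge $\delta$ such that for every $\delta$-fine Perron partition (resp. partition) of $[0,1]$, $d_H\big(\Phi_\Gamma([0,1]),\sum_{i=1}^p\Gamma(t_i)|I_i|\big)<\varepsilon$. $\Gamma$ is $\mathcal{H}$-integrable (resp. Birkhoff integrable) in $cb(X)$ if it satisfies the definition of Henstock (resp. McShane) integrability with the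 gauges $\delta$ required to be measurable. For a closed interval $I\subset[0,1]$, $\Phi_\Gamma(I)$ denotes the corresponding integral over $[0,1]$ of $\Gamma 1_I$ (equal to $\Gamma(t)$ for $t\in I$ and to $\{0\}$ otherwise). The variation of an additive interval multifunction $\Phi$ with values in $cb(X)$ is $\widetilde{\Phi}(I)=\sup\{\sum_i\|\Phi(I_i)\| : \{I_1,\dots,I_n\}\text{ is a finite partition of } I \text{ into nonoverlapping closed intervals}\}$. *)

theory Defs
  imports "HOL-Analysis.Analysis" "HOL-Library.Set_Algebras"
begin

definition cb :: "'a::real_normed_vector set set" where
  "cb = {C. C \<noteq> {} \<and> closed C \<and> convex C \<and> bounded C}"

definition hausdorff_dist :: "'a::metric_space set \<Rightarrow> 'a set \<Rightarrow> real" where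
  "hausdorff_dist A B = max (SUP a\<in>A. infdist a B) (SUP b\<in>B. infdist b A)"

definition set_norm :: "'a::real_normed_vector set \<Rightarrow> real" where
  "set_norm C = (SUP x\<in>C. norm x)"

text \<open>A tagged partition is a finite set of pairs (tag, interval), as in the library's
  tagged divisions, except that the tag may be any point of [0,1].\<close>

definition tagged_partition :: "(real \<times> real set) set \<Rightarrow> bool" where
  "tagged_partition P \<longleftrightarrow>
     finite P \<and>
     (\<forall>(t, I)\<in>P. t \<in> {0..1} \<and> I \<subseteq> {0..1} \<and> (\<exists>a b. a \<le> b \<and> I = {a..b})) \<and>
     (\<forall>(t, I)\<in>P. \<forall>(s, J)\<in>P. (t, I) \<noteq> (s, J) \<longrightarrow> interior I \<inter> interior J = {}) \<and>
     (\<Union>(t, I)\<in>P. I) = {0..1}"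

definition perron_partition :: "(real \<times> real set) set \<Rightarrow> bool" where
  "perron_partition P \<longleftrightarrow> tagged_partition P \<and> (\<forall>(t, I)\<in>P. t \<in> I)"

lemma perron_partition_iff_tagged_division:
  "perron_partition P \<longleftrightarrow> P tagged_division_of {0..1}"
proof
  assume P: "perron_partition P"
  note D = P[unfolded perron_partition_def tagged_partition_def]
  show "P tagged_division_of {0..1}"
  proof (rule tagged_division_ofI)
    show "finite P" using D by simp
    show "x \<in> K" if "(x, K) \<in> P" for x K using D that by auto
    show "K \<subseteq> {0..1}" if "(x, K) \<in> P" for x K using D that by auto
    show "\<exists>a b. K = cbox a b" if "(x, K) \<in> P" for x K
    proof -
      have "\<forall>(t, I)\<in>P. t \<in> {0..1} \<and> I \<subseteq> {0..1} \<and> (\<exists>a b. a \<le> b \<and> I = {a..b})"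
        using D by (elim conjE)
      from bspec[OF this that] obtain a b where "K = {a..b}" by (simp only: prod.case) blast
      then show ?thesis unfolding cbox_interval by blast
    qed
    show "interior K1 \<inter> interior K2 = {}"
      if "(x1, K1) \<in> P" "(x2, K2) \<in> P" "(x1, K1) \<noteq> (x2, K2)" for x1 K1 x2 K2
    proof -
      have "\<forall>(t, I)\<in>P. \<forall>(s, J)\<in>P. (t, I) \<noteq> (s, J) \<longrightarrow> interior I \<inter> interior J = {}"
        using D by (elim conjE)
      from bspec[OF bspec[OF this that(1), simplified] that(2)] show ?thesis using that(3) by simp
    qed
    have "(\<Union>(t, I)\<in>P. I) = {0..1}" using D by (elim conjE)
    moreover have "\<Union>{K. \<exists>x. (x, K) \<in> P} = (\<Union>(t, I)\<in>P. I)" by auto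
    ultimately show "\<Union>{K. \<exists>x. (x, K) \<in> P} = {0..1}" by (rule trans[rotated])
  qed
next
  assume P: "P tagged_division_of {0..1}"
  note D = tagged_division_ofD[OF P]
  have 1: "\<exists>a b. a \<le> b \<and> I = {a..b}" if "(t, I) \<in> P" for t I
  proof -
    from D(4)[OF that] obtain a b where "I = cbox a b" by blast
    then have "I = {a..b}" by (simp only: cbox_interval)
    moreover have "a \<le> b" using D(2)[OF that] calculation by simp
    ultimately show ?thesis by blast
  qed
  have 2: "(\<Union>(t, I)\<in>P. I) = {0..1}" using D(6) by auto
  have 3: "t \<in> {0..1} \<and> I \<subseteq> {0..1} \<and> (\<exists>a b. a \<le> b \<and> I = {a..b})" if "(t, I) \<in> P" for t I
    using D(2)[OF that] D(3)[OF that] 1[OF that] by blast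
  have 4: "interior I \<inter> interior J = {}"
    if "(t, I) \<in> P" "(s, J) \<in> P" "(t, I) \<noteq> (s, J)" for t I s J
    using D(5) that by blast
  have "tagged_partition P"
    unfolding tagged_partition_def
  proof (intro conjI)
    show "\<forall>(t, I)\<in>P. \<forall>(s, J)\<in>P. (t, I) \<noteq> (s, J) \<longrightarrow> interior I \<inter> interior J = {}"
      by (intro ballI case_prodI2 impI) (use 4 in simp)
  qed (use D(1) 3 2 in auto)
  then show "perron_partition P"
    unfolding perron_partition_def using D(2) by auto
qed

definition gauge01 :: "(real \<Rightarrow> real) \<Rightarrow> bool" where
  "gauge01 \<delta> \<longleftrightarrow> (\<forall>t\<in>{0..1}. \<delta> t > 0)"

text \<open>Measurability of a gauge is Lebesgue measurability on [0,1].\<close>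

definition measurable_gauge01 :: "(real \<Rightarrow> real) \<Rightarrow> bool" where
  "measurable_gauge01 \<delta> \<longleftrightarrow> gauge01 \<delta> \<and> \<delta> \<in> borel_measurable (lebesgue_on {0..1})"

definition gauge_fine :: "(real \<Rightarrow> real) \<Rightarrow> (real \<times> real set) set \<Rightarrow> bool" where
  "gauge_fine \<delta> P \<longleftrightarrow> (\<forall>(t, I)\<in>P. I \<subseteq> {t - \<delta> t <..< t + \<delta> t})"

text \<open>The sum over \<open>P\<close> is the Minkowski sum, using the additive structure on sets from
  \<^theory>\<open>HOL-Library.Set_Algebras\<close>. It need not be closed; the Hausdorff distance does not
  distinguish a set from its closure.\<close>

definition riemann_sum :: "(real \<Rightarrow> 'a::real_normed_vector set) \<Rightarrow> (real \<times> real set) set \<Rightarrow> 'a set" where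
  "riemann_sum \<Gamma> P = (\<Sum>(t, I)\<in>P. (\<lambda>x. measure lborel I *\<^sub>R x) ` \<Gamma> t)"

text \<open>The parameters \<open>G\<close> and \<open>Q\<close> are the class of admissible gauges and the class of admissible
  partitions, respectively.\<close>

definition has_cb_integral ::
  "((real \<Rightarrow> real) \<Rightarrow> bool) \<Rightarrow> ((real \<times> real set) set \<Rightarrow> bool) \<Rightarrow>
   (real \<Rightarrow> 'a::real_normed_vector set) \<Rightarrow> 'a set \<Rightarrow> bool" where
  "has_cb_integral G Q \<Gamma> C \<longleftrightarrow>
     C \<in> cb \<and>
     (\<forall>\<epsilon>>0. \<exists>\<delta>. G \<delta> \<and>
        (\<forall>P. Q P \<and> gauge_fine \<delta> P \<longrightarrow> hausdorff_dist C (riemann_sum \<Gamma> P) < \<epsilon>))"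

definition has_henstock_integral :: "(real \<Rightarrow> 'a::real_normed_vector set) \<Rightarrow> 'a set \<Rightarrow> bool" where
  "has_henstock_integral = has_cb_integral gauge01 perron_partition"

definition has_H_integral :: "(real \<Rightarrow> 'a::real_normed_vector set) \<Rightarrow> 'a set \<Rightarrow> bool" where
  "has_H_integral = has_cb_integral measurable_gauge01 perron_partition"

definition has_mcshane_integral :: "(real \<Rightarrow> 'a::real_normed_vector set) \<Rightarrow> 'a set \<Rightarrow> bool" where
  "has_mcshane_integral = has_cb_integral gauge01 tagged_partition"

definition has_birkhoff_integral :: "(real \<Rightarrow> 'a::real_normed_vector set) \<Rightarrow> 'a set \<Rightarrow> bool" where
  "has_birkhoff_integral = has_cb_integral measurable_gauge01 tagged_partition"

definition henstock_integrable :: "(real \<Rightarrow> 'a::real_normed_vector set) \<Rightarrow> bool" where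
  "henstock_integrable \<Gamma> \<longleftrightarrow> (\<exists>C. has_henstock_integral \<Gamma> C)"

definition H_integrable :: "(real \<Rightarrow> 'a::real_normed_vector set) \<Rightarrow> bool" where
  "H_integrable \<Gamma> \<longleftrightarrow> (\<exists>C. has_H_integral \<Gamma> C)"

definition mcshane_integrable :: "(real \<Rightarrow> 'a::real_normed_vector set) \<Rightarrow> bool" where
  "mcshane_integrable \<Gamma> \<longleftrightarrow> (\<exists>C. has_mcshane_integral \<Gamma> C)"

definition birkhoff_integrable :: "(real \<Rightarrow> 'a::real_normed_vector set) \<Rightarrow> bool" where
  "birkhoff_integrable \<Gamma> \<longleftrightarrow> (\<exists>C. has_birkhoff_integral \<Gamma> C)"

definition restrict_multi :: "(real \<Rightarrow> 'a::real_normed_vector set) \<Rightarrow> real set \<Rightarrow> real \<Rightarrow> 'a set" where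
  "restrict_multi \<Gamma> I t = (if t \<in> I then \<Gamma> t else {0})"

definition henstock_integral :: "(real \<Rightarrow> 'a::real_normed_vector set) \<Rightarrow> real set \<Rightarrow> 'a set" where
  "henstock_integral \<Gamma> I = (THE C. has_henstock_integral (restrict_multi \<Gamma> I) C)"

definition H_integral :: "(real \<Rightarrow> 'a::real_normed_vector set) \<Rightarrow> real set \<Rightarrow> 'a set" where
  "H_integral \<Gamma> I = (THE C. has_H_integral (restrict_multi \<Gamma> I) C)"

text \<open>Extended-real valued, so that the supremum of an unbounded family is \<open>\<infinity>\<close>.\<close>

definition set_variation :: "(real set \<Rightarrow> 'a::real_normed_vector set) \<Rightarrow> real set \<Rightarrow> ereal" where
  "set_variation \<Phi> I = (SUP d\<in>{d. d division_of I}. ereal (\<Sum>J\<in>d. set_norm (\<Phi> J)))"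

end

theory Submission
  imports Defs
begin

text \<open>By the Hahn--Banach theorem the Hausdorff distance of bounded convex sets is the supremum of
  the differences of their support functionals over the dual unit ball. So the claim concerns the
  scalar family of the functions that send t to the support functional of \<open>\<Gamma> t\<close>, with one gauge for
  the whole family.

  Finite variation makes this family uniformly integrable. Together with Henstock's lemma this
  shows that the averages over a fine grid approximate all members uniformly in mean. A free tag
  whose value is close to the average over its cell contributes little. The intervals of the
  remaining tags t lie in balls around t, and by Vitali's covering lemma their union is controlled by
  disjoint balls of this kind. These form a partial Perron partition, so Henstock's lemma shows that
  their total length is small, whether or not the gauge is measurable.\<close>

section \<open>Sublinear functionals and the Hahn--Banach theorem\<close>

text \<open>The obstacle is that the gauge must be chosen before the functional, whereas the set of
  tags at which a member of the family is far from its local average varies with the member. Such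
  tags cannot be removed by shrinking the gauge; only their total length can be bounded uniformly.
  Pointwise suprema over the dual ball may fail to be measurable, so the argument works with
  quantities that are uniform over the family: integrals of envelopes of finite subfamilies, mean
  deviations on a fixed grid, and lengths of disjoint balls. Cell averages replace Lebesgue points
  for the same reason, since one grid serves all members.

  A short interval may also carry a tag with a huge value, so a small total length is useful only
  among tags with a common bound. Henstock's lemma on one interval at t bounds all members at t in
  terms of the gauge at t. This leaves countably many classes of tags, and their errors are made
  summable.\<close>

definition sublinear :: "('a::real_vector \<Rightarrow> real) \<Rightarrow> bool" where
  "sublinear p \<longleftrightarrow> (\<forall>x y. p (x + y) \<le> p x + p y) \<and> (\<forall>c x. 0 \<le> c \<longrightarrow> p (c *\<^sub>R x) = c * p x)"

lemma sublinear_add: "sublinear p \<Longrightarrow> p (x + y) \<le> p x + p y"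
  and sublinear_scale: "sublinear p \<Longrightarrow> 0 \<le> c \<Longrightarrow> p (c *\<^sub>R x) = c * p x"
  by (auto simp: sublinear_def)

lemma sublinear_zero: "sublinear p \<Longrightarrow> p 0 = 0"
  using sublinear_scale[of p 0 0] by simp

lemma sublinear_minus_le: "sublinear p \<Longrightarrow> - p (- x) \<le> p x"
  using sublinear_add[of p x "- x"] sublinear_zero[of p] by simp

text \<open>Shared by the three infima below: the perturbation in a direction \<open>w\<close>, the
  lower bound of a chain, and the functional that separates a point from a convex set. Only an
  element below \<open>a + b\<close> is demanded, since sums of values are in general not
  values.\<close>

lemma sublinear_Inf:
  fixes R :: "'a::real_vector \<Rightarrow> real set"
  assumes ne: "\<And>x. R x \<noteq> {}" and bdd: "\<And>x. bdd_below (R x)"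
    and add: "\<And>x y a b. a \<in> R x \<Longrightarrow> b \<in> R y \<Longrightarrow> \<exists>c\<in>R (x + y). c \<le> a + b"
    and scale: "\<And>c x a. 0 < c \<Longrightarrow> a \<in> R x \<Longrightarrow> c * a \<in> R (c *\<^sub>R x)"
  shows "sublinear (\<lambda>x. Inf (R x))"
proof -
  have A: "Inf (R (x + y)) \<le> Inf (R x) + Inf (R y)" for x y
  proof (rule field_le_epsilon)
    fix e :: real assume "e > 0"
    then obtain a b where a: "a \<in> R x" "a < Inf (R x) + e/2" and b: "b \<in> R y" "b < Inf (R y) + e/2"
      using cInf_lessD[OF ne, of x "Inf (R x) + e/2"] cInf_lessD[OF ne, of y "Inf (R y) + e/2"] by auto
    obtain c where "c \<in> R (x + y)" "c \<le> a + b" using add[OF a(1) b(1)] by blast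
    then show "Inf (R (x + y)) \<le> Inf (R x) + Inf (R y) + e"
      using cInf_lower[OF _ bdd] a b by fastforce
  qed
  have le: "Inf (R (c *\<^sub>R x)) \<le> c * Inf (R x)" if "c > 0" for c x
  proof -
    have "Inf (R (c *\<^sub>R x)) / c \<le> Inf (R x)"
    proof (rule cInf_greatest[OF ne])
      fix a assume "a \<in> R x"
      then have "Inf (R (c *\<^sub>R x)) \<le> c * a" by (intro cInf_lower bdd scale that)
      then show "Inf (R (c *\<^sub>R x)) / c \<le> a" using that by (simp add: field_simps)
    qed
    then show ?thesis using that by (simp add: field_simps)
  qed
  have pos: "Inf (R (c *\<^sub>R x)) = c * Inf (R x)" if "c > 0" for c x
  proof (rule antisym[OF le[OF that]])
    have "Inf (R x) \<le> (1/c) * Inf (R (c *\<^sub>R x))" using le[of "1/c" "c *\<^sub>R x"] that by simp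
    then show "c * Inf (R x) \<le> Inf (R (c *\<^sub>R x))" using that by (simp add: field_simps)
  qed
  \<comment> \<open>Scaling the origin by 2 makes the value its own double.\<close>
  have "Inf (R 0) = 0" using pos[of 2 0] by simp
  then have "Inf (R (c *\<^sub>R x)) = c * Inf (R x)" if "c \<ge> 0" for c x
    using pos[of c x] that by (cases "c = 0") auto
  with A show ?thesis by (auto simp: sublinear_def)
qed

text \<open>For fixed \<open>w\<close>, the infimum over s \<ge> 0 of q (v + s w) - s q w is again
  sublinear and lies below \<open>q\<close> (take s = 0), so by minimality it equals
  \<open>q\<close>. Taking s = 1 then gives superadditivity.\<close>

lemma minimal_sublinear_imp_linear:
  assumes q: "sublinear q" and minimal: "\<And>q'. sublinear q' \<Longrightarrow> q' \<le> q \<Longrightarrow> q' = q"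
  shows "linear q"
proof -
  have super: "q v + q w \<le> q (v + w)" for v w
  proof -
    define R where "R = (\<lambda>v. (\<lambda>s. q (v + s *\<^sub>R w) - s * q w) ` {0..})"
    have bdd: "bdd_below (R v)" for v
    proof (rule bdd_belowI[of _ "- q (- v)"])
      fix a assume "a \<in> R v"
      then obtain s where s: "s \<ge> 0" "a = q (v + s *\<^sub>R w) - s * q w" by (auto simp: R_def)
      have "s * q w \<le> q (v + s *\<^sub>R w) + q (- v)"
        using sublinear_add[OF q, of "v + s *\<^sub>R w" "- v"] sublinear_scale[OF q s(1)] by simp
      then show "- q (- v) \<le> a" using s by simp
    qed
    have low: "Inf (R v) \<le> q (v + s *\<^sub>R w) - s * q w" if "s \<ge> 0" for v s
      by (rule cInf_lower[OF _ bdd]) (use that in \<open>auto simp: R_def\<close>)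
    have "sublinear (\<lambda>v. Inf (R v))"
    proof (rule sublinear_Inf[OF _ bdd])
      fix x y a b assume "a \<in> R x" "b \<in> R y"
      then obtain s t where st: "s \<ge> 0" "a = q (x + s *\<^sub>R w) - s * q w"
          "t \<ge> 0" "b = q (y + t *\<^sub>R w) - t * q w"
        by (auto simp: R_def)
      have "q (x + y + (s + t) *\<^sub>R w) \<le> q (x + s *\<^sub>R w) + q (y + t *\<^sub>R w)"
        using sublinear_add[OF q, of "x + s *\<^sub>R w" "y + t *\<^sub>R w"] by (simp add: algebra_simps)
      then show "\<exists>c\<in>R (x + y). c \<le> a + b"
        using st by (auto simp: R_def algebra_simps intro!: bexI[of _ "s + t"])
    next
      fix c :: real and x a assume c: "0 < c" and "a \<in> R x"
      then obtain s where s: "s \<ge> 0" "a = q (x + s *\<^sub>R w) - s * q w" by (auto simp: R_def)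
      have "c * q (x + s *\<^sub>R w) = q (c *\<^sub>R x + (c * s) *\<^sub>R w)"
        using sublinear_scale[OF q, of c "x + s *\<^sub>R w"] c by (simp add: algebra_simps)
      then show "c * a \<in> R (c *\<^sub>R x)"
        using s c unfolding R_def
        by (intro image_eqI[of _ _ "c * s"]) (auto simp: right_diff_distrib mult.assoc)
    qed (auto simp: R_def)
    moreover have "(\<lambda>v. Inf (R v)) \<le> q" using low[of 0] by (auto intro: le_funI)
    ultimately have "(\<lambda>v. Inf (R v)) = q" by (rule minimal)
    then show ?thesis using low[of 1 v] by (auto dest: fun_cong[of _ _ v])
  qed
  have add: "q (v + w) = q v + q w" for v w
    using super sublinear_add[OF q] by (intro antisym)
  have neg: "q (- v) = - q v" for v using add[of v "- v"] sublinear_zero[OF q] by simp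
  show ?thesis
  proof (rule linearI)
    show "q (c *\<^sub>R v) = c *\<^sub>R q v" for c v
      using sublinear_scale[OF q, of c v] sublinear_scale[OF q, of "- c" v] neg[of "c *\<^sub>R v"]
      by (cases "c \<ge> 0") auto
  qed (rule add)
qed

text \<open>The Hahn-Banach theorem. Zorn's lemma supplies a minimal sublinear functional below
  \<open>p\<close>, because the pointwise infimum of a chain stays above
  \<open>- p (- x)\<close>.\<close>

theorem sublinear_dominates_linear:
  assumes p: "sublinear p"
  shows "\<exists>l. linear l \<and> (\<forall>x. l x \<le> p x)"
proof -
  define A where "A = {q. sublinear q \<and> q \<le> p}"
  \<comment> \<open>\<open>predicate_Zorn\<close> yields maximal elements, so the order is
    reversed.\<close>
  define P :: "('a \<Rightarrow> real) \<Rightarrow> ('a \<Rightarrow> real) \<Rightarrow> bool" where "P = (\<lambda>a b. b \<le> a)"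
  have "\<exists>m\<in>A. \<forall>a\<in>A. P m a \<longrightarrow> a = m"
  proof (rule predicate_Zorn)
    show "partial_order_on A (relation_of P A)"
      by (auto simp: partial_order_on_def preorder_on_def refl_on_def trans_def antisym_def relation_of_def P_def
          intro: order_trans)
  next
    fix C assume "C \<in> Chains (relation_of P A)"
    then have CA: "C \<subseteq> A" and ch: "\<And>a b. a \<in> C \<Longrightarrow> b \<in> C \<Longrightarrow> a \<le> b \<or> b \<le> a"
      by (auto simp: Chains_def relation_of_def P_def)
    show "\<exists>u\<in>A. \<forall>a\<in>C. P a u"
    proof (cases "C = {}")
      case True
      then show ?thesis using p by (auto simp: A_def)
    next
      case False
      define R where "R = (\<lambda>x. (\<lambda>q. q x) ` C)"
      have sl: "sublinear q" "q x \<le> p x" if "q \<in> C" for q x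
        using that CA by (auto simp: A_def le_fun_def)
      have bdd: "bdd_below (R x)" for x
        unfolding R_def
      proof (rule bdd_belowI2[of _ "- p (- x)"])
        fix q assume "q \<in> C"
        then show "- p (- x) \<le> q x" using sublinear_minus_le[OF sl(1), of q x] sl(2)[of q "- x"] by simp
      qed
      have "sublinear (\<lambda>x. Inf (R x))"
      proof (rule sublinear_Inf[OF _ bdd])
        show "R x \<noteq> {}" for x using False by (simp add: R_def)
        fix x y a b assume "a \<in> R x" "b \<in> R y"
        then obtain f g where fg: "f \<in> C" "g \<in> C" "a = f x" "b = g y" by (auto simp: R_def)
        \<comment> \<open>One member of the chain has to serve at both points.\<close>
        define k where "k = (if f \<le> g then f else g)"
        have "k \<in> C" "k x \<le> f x" "k y \<le> g y" using fg ch[of f g] by (auto simp: k_def le_fun_def)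
        then show "\<exists>c\<in>R (x + y). c \<le> a + b"
          using sublinear_add[OF sl(1), of k x y] fg by (auto simp: R_def intro!: bexI[of _ k])
      next
        fix c :: real and x a assume "0 < c" "a \<in> R x"
        then show "c * a \<in> R (c *\<^sub>R x)"
          using sublinear_scale[OF sl(1)] by (force simp: R_def)
      qed
      moreover have "Inf (R x) \<le> q x" if "q \<in> C" for q x
        using that by (intro cInf_lower bdd) (auto simp: R_def)
      ultimately show ?thesis
        using False sl(2) unfolding A_def P_def le_fun_def
        by (intro bexI[of _ "\<lambda>x. Inf (R x)"]) (auto, meson equals0I order_trans)
    qed
  qed
  then obtain m where m: "m \<in> A" "\<And>a. a \<in> A \<Longrightarrow> a \<le> m \<Longrightarrow> a = m" by (auto simp: P_def)
  have "linear m"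
    by (rule minimal_sublinear_imp_linear) (use m in \<open>auto simp: A_def intro: order_trans\<close>)
  then show ?thesis using m(1) by (auto simp: A_def le_fun_def)
qed

section \<open>Support functionals\<close>

text \<open>The one-sided bound suffices: applied to x and - x it gives the bound on the modulus, so
  these are exactly the continuous functionals of norm at most 1.\<close>

definition dual_ball :: "('a::real_normed_vector \<Rightarrow> real) set" where
  "dual_ball = {l. linear l \<and> (\<forall>x. l x \<le> norm x)}"

definition support :: "('a::real_normed_vector \<Rightarrow> real) \<Rightarrow> 'a set \<Rightarrow> real" where
  "support l A = (SUP a\<in>A. l a)"

lemma dual_ball_linear: "l \<in> dual_ball \<Longrightarrow> linear l"
  by (simp add: dual_ball_def)

lemma dual_ball_abs_le:
  assumes "l \<in> dual_ball"
  shows "\<bar>l x\<bar> \<le> norm x"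
proof -
  have "l x \<le> norm x" "l (- x) \<le> norm (- x)" using assms unfolding dual_ball_def by blast+
  moreover have "l (- x) = - l x" using dual_ball_linear[OF assms] by (rule linear_neg)
  ultimately show ?thesis by simp
qed

lemma dual_ball_diff_le: "l \<in> dual_ball \<Longrightarrow> \<bar>l x - l y\<bar> \<le> dist x y"
  using dual_ball_abs_le[of l "x - y"] dual_ball_linear[of l] by (simp add: linear_diff dist_norm)

lemma zero_in_dual_ball: "(\<lambda>_. 0) \<in> dual_ball"
  by (simp add: dual_ball_def linear_iff)

text \<open>Hahn-Banach is applied to the infimum over s \<ge> 0 and b in \<open>B\<close> of norm
  (v + s (x - b)) - s d, where d is the distance. The choice s = 0 puts it below the norm; the
  choice s = 1 at v = - (x - b) makes it at most - d there.\<close>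

lemma separating_functional:
  fixes B :: "'a::real_normed_vector set"
  assumes B: "convex B" "B \<noteq> {}"
  shows "\<exists>l\<in>dual_ball. \<forall>b\<in>B. infdist x B \<le> l x - l b"
proof -
  define d where "d = infdist x B"
  define R where "R = (\<lambda>v. (\<lambda>(s,b). norm (v + s *\<^sub>R (x - b)) - s * d) ` ({0..} \<times> B))"
  have RI: "norm (v + s *\<^sub>R (x - b)) - s * d \<in> R v" if "s \<ge> 0" "b \<in> B" for v s b
    unfolding R_def using that by (intro image_eqI[of _ _ "(s,b)"]) auto
  have bdd: "bdd_below (R v)" for v
  proof (rule bdd_belowI[of _ "- norm v"])
    fix a assume "a \<in> R v"
    then obtain s b where s: "s \<ge> 0" "b \<in> B" "a = norm (v + s *\<^sub>R (x - b)) - s * d" by (auto simp: R_def)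
    have "d \<le> norm (x - b)" unfolding d_def using infdist_le[OF s(2), of x] by (simp add: dist_norm)
    then have "s * d \<le> norm (s *\<^sub>R (x - b))" using s by (simp add: mult_left_mono)
    also have "\<dots> \<le> norm (v + s *\<^sub>R (x - b)) + norm v"
      using norm_triangle_ineq4[of "v + s *\<^sub>R (x - b)" v] by simp
    finally show "- norm v \<le> a" using s by simp
  qed
  have "sublinear (\<lambda>v. Inf (R v))"
  proof (rule sublinear_Inf[OF _ bdd])
    show "R v \<noteq> {}" for v using B(2) by (auto simp: R_def)
    fix v w a a' assume "a \<in> R v" "a' \<in> R w"
    then obtain s b t c where st: "s \<ge> 0" "b \<in> B" "a = norm (v + s *\<^sub>R (x - b)) - s * d"
        "t \<ge> 0" "c \<in> B" "a' = norm (w + t *\<^sub>R (x - c)) - t * d"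
      by (auto simp: R_def)
    show "\<exists>u\<in>R (v + w). u \<le> a + a'"
    proof -
      \<comment> \<open>Convexity enters here: the mean of \<open>b\<close> and \<open>c\<close>
        with weights proportional to \<open>s\<close> and \<open>t\<close> merges the two
        directions.\<close>
      obtain e where e: "e \<in> B" "(s + t) *\<^sub>R (x - e) = s *\<^sub>R (x - b) + t *\<^sub>R (x - c)"
      proof (cases "s + t = 0")
        case True
        then have "s = 0" "t = 0" using st by auto
        then show ?thesis using that[of b] st by simp
      next
        case False
        then have pos: "s + t > 0" using st by auto
        define e where "e = (s/(s+t)) *\<^sub>R b + (t/(s+t)) *\<^sub>R c"
        have "e \<in> B" unfolding e_def
          by (rule convexD[OF B(1)]) (use st pos in \<open>auto simp: add_divide_distrib[symmetric]\<close>)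
        moreover have "(s + t) *\<^sub>R e = s *\<^sub>R b + t *\<^sub>R c"
          unfolding e_def using pos by (simp add: scaleR_add_right)
        ultimately show ?thesis using that[of e] by (simp add: algebra_simps)
      qed
      have "norm (v + w + (s + t) *\<^sub>R (x - e)) \<le> norm (v + s *\<^sub>R (x - b)) + norm (w + t *\<^sub>R (x - c))"
        unfolding e(2) using norm_triangle_ineq[of "v + s *\<^sub>R (x - b)" "w + t *\<^sub>R (x - c)"]
        by (simp add: algebra_simps)
      then show ?thesis
        using RI[of "s + t" e "v + w"] e st by (intro bexI) (auto simp: algebra_simps)
    qed
  next
    fix c :: real and v a assume c: "0 < c" and "a \<in> R v"
    then obtain s b where s: "s \<ge> 0" "b \<in> B" "a = norm (v + s *\<^sub>R (x - b)) - s * d" by (auto simp: R_def)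
    have "c * norm (v + s *\<^sub>R (x - b)) = norm (c *\<^sub>R (v + s *\<^sub>R (x - b)))" using c by simp
    also have "\<dots> = norm (c *\<^sub>R v + (c * s) *\<^sub>R (x - b))"
      by (simp only: scaleR_add_right scaleR_scaleR)
    finally have "c * a = norm (c *\<^sub>R v + (c * s) *\<^sub>R (x - b)) - (c * s) * d"
      using s by (simp add: right_diff_distrib mult.assoc del: scaleR_add_right scaleR_diff_right)
    then show "c * a \<in> R (c *\<^sub>R v)" using RI[of "c * s" b "c *\<^sub>R v"] s c by simp
  qed
  then obtain l where l: "linear l" "\<And>v. l v \<le> Inf (R v)" using sublinear_dominates_linear by blast
  have le: "l v \<le> norm (v + s *\<^sub>R (x - b)) - s * d" if "s \<ge> 0" "b \<in> B" for v s b
    using l(2)[of v] cInf_lower[OF RI[OF that, of v] bdd] by simp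
  have "l \<in> dual_ball" using l(1) le[of 0] B(2) by (auto simp: dual_ball_def)
  moreover have "d \<le> l x - l b" if "b \<in> B" for b
    using le[of 1 b "- (x - b)"] that linear_diff[OF l(1), of b x] by simp
  ultimately show ?thesis unfolding d_def by blast
qed

lemma bdd_above_dual_ball:
  assumes "l \<in> dual_ball" "bounded A"
  shows "bdd_above (l ` A)"
proof -
  obtain b where "\<And>x. x \<in> A \<Longrightarrow> norm x \<le> b" using assms(2) by (auto simp: bounded_iff)
  then show ?thesis using dual_ball_abs_le[OF assms(1)]
    by (intro bdd_aboveI2[of _ _ b]) (meson abs_le_D1 order_trans)
qed

lemma support_upper: "l \<in> dual_ball \<Longrightarrow> bounded A \<Longrightarrow> a \<in> A \<Longrightarrow> l a \<le> support l A"
  unfolding support_def by (rule cSUP_upper[OF _ bdd_above_dual_ball])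

lemma support_least: "A \<noteq> {} \<Longrightarrow> (\<And>a. a \<in> A \<Longrightarrow> l a \<le> c) \<Longrightarrow> support l A \<le> c"
  unfolding support_def by (rule cSUP_least)

lemma support_abs_le_set_norm:
  assumes l: "l \<in> dual_ball" and A: "A \<noteq> {}" "bounded A"
  shows "\<bar>support l A\<bar> \<le> set_norm A"
proof -
  obtain b where "\<And>x. x \<in> A \<Longrightarrow> norm x \<le> b" using A(2) by (auto simp: bounded_iff)
  then have up: "norm a \<le> set_norm A" if "a \<in> A" for a
    unfolding set_norm_def using that by (intro cSUP_upper bdd_aboveI2)
  obtain a where a: "a \<in> A" using A by blast
  have "support l A \<le> set_norm A"
    using dual_ball_abs_le[OF l] up by (intro support_least A(1)) (meson abs_le_D1 order_trans)
  moreover have "- set_norm A \<le> support l A"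
    using support_upper[OF l A(2) a] up[OF a] dual_ball_abs_le[OF l, of a] by linarith
  ultimately show ?thesis by simp
qed

lemma support_plus:
  assumes l: "l \<in> dual_ball" and A: "A \<noteq> {}" "bounded A" and B: "B \<noteq> {}" "bounded B"
  shows "support l (A + B) = support l A + support l B"
proof (rule antisym)
  have ladd: "l (a + b) = l a + l b" for a b using dual_ball_linear[OF l] by (rule linear_add)
  show "support l (A + B) \<le> support l A + support l B"
  proof (rule support_least)
    show "A + B \<noteq> {}" using A B by (auto simp: set_plus_def)
    show "l x \<le> support l A + support l B" if "x \<in> A + B" for x
      using that support_upper[OF l A(2)] support_upper[OF l B(2)]
      by (auto elim!: set_plus_elim simp: ladd add_mono)
  qed
  have bAB: "bounded (A + B)" using bounded_plus[OF A(2) B(2)] by (simp add: set_plus_image)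
  have "support l A \<le> support l (A + B) - support l B"
  proof (rule support_least[OF A(1)])
    fix a assume a: "a \<in> A"
    have "support l B \<le> support l (A + B) - l a"
    proof (rule support_least[OF B(1)])
      fix b assume "b \<in> B"
      then show "l b \<le> support l (A + B) - l a"
        using support_upper[OF l bAB, of "a + b"] a ladd by (auto simp: set_plus_intro)
    qed
    then show "l a \<le> support l (A + B) - support l B" by simp
  qed
  then show "support l A + support l B \<le> support l (A + B)" by simp
qed

lemma support_scaleR:
  assumes l: "l \<in> dual_ball" and A: "A \<noteq> {}" "bounded A" and c: "c \<ge> 0"
  shows "support l ((*\<^sub>R) c ` A) = c * support l A"
proof (cases "c = 0")
  case True
  have "(*\<^sub>R) c ` A = {0}" using A True by auto
  then show ?thesis using True linear_0[OF dual_ball_linear[OF l]] by (simp add: support_def)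
next
  case False
  then have c: "c > 0" using c by simp
  have ls: "l (c *\<^sub>R a) = c * l a" for a using linear_scale[OF dual_ball_linear[OF l], of c a] by simp
  have bA: "bounded ((*\<^sub>R) c ` A)" by (rule bounded_scaling[OF A(2)])
  show ?thesis
  proof (rule antisym)
    show "support l ((*\<^sub>R) c ` A) \<le> c * support l A"
      using A c support_upper[OF l A(2)] ls by (intro support_least) auto
    have "support l A \<le> support l ((*\<^sub>R) c ` A) / c"
    proof (rule support_least[OF A(1)])
      fix a assume "a \<in> A"
      then have "c * l a \<le> support l ((*\<^sub>R) c ` A)" using support_upper[OF l bA, of "c *\<^sub>R a"] ls by auto
      then show "l a \<le> support l ((*\<^sub>R) c ` A) / c" using c by (simp add: field_simps)
    qed
    then show "c * support l A \<le> support l ((*\<^sub>R) c ` A)" using c by (simp add: field_simps)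
  qed
qed

lemma support_sum:
  assumes l: "l \<in> dual_ball" and "finite S" and "\<And>i. i \<in> S \<Longrightarrow> A i \<noteq> {} \<and> bounded (A i)"
  shows "support l (sum A S) = (\<Sum>i\<in>S. support l (A i)) \<and> sum A S \<noteq> {} \<and> bounded (sum A S)"
  using assms(2,3)
proof (induction S rule: finite_induct)
  case empty
  then show ?case using linear_0[OF dual_ball_linear[OF l]]
    by (simp add: support_def set_zero)
next
  case (insert i S)
  then have "bounded (A i + sum A S)" "A i + sum A S \<noteq> {}"
    using bounded_plus[of "A i" "sum A S"] by (auto simp: set_plus_image)
  then show ?case using insert support_plus[OF l, of "A i" "sum A S"] by simp
qed

section \<open>Hausdorff distance in terms of support functionals\<close>

lemma abs_support_diff_le_hausdorff_dist:
  assumes l: "l \<in> dual_ball" and A: "A \<noteq> {}" "bounded A" and B: "B \<noteq> {}" "bounded B"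
  shows "\<bar>support l A - support l B\<bar> \<le> hausdorff_dist A B"
proof -
  have half: "support l A \<le> support l B + (SUP a\<in>A. infdist a B)"
    if A: "A \<noteq> {}" "bounded A" and B: "B \<noteq> {}" "bounded B" for A B
  proof (rule support_least[OF A(1)])
    fix a assume a: "a \<in> A"
    obtain b0 where b0: "b0 \<in> B" using B by blast
    obtain M where M: "\<And>x. x \<in> A \<Longrightarrow> dist b0 x \<le> M" using A(2) by (auto simp: bounded_any_center[of A b0])
    have "bdd_above ((\<lambda>a. infdist a B) ` A)"
      using infdist_le[OF b0] M by (intro bdd_aboveI2[of _ _ M]) (metis dist_commute order_trans)
    then have up: "infdist a B \<le> (SUP a\<in>A. infdist a B)" using a by (intro cSUP_upper)
    have "l a \<le> support l B + infdist a B"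
    proof (rule field_le_epsilon)
      fix e :: real assume "e > 0"
      then obtain b where b: "b \<in> B" "dist a b < infdist a B + e"
        using cInf_lessD[of "dist a ` B" "infdist a B + e"] B(1) by (auto simp: infdist_def)
      then show "l a \<le> support l B + infdist a B + e"
        using dual_ball_diff_le[OF l, of a b] support_upper[OF l B(2) b(1)] by linarith
    qed
    then show "l a \<le> support l B + (SUP a\<in>A. infdist a B)" using up by simp
  qed
  show ?thesis using half[OF A B] half[OF B A] by (auto simp: hausdorff_dist_def)
qed

text \<open>The separating functional of the point \<open>x\<close> loses at least the distance on
  all of \<open>B\<close>, so the hypothesis for this one functional decides.\<close>

lemma infdist_le_of_support_le:
  fixes B :: "'a::real_normed_vector set"
  assumes B: "convex B" "B \<noteq> {}" "bounded B" and r: "\<And>l. l \<in> dual_ball \<Longrightarrow> l x \<le> support l B + r"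
  shows "infdist x B \<le> r"
proof -
  obtain l where l: "l \<in> dual_ball" "\<And>b. b \<in> B \<Longrightarrow> infdist x B \<le> l x - l b"
    using separating_functional[OF B(1,2)] by blast
  have "support l B \<le> l x - infdist x B" using l(2) by (intro support_least B(2)) fastforce
  then show ?thesis using r[OF l(1)] by simp
qed

lemma hausdorff_dist_le_of_support:
  fixes A B :: "'a::real_normed_vector set"
  assumes A: "convex A" "A \<noteq> {}" "bounded A" and B: "convex B" "B \<noteq> {}" "bounded B"
    and r: "\<And>l. l \<in> dual_ball \<Longrightarrow> \<bar>support l A - support l B\<bar> \<le> r"
  shows "hausdorff_dist A B \<le> r"
proof -
  have "infdist a B \<le> r" if "a \<in> A" for a
    using r support_upper[OF _ A(3) that] by (intro infdist_le_of_support_le B) (fastforce simp: abs_le_iff)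
  moreover have "infdist b A \<le> r" if "b \<in> B" for b
    using r support_upper[OF _ B(3) that] by (intro infdist_le_of_support_le A) (fastforce simp: abs_le_iff)
  ultimately show ?thesis using A(2) B(2) by (auto simp: hausdorff_dist_def intro!: cSUP_least)
qed

text \<open>Closedness enters: a point at distance 0 belongs to the set. This gives the uniqueness
  behind the definite descriptions of the integrals.\<close>

lemma cb_eq_of_support_eq:
  assumes C: "C \<in> cb" "C' \<in> cb" and eq: "\<And>l. l \<in> dual_ball \<Longrightarrow> support l C = support l C'"
  shows "C = C'"
proof -
  have half: "C \<subseteq> C'" if C: "C \<in> cb" "C' \<in> cb" and eq: "\<And>l. l \<in> dual_ball \<Longrightarrow> support l C = support l C'"
    for C C' :: "'a set"
  proof
    fix x assume x: "x \<in> C"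
    have "infdist x C' \<le> 0"
      using C eq x support_upper[of _ C x] by (intro infdist_le_of_support_le) (auto simp: cb_def)
    then show "x \<in> C'" using C in_closed_iff_infdist_zero[of C' x] infdist_nonneg[of x C']
      by (auto simp: cb_def)
  qed
  show ?thesis using half[OF C eq] half[OF C(2,1)] eq by auto
qed

text \<open>Completeness of \<open>cb\<close> under the Hausdorff distance, with the limit written as an
  intersection of half-spaces.\<close>

lemma cb_limit_exists:
  fixes R :: "nat \<Rightarrow> 'a::banach set"
  assumes R: "\<And>n. convex (R n)" "\<And>n. R n \<noteq> {}" "\<And>n. bounded (R n)"
    and s: "\<And>n l. l \<in> dual_ball \<Longrightarrow> \<bar>support l (R n) - s l\<bar> \<le> (1/2)^n"
  shows "\<exists>C\<in>cb. \<forall>l\<in>dual_ball. support l C = s l"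
proof -
  define C where "C = {x. \<forall>l\<in>dual_ball. l x \<le> s l}"
  have near: "infdist x (R n) \<le> (1/2)^n" if "\<And>l. l \<in> dual_ball \<Longrightarrow> l x \<le> s l" for x n
  proof (rule infdist_le_of_support_le[OF R])
    fix l :: "'a \<Rightarrow> real" assume l: "l \<in> dual_ball"
    show "l x \<le> support l (R n) + (1/2)^n" using s[OF l, of n] that[OF l] by linarith
  qed
  \<comment> \<open>The two errors add up to 3/2 * (1/2)^n; the constant 2 leaves room because
    \<open>infdist\<close> need not be attained.\<close>
  have step: "\<exists>y\<in>R (Suc n). dist x y < 2 * (1/2)^n" if x: "x \<in> R n" for x n
  proof -
    have "infdist x (R (Suc n)) \<le> (1/2)^n + (1/2)^Suc n"
    proof (intro infdist_le_of_support_le R)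
      fix l :: "'a \<Rightarrow> real" assume l: "l \<in> dual_ball"
      show "l x \<le> support l (R (Suc n)) + ((1/2)^n + (1/2)^Suc n)"
        using support_upper[OF l R(3) x] s[OF l, of n] s[OF l, of "Suc n"] by linarith
    qed
    also have "\<dots> < 2 * (1/2)^n" by simp
    finally show ?thesis using cInf_lessD[of "dist x ` R (Suc n)"] R(2)
      by (auto simp: infdist_def)
  qed
  \<comment> \<open>Steps of length 2 * (1/2)^(n + k) sum to 4 * (1/2)^n, so by completeness the
    walk through the sets \<open>R (n + k)\<close> converges. The limit satisfies every defining
    inequality of \<open>C\<close>, since the errors of these sets tend to 0.\<close>
  have point: "\<exists>x\<in>C. dist a x \<le> 4 * (1/2)^n" if a: "a \<in> R n" for a n
  proof -
    have "\<exists>f. \<forall>k. (f k \<in> R (n + k) \<and> (k = 0 \<longrightarrow> f k = a)) \<and> dist (f k) (f (Suc k)) < 2 * (1/2)^(n + k)"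
      using a step by (intro dependent_nat_choice) auto
    then obtain f where f: "\<And>k. f k \<in> R (n + k)" "f 0 = a"
        "\<And>k. dist (f k) (f (Suc k)) < 2 * (1/2)^(n + k)" by metis
    \<comment> \<open>The subtracted term is the tail of the geometric series; with it the induction
      closes.\<close>
    have far: "dist (f i) (f (i + j)) \<le> 4 * (1/2)^(n + i) - 4 * (1/2)^(n + i + j)" for i j
    proof (induction j)
      case (Suc j)
      then show ?case
        using dist_triangle[of "f i" "f (i + Suc j)" "f (i + j)"] f(3)[of "i + j"]
        by (simp add: add.assoc)
    qed simp
    have far': "dist (f i) (f (i + j)) \<le> 4 * (1/2)^(n + i)" for i j
      using far[of i j] zero_le_power[of "1/2::real" "n + i + j"] by linarith
    have "Cauchy f"
    proof (rule metric_CauchyI)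
      fix e :: real assume "e > 0"
      then obtain N where N: "(1/2::real)^N < e/8" using real_arch_pow_inv[of "e/8" "1/2"] by auto
      have "dist (f i) (f j) < e" if "i \<ge> N" "j \<ge> N" for i j
      proof -
        have "(1/2::real)^(n + N) \<le> (1/2)^N" by (intro power_decreasing) auto
        moreover have "dist (f N) (f i) \<le> 4 * (1/2)^(n + N)" "dist (f N) (f j) \<le> 4 * (1/2)^(n + N)"
          using far'[of N "i - N"] far'[of N "j - N"] that by auto
        ultimately show ?thesis using N dist_triangle3[of "f i" "f j" "f N"] by linarith
      qed
      then show "\<exists>M. \<forall>m\<ge>M. \<forall>k\<ge>M. dist (f m) (f k) < e" by blast
    qed
    then obtain x where x: "f \<longlonglongrightarrow> x" using Cauchy_convergent convergent_def by blast
    have "x \<in> C" unfolding C_def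
    proof safe
      fix l :: "'a \<Rightarrow> real" assume l: "l \<in> dual_ball"
      have "(\<lambda>k. l (f k)) \<longlonglongrightarrow> l x"
      proof (rule metric_tendsto_imp_tendsto[OF x])
        show "\<forall>\<^sub>F k in sequentially. dist (l (f k)) (l x) \<le> dist (f k) x"
          using dual_ball_diff_le[OF l] by (simp add: dist_real_def)
      qed
      moreover have "(\<lambda>k. s l + (1/2)^(n + k)) \<longlonglongrightarrow> s l + 0"
        by (intro tendsto_intros) (simp add: power_add tendsto_mult_right_zero LIMSEQ_power_zero)
      moreover have "l (f k) \<le> s l + (1/2)^(n + k)" for k
        using support_upper[OF l R(3) f(1)[of k]] s[OF l, of "n + k"] by linarith
      ultimately have "l x \<le> s l + 0"
        by (intro LIMSEQ_le[of "\<lambda>k. l (f k)" _ "\<lambda>k. s l + (1/2)^(n + k)"]) auto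
      then show "l x \<le> s l" by simp
    qed
    moreover have "dist a x \<le> 4 * (1/2)^n"
    proof (rule LIMSEQ_le_const2)
      show "(\<lambda>k. dist a (f k)) \<longlonglongrightarrow> dist a x" by (intro tendsto_intros x)
      show "\<exists>N. \<forall>k\<ge>N. dist a (f k) \<le> 4 * (1/2)^n" using far'[of 0] f(2) by auto
    qed
    ultimately show ?thesis by blast
  qed
  have Cne: "C \<noteq> {}" using point[of _ 0] R(2)[of 0] by blast
  have Ceq: "C = (\<Inter>l\<in>dual_ball. {x. l x \<le> s l})" by (auto simp: C_def)
  have "closed C" unfolding Ceq
  proof (intro closed_INT ballI closed_Collect_le continuous_on_const)
    fix l :: "'a \<Rightarrow> real" assume l: "l \<in> dual_ball"
    show "continuous_on UNIV l"
    proof (rule continuous_onI)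
      fix x :: 'a and e :: real assume "e > 0"
      then show "\<exists>d>0. \<forall>x'\<in>UNIV. dist x' x < d \<longrightarrow> dist (l x') (l x) \<le> e"
        using dual_ball_diff_le[OF l] by (intro exI[of _ e]) (fastforce simp: dist_real_def intro: order_trans less_imp_le)
    qed
  qed
  moreover have "convex C"
  proof (rule convexI)
    fix x y :: 'a and u v :: real
    assume xy: "x \<in> C" "y \<in> C" and uv: "0 \<le> u" "0 \<le> v" "u + v = 1"
    show "u *\<^sub>R x + v *\<^sub>R y \<in> C" unfolding C_def
    proof safe
      fix l :: "'a \<Rightarrow> real" assume l: "l \<in> dual_ball"
      have "l (u *\<^sub>R x + v *\<^sub>R y) = u * l x + v * l y"
        using dual_ball_linear[OF l] by (simp add: linear_add linear_scale)
      also have "\<dots> \<le> u * s l + v * s l"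
        using xy l uv by (intro add_mono mult_left_mono) (auto simp: C_def)
      finally show "l (u *\<^sub>R x + v *\<^sub>R y) \<le> s l" using uv(3) by (simp flip: distrib_right)
    qed
  qed
  moreover have "bounded C"
  proof -
    obtain b where b: "\<And>y. y \<in> R 0 \<Longrightarrow> norm y \<le> b" using R(3)[of 0] by (auto simp: bounded_iff)
    have "norm x \<le> b + 2" if "x \<in> C" for x
    proof -
      have "infdist x (R 0) < 2" using near[of x 0] that by (auto simp: C_def)
      then obtain y where y: "y \<in> R 0" "dist x y < 2"
        using cInf_lessD[of "dist x ` R 0" 2] R(2)[of 0] by (auto simp: infdist_def)
      then show ?thesis using b[OF y(1)] norm_triangle_ineq2[of x y] by (simp add: dist_norm)
    qed
    then show ?thesis by (auto simp: bounded_iff)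
  qed
  ultimately have Ccb: "C \<in> cb" using Cne by (simp add: cb_def)
  have "support l C = s l" if l: "l \<in> dual_ball" for l
  proof (rule antisym)
    show "support l C \<le> s l" using l by (intro support_least Cne) (auto simp: C_def)
    \<comment> \<open>The bound 4 from \<open>point\<close> and the error 1 of \<open>R n\<close>
      fit into 6; any fixed multiple vanishes in the limit.\<close>
    have "s l \<le> support l C + 6 * (1/2)^n" for n
    proof -
      have "support l (R n) \<le> support l C + 4 * (1/2)^n"
      proof (rule support_least[OF R(2)])
        fix a assume "a \<in> R n"
        then obtain x where x: "x \<in> C" "dist a x \<le> 4 * (1/2)^n" using point by blast
        then show "l a \<le> support l C + 4 * (1/2)^n"
          using support_upper[OF l \<open>bounded C\<close> x(1)] dual_ball_diff_le[OF l, of a x] by linarith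
      qed
      then show ?thesis using s[OF l, of n] zero_le_power[of "1/2::real" n] by linarith
    qed
    moreover have "(\<lambda>n. support l C + 6 * (1/2)^n) \<longlonglongrightarrow> support l C + 6 * 0"
      by (intro tendsto_intros) (simp add: LIMSEQ_power_zero)
    ultimately have "s l \<le> support l C + 6 * 0" by (intro LIMSEQ_le_const) auto
    then show "s l \<le> support l C" by simp
  qed
  with Ccb show ?thesis by blast
qed

section \<open>Gauges and scalar families\<close>

text \<open>The closure properties used to build new gauges, shared by arbitrary and by measurable
  gauges, so that both integrals are treated at once.\<close>

definition gauge_class :: "((real \<Rightarrow> real) \<Rightarrow> bool) \<Rightarrow> bool" where
  "gauge_class G \<longleftrightarrow> (\<forall>\<delta>. G \<delta> \<longrightarrow> gauge01 \<delta>) \<and>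
     (\<forall>\<delta> a b r. G \<delta> \<longrightarrow> r > 0 \<longrightarrow>
        G (\<lambda>t. if t = a \<or> t = b then min (\<delta> t) r else min (\<delta> t) (infdist t {a, b}))) \<and>
     (\<forall>\<delta> \<delta>s \<rho>. G \<delta> \<longrightarrow> (\<forall>k. G (\<delta>s k)) \<longrightarrow> (\<forall>k::nat. \<rho> k > 0) \<longrightarrow>
        G (\<lambda>t. min (\<delta>s (nat \<lceil>1 / \<delta> t\<rceil>) t / 2) (\<rho> (nat \<lceil>1 / \<delta> t\<rceil>))))"

lemma gauge_class_gauge01: "gauge_class gauge01"
proof -
  have "infdist t {a, b} > 0" if "t \<noteq> a" "t \<noteq> b" for t a b :: real
    using that infdist_pos_not_in_closed[of "{a,b}" t] by auto
  then show ?thesis by (auto simp: gauge_class_def gauge01_def)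
qed

text \<open>The delicate closure property is the one whose index depends on t. That index is a
  measurable function into a countable set, and a selection along it among countably many measurable
  functions is measurable.\<close>

lemma gauge_class_measurable_gauge01: "gauge_class measurable_gauge01"
proof -
  let ?M = "lebesgue_on {0..1::real}"
  note g = gauge_class_gauge01[unfolded gauge_class_def]
  have id: "(\<lambda>t. t) \<in> borel_measurable ?M"
    by (intro measurable_restrict_space1 measurable_completion) simp
  have a: "(\<lambda>t. if t = a \<or> t = b then min (\<delta> t) r else min (\<delta> t) (infdist t {a, b})) \<in> borel_measurable ?M"
    if [measurable]: "\<delta> \<in> borel_measurable ?M" for \<delta> :: "real \<Rightarrow> real" and a b r
  proof -
    have [measurable]: "(\<lambda>t. infdist t {a, b}) \<in> borel_measurable ?M"
      by (rule borel_measurable_continuous_on[OF _ id]) (intro continuous_intros)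
    have [measurable]: "Measurable.pred ?M (\<lambda>t. t = a \<or> t = b)"
      using id by measurable
    show ?thesis by measurable
  qed
  have b: "(\<lambda>t. min (\<delta>s (nat \<lceil>1 / \<delta> t\<rceil>) t / 2) (\<rho> (nat \<lceil>1 / \<delta> t\<rceil>))) \<in> borel_measurable ?M"
    if \<delta>[measurable]: "\<delta> \<in> borel_measurable ?M" and \<delta>s[measurable]: "\<And>k. \<delta>s k \<in> borel_measurable ?M"
    for \<delta> :: "real \<Rightarrow> real" and \<delta>s :: "nat \<Rightarrow> real \<Rightarrow> real" and \<rho> :: "nat \<Rightarrow> real"
  proof -
    have "(\<lambda>t. 1 / \<delta> t) \<in> borel_measurable ?M" by measurable
    from measurable_compose[OF this measurable_real_ceiling]
    have [measurable]: "(\<lambda>t. nat \<lceil>1 / \<delta> t\<rceil>) \<in> measurable ?M (count_space UNIV)" by measurable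
    show ?thesis
      by (rule measurable_compose_countable[where f="\<lambda>k t. min (\<delta>s k t / 2) (\<rho> k)"]) measurable
  qed
  show ?thesis
    unfolding gauge_class_def measurable_gauge01_def using g a by (auto intro!: b)
qed

text \<open>The gauge is chosen before the member \<open>i\<close>; over the dual ball this encodes
  convergence in the Hausdorff distance. The index set is left abstract so that the core of the
  proof concerns real functions only.\<close>

definition uniform_integral ::
  "((real \<Rightarrow> real) \<Rightarrow> bool) \<Rightarrow> ((real \<times> real set) set \<Rightarrow> bool) \<Rightarrow>
   'i set \<Rightarrow> ('i \<Rightarrow> real \<Rightarrow> real) \<Rightarrow> ('i \<Rightarrow> real) \<Rightarrow> bool" where
  "uniform_integral G Q D h c \<longleftrightarrow>
     (\<forall>\<epsilon>>0. \<exists>\<delta>. G \<delta> \<and> (\<forall>P. Q P \<and> gauge_fine \<delta> P \<longrightarrow>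
        (\<forall>i\<in>D. \<bar>(\<Sum>(t, I)\<in>P. measure lborel I * h i t) - c i\<bar> < \<epsilon>)))"

lemma uniform_integralD:
  assumes "uniform_integral G Q D h c" "\<epsilon> > 0"
  obtains \<delta> where "G \<delta>"
    "\<And>P i. Q P \<Longrightarrow> gauge_fine \<delta> P \<Longrightarrow> i \<in> D \<Longrightarrow> \<bar>(\<Sum>(t, I)\<in>P. measure lborel I * h i t) - c i\<bar> < \<epsilon>"
  using assms unfolding uniform_integral_def by metis

section \<open>Set-valued integrals as uniform scalar integrals\<close>

lemma riemann_sum_support:
  assumes "\<And>t. t \<in> {0..1} \<Longrightarrow> \<Gamma> t \<in> cb" and P: "tagged_partition P"
  shows "convex (riemann_sum \<Gamma> P)" "riemann_sum \<Gamma> P \<noteq> {}" "bounded (riemann_sum \<Gamma> P)"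
    and "l \<in> dual_ball \<Longrightarrow> support l (riemann_sum \<Gamma> P) = (\<Sum>(t, I)\<in>P. measure lborel I * support l (\<Gamma> t))"
proof -
  have fin: "finite P" and cb: "\<And>t I. (t, I) \<in> P \<Longrightarrow> \<Gamma> t \<in> cb"
    using assms(1) P unfolding tagged_partition_def by fastforce+
  have rs: "riemann_sum \<Gamma> P = (\<Sum>p\<in>P. (*\<^sub>R) (measure lborel (snd p)) ` \<Gamma> (fst p))"
    unfolding riemann_sum_def by (simp add: case_prod_unfold)
  have ne: "(*\<^sub>R) (measure lborel (snd p)) ` \<Gamma> (fst p) \<noteq> {} \<and> bounded ((*\<^sub>R) (measure lborel (snd p)) ` \<Gamma> (fst p))"
    if "p \<in> P" for p
    using cb[of "fst p" "snd p"] that bounded_scaling by (auto simp: cb_def)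
  show "convex (riemann_sum \<Gamma> P)" unfolding rs
    using cb by (intro convex_set_sum convex_scaling) (auto simp: cb_def)
  show "riemann_sum \<Gamma> P \<noteq> {}" "bounded (riemann_sum \<Gamma> P)"
    using support_sum[OF zero_in_dual_ball fin ne] unfolding rs by auto
  show "support l (riemann_sum \<Gamma> P) = (\<Sum>(t, I)\<in>P. measure lborel I * support l (\<Gamma> t))" if l: "l \<in> dual_ball"
  proof -
    have "support l (riemann_sum \<Gamma> P) = (\<Sum>p\<in>P. support l ((*\<^sub>R) (measure lborel (snd p)) ` \<Gamma> (fst p)))"
      using support_sum[OF l fin ne] unfolding rs by auto
    also have "\<dots> = (\<Sum>p\<in>P. measure lborel (snd p) * support l (\<Gamma> (fst p)))"
      using cb by (intro sum.cong refl support_scaleR[OF l]) (auto simp: cb_def)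
    finally show ?thesis by (simp add: case_prod_unfold)
  qed
qed

text \<open>Support functionals are additive and positively homogeneous for Minkowski operations, so
  they turn set-valued Riemann sums into scalar ones. These sums may fail to be closed, and the
  estimates for the Hausdorff distance ask only for convex, bounded and nonempty sets.\<close>

lemma has_cb_integral_iff_uniform_integral:
  assumes \<Gamma>: "\<And>t. t \<in> {0..1} \<Longrightarrow> \<Gamma> t \<in> cb" and Q: "\<And>P. Q P \<Longrightarrow> tagged_partition P"
  shows "has_cb_integral G Q \<Gamma> C \<longleftrightarrow>
    C \<in> cb \<and> uniform_integral G Q dual_ball (\<lambda>l t. support l (\<Gamma> t)) (\<lambda>l. support l C)"
    (is "?L \<longleftrightarrow> _ \<and> ?R")
proof -
  note rs = riemann_sum_support[OF \<Gamma> Q]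
  have "?L" if C: "C \<in> cb" and R: ?R
    unfolding has_cb_integral_def
  proof (intro conjI C allI impI)
    fix \<epsilon> :: real assume "\<epsilon> > 0"
    \<comment> \<open>A supremum of quantities below a number is only weakly below it, hence the
      half.\<close>
    then have "\<epsilon>/2 > 0" by simp
    from uniform_integralD[OF R this] obtain \<delta> where \<delta>: "G \<delta>"
      "\<And>P l. Q P \<Longrightarrow> gauge_fine \<delta> P \<Longrightarrow> l \<in> dual_ball \<Longrightarrow>
         \<bar>(\<Sum>(t, I)\<in>P. measure lborel I * support l (\<Gamma> t)) - support l C\<bar> < \<epsilon>/2" by blast
    have "hausdorff_dist C (riemann_sum \<Gamma> P) < \<epsilon>" if "Q P" "gauge_fine \<delta> P" for P
    proof -
      have "hausdorff_dist C (riemann_sum \<Gamma> P) \<le> \<epsilon>/2"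
        using C rs[OF _ that(1)] \<delta>(2)[OF that]
        by (intro hausdorff_dist_le_of_support) (auto simp: cb_def abs_minus_commute intro: less_imp_le)
      then show ?thesis using \<open>\<epsilon> > 0\<close> by simp
    qed
    then show "\<exists>\<delta>. G \<delta> \<and> (\<forall>P. Q P \<and> gauge_fine \<delta> P \<longrightarrow> hausdorff_dist C (riemann_sum \<Gamma> P) < \<epsilon>)"
      using \<delta>(1) by blast
  qed
  moreover have "?R" if L: ?L
    unfolding uniform_integral_def
  proof (intro allI impI)
    fix \<epsilon> :: real assume "\<epsilon> > 0"
    then obtain \<delta> where \<delta>: "G \<delta>"
      "\<And>P. Q P \<Longrightarrow> gauge_fine \<delta> P \<Longrightarrow> hausdorff_dist C (riemann_sum \<Gamma> P) < \<epsilon>"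
      using L unfolding has_cb_integral_def by blast
    have "\<bar>(\<Sum>(t, I)\<in>P. measure lborel I * support l (\<Gamma> t)) - support l C\<bar> < \<epsilon>"
      if "Q P" "gauge_fine \<delta> P" and l: "l \<in> dual_ball" for P l
    proof -
      have "\<bar>support l C - support l (riemann_sum \<Gamma> P)\<bar> \<le> hausdorff_dist C (riemann_sum \<Gamma> P)"
        using L rs[OF _ that(1)] by (intro abs_support_diff_le_hausdorff_dist l) (auto simp: has_cb_integral_def cb_def)
      then show ?thesis using \<delta>(2)[OF that(1,2)] rs(4)[OF _ that(1) l] by (simp add: abs_minus_commute)
    qed
    then show "\<exists>\<delta>. G \<delta> \<and> (\<forall>P. Q P \<and> gauge_fine \<delta> P \<longrightarrow> (\<forall>l\<in>dual_ball.
        \<bar>(\<Sum>(t, I)\<in>P. measure lborel I * support l (\<Gamma> t)) - support l C\<bar> < \<epsilon>))"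
      using \<delta>(1) by blast
  qed
  ultimately show ?thesis by (auto simp: has_cb_integral_def)
qed

section \<open>Translation to the gauges of the library and Henstock's lemma\<close>

definition gauge_sets :: "(real \<Rightarrow> real) \<Rightarrow> real \<Rightarrow> real set" where
  "gauge_sets \<delta> t = ball t (if t \<in> {0..1} then \<delta> t else 1)"

text \<open>Outside [0,1] a function satisfying \<open>gauge01\<close> may be nonpositive; the
  radius 1 used there yields a gauge on the whole line.\<close>

lemma gauge_gauge_sets: "gauge01 \<delta> \<Longrightarrow> gauge (gauge_sets \<delta>)"
  unfolding gauge_sets_def by (rule gauge_ball_dependent) (auto simp: gauge01_def)

lemma gauge_sets_fine_iff:
  assumes "\<And>t I. (t, I) \<in> P \<Longrightarrow> t \<in> {0..1}"
  shows "gauge_sets \<delta> fine P \<longleftrightarrow> gauge_fine \<delta> P"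
proof -
  have "gauge_sets \<delta> t = {t - \<delta> t<..<t + \<delta> t}" if "(t, I) \<in> P" for t I
    using assms[OF that] by (simp add: gauge_sets_def ball_eq_greaterThanLessThan)
  then show ?thesis unfolding fine_def gauge_fine_def by blast
qed

lemma perron_partition_tag: "perron_partition P \<Longrightarrow> (t, I) \<in> P \<Longrightarrow> t \<in> {0..1}"
  by (force simp: perron_partition_def tagged_partition_def)

lemma fine_perron_partition_exists:
  assumes "gauge01 \<delta>"
  obtains P where "perron_partition P" "gauge_fine \<delta> P"
proof -
  obtain P where P: "P tagged_division_of {0..1}" "gauge_sets \<delta> fine P"
    using fine_division_exists_real[OF gauge_gauge_sets[OF assms]] by blast
  then have "perron_partition P" by (simp add: perron_partition_iff_tagged_division)
  then show ?thesis using that P(2) gauge_sets_fine_iff[of P \<delta>] perron_partition_tag[of P] by blast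
qed

lemma uniform_integral_has_integral:
  assumes U: "uniform_integral G perron_partition D h c" and G: "gauge_class G" and i: "i \<in> D"
  shows "(h i has_integral c i) {0..1}"
proof -
  have "\<exists>\<gamma>. gauge \<gamma> \<and> (\<forall>P. P tagged_division_of cbox 0 1 \<and> \<gamma> fine P \<longrightarrow>
      norm ((\<Sum>(t,I)\<in>P. measure lborel I *\<^sub>R h i t) - c i) < e)" if "e > 0" for e
  proof -
    obtain \<delta> where \<delta>: "G \<delta>" "\<And>P. perron_partition P \<Longrightarrow> gauge_fine \<delta> P \<Longrightarrow>
        \<bar>(\<Sum>(t, I)\<in>P. measure lborel I * h i t) - c i\<bar> < e"
      using uniform_integralD[OF U \<open>e > 0\<close>] i by metis
    then have "gauge (gauge_sets \<delta>)" using G gauge_gauge_sets by (simp add: gauge_class_def)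
    moreover have *: "norm ((\<Sum>(t,I)\<in>P. measure lborel I *\<^sub>R h i t) - c i) < e"
      if "P tagged_division_of cbox 0 1" "gauge_sets \<delta> fine P" for P
    proof -
      have P: "perron_partition P" using that(1) by (simp add: perron_partition_iff_tagged_division)
      then have "gauge_fine \<delta> P"
        using gauge_sets_fine_iff[of P \<delta>] perron_partition_tag[of P] that(2) by blast
      then show ?thesis using \<delta>(2)[OF P] by simp
    qed
    ultimately show ?thesis by (intro exI[of _ "gauge_sets \<delta>"] conjI allI impI) (auto intro: *)
  qed
  then show ?thesis using has_integral[of "h i" "c i" 0 1] by simp
qed

text \<open>The constant in Henstock's lemma depends on the dimension alone, so a gauge with error
  \<open>\<epsilon>/2\<close> for all members serves all of them here too.\<close>

lemma uniform_saks_henstock: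
  assumes U: "uniform_integral G perron_partition D h c" and G: "gauge_class G" and e: "\<epsilon> > 0"
  obtains \<delta> where "G \<delta>"
    "\<And>p i. p tagged_partial_division_of {0..1} \<Longrightarrow> gauge_fine \<delta> p \<Longrightarrow> i \<in> D \<Longrightarrow>
       (\<Sum>(t, I)\<in>p. \<bar>measure lborel I * h i t - integral I (h i)\<bar>) \<le> \<epsilon>"
proof -
  have "\<epsilon>/2 > 0" using e by simp
  from uniform_integralD[OF U this] obtain \<delta> where \<delta>: "G \<delta>"
    "\<And>P i. perron_partition P \<Longrightarrow> gauge_fine \<delta> P \<Longrightarrow> i \<in> D \<Longrightarrow>
       \<bar>(\<Sum>(t, I)\<in>P. measure lborel I * h i t) - c i\<bar> < \<epsilon>/2" by blast
  have g: "gauge (gauge_sets \<delta>)" using \<delta>(1) G gauge_gauge_sets by (simp add: gauge_class_def)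
  have "(\<Sum>(t, I)\<in>p. \<bar>measure lborel I * h i t - integral I (h i)\<bar>) \<le> \<epsilon>"
    if p: "p tagged_partial_division_of {0..1}" "gauge_fine \<delta> p" and i: "i \<in> D" for p i
  proof -
    note hi = uniform_integral_has_integral[OF U G i]
    have tag: "t \<in> {0..1}" if "(t, I) \<in> p" for t I
      using tagged_partial_division_ofD(2,3)[OF p(1) that] by blast
    have "(\<Sum>(t, I)\<in>p. norm (measure lborel I *\<^sub>R h i t - integral I (h i))) \<le> 2 * real (DIM(real)) * (\<epsilon>/2)"
    proof (rule Henstock_lemma_part2[of _ 0 1 "\<epsilon>/2" "gauge_sets \<delta>"])
      show "h i integrable_on cbox 0 1" using hi by auto
      show "gauge_sets \<delta> fine p" using gauge_sets_fine_iff[of p] tag p(2) by blast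
      show "norm ((\<Sum>(t,I)\<in>P. measure lborel I *\<^sub>R h i t) - integral (cbox 0 1) (h i)) < \<epsilon>/2"
        if "P tagged_division_of cbox 0 1" "gauge_sets \<delta> fine P" for P
      proof -
        have "perron_partition P" using that(1) by (simp add: perron_partition_iff_tagged_division)
        moreover from this have "gauge_fine \<delta> P"
          using gauge_sets_fine_iff[of P \<delta>] perron_partition_tag[of P] that(2) by blast
        ultimately show ?thesis using \<delta>(2)[of P i] i integral_unique[OF hi] by simp
      qed
    qed (use p e g in auto)
    then show ?thesis by simp
  qed
  with \<delta>(1) that show ?thesis by blast
qed

text \<open>Neither covering nor any relation between tags and intervals is asked for, so the
  property passes to the subfamilies into which a partition is split below. Disjointness concerns
  pairs: a degenerate interval may occur with several tags.\<close>

definition nonoverlapping :: "(real \<times> real set) set \<Rightarrow> bool" where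
  "nonoverlapping P \<longleftrightarrow> finite P \<and> (\<forall>(t, I)\<in>P. \<exists>a b. I = {a..b}) \<and>
     (\<forall>p\<in>P. \<forall>q\<in>P. p \<noteq> q \<longrightarrow> interior (snd p) \<inter> interior (snd q) = {})"

lemma nonoverlapping_subset: "nonoverlapping P \<Longrightarrow> Q \<subseteq> P \<Longrightarrow> nonoverlapping Q"
  unfolding nonoverlapping_def by (meson finite_subset subsetD)

lemma tagged_partition_nonoverlapping: "tagged_partition P \<Longrightarrow> nonoverlapping P"
  unfolding nonoverlapping_def
proof (intro conjI)
  assume "tagged_partition P"
  note D = this[unfolded tagged_partition_def case_prod_unfold prod.collapse]
  show "finite P" using D by (elim conjE)
  have "\<forall>p\<in>P. fst p \<in> {0..1} \<and> snd p \<subseteq> {0..1} \<and> (\<exists>a b. a \<le> b \<and> snd p = {a..b})"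
    using D by (elim conjE)
  then show "\<forall>(t, I)\<in>P. \<exists>a b. I = {a..b}" by fastforce
  show "\<forall>p\<in>P. \<forall>q\<in>P. p \<noteq> q \<longrightarrow> interior (snd p) \<inter> interior (snd q) = {}" using D by (elim conjE)
qed

text \<open>Two of the intervals meet in a convex set with empty interior, hence in a null
  set.\<close>

lemma nonoverlapping_has_integral:
  fixes f :: "real \<Rightarrow> real"
  assumes P: "nonoverlapping P" and f: "\<And>t I. (t, I) \<in> P \<Longrightarrow> f integrable_on I"
  shows "(f has_integral (\<Sum>(t, I)\<in>P. integral I f)) (\<Union>(t, I)\<in>P. I)"
proof -
  have "(f has_integral (\<Sum>p\<in>P. integral (snd p) f)) (\<Union>p\<in>P. snd p)"
  proof (rule has_integral_UN)
    show "finite P" using P by (simp add: nonoverlapping_def)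
    show "(f has_integral integral (snd p) f) (snd p)" if "p \<in> P" for p
      using f[of "fst p" "snd p"] that by auto
    show "pairwise (\<lambda>p q. negligible (snd p \<inter> snd q)) P"
    proof (rule pairwiseI)
      fix p q assume pq: "p \<in> P" "q \<in> P" "p \<noteq> q"
      then have "convex (snd p)" "convex (snd q)"
        using P by (auto simp: nonoverlapping_def)
      then have "convex (snd p \<inter> snd q)" by (rule convex_Int)
      moreover have "interior (snd p \<inter> snd q) = {}" using pq P by (auto simp: nonoverlapping_def)
      ultimately show "negligible (snd p \<inter> snd q)" by (simp add: negligible_convex_interior)
    qed
  qed
  then show ?thesis by (simp add: case_prod_unfold)
qed

lemma nonoverlapping_sum_measure_le:
  assumes P: "nonoverlapping P" and S: "\<And>t I. (t, I) \<in> P \<Longrightarrow> I \<subseteq> S" and "S \<in> lmeasurable"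
  shows "(\<Sum>(t, I)\<in>P. measure lborel I) \<le> measure lebesgue S"
proof -
  have iv: "\<exists>a b. I = {a..b}" if "(t, I) \<in> P" for t I using P that by (auto simp: nonoverlapping_def)
  have 1: "((\<lambda>_. 1::real) has_integral (\<Sum>(t, I)\<in>P. integral I (\<lambda>_. 1))) (\<Union>(t, I)\<in>P. I)"
  proof (rule nonoverlapping_has_integral[OF P])
    show "(\<lambda>_. 1::real) integrable_on I" if "(t, I) \<in> P" for t I
      using iv[OF that] by (auto intro: integrable_const_ivl)
  qed
  have 2: "((\<lambda>_. 1::real) has_integral measure lebesgue S) S"
    using assms(3) by (simp add: lmeasure_integral has_integral_integral lmeasurable_iff_integrable_on)
  have "(\<Sum>(t, I)\<in>P. integral I (\<lambda>_. 1::real)) \<le> measure lebesgue S"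
    by (rule has_integral_subset_le[OF _ 1 2]) (use S in auto)
  moreover have "(\<Sum>(t, I)\<in>P. integral I (\<lambda>_. 1::real)) = (\<Sum>(t, I)\<in>P. measure lborel I)"
    by (rule sum.cong) (auto dest!: iv)
  ultimately show ?thesis by simp
qed

section \<open>Integrals over subintervals\<close>

text \<open>Trimming keeps the retained tags in their intervals, so Henstock's lemma applies to the
  parts inside \<open>{a..b}\<close>.\<close>

lemma perron_inter_partial_division:
  assumes P: "perron_partition P"
  shows "(\<lambda>(t, I). (t, I \<inter> {a..b})) ` {(t, I)\<in>P. t \<in> {a..b}} tagged_partial_division_of {0..1}"
proof -
  have P: "P tagged_division_of {0..1}" using P by (simp add: perron_partition_iff_tagged_division)
  note D = tagged_division_ofD[OF P]
  show ?thesis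
    unfolding tagged_partial_division_of_def
  proof (intro conjI allI impI; (elim conjE)?)
    show "finite ((\<lambda>(t, I). (t, I \<inter> {a..b})) ` {(t, I)\<in>P. t \<in> {a..b}})"
      using D(1) by (intro finite_imageI) (auto intro: finite_subset)
    show "\<exists>a b. K = cbox a b"
      if K: "(x, K) \<in> (\<lambda>(t, I). (t, I \<inter> {a..b})) ` {(t, I)\<in>P. t \<in> {a..b}}" for x K
    proof -
      obtain I where I: "(x, I) \<in> P" "K = I \<inter> {a..b}" using K by auto
      obtain c d where "I = {c..d}" using D(4)[OF I(1)] by auto
      then have "K = cbox (max c a) (min d b)" using I by auto
      then show ?thesis by blast
    qed
    show "interior K1 \<inter> interior K2 = {}"
      if K: "(x1, K1) \<in> (\<lambda>(t, I). (t, I \<inter> {a..b})) ` {(t, I)\<in>P. t \<in> {a..b}}"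
        "(x2, K2) \<in> (\<lambda>(t, I). (t, I \<inter> {a..b})) ` {(t, I)\<in>P. t \<in> {a..b}}"
        "(x1, K1) \<noteq> (x2, K2)" for x1 K1 x2 K2
    proof -
      obtain I1 I2 where I: "(x1, I1) \<in> P" "K1 = I1 \<inter> {a..b}" "(x2, I2) \<in> P" "K2 = I2 \<inter> {a..b}"
        using K by auto
      then have "(x1, I1) \<noteq> (x2, I2)" using K(3) by auto
      then have "interior I1 \<inter> interior I2 = {}" using D(5) I by blast
      then show ?thesis using I by auto
    qed
    show "x \<in> K" "K \<subseteq> {0..1}"
      if K: "(x, K) \<in> (\<lambda>(t, I). (t, I \<inter> {a..b})) ` {(t, I)\<in>P. t \<in> {a..b}}" for x K
    proof -
      obtain I where I: "(x, I) \<in> P" "K = I \<inter> {a..b}" "x \<in> {a..b}" using K by auto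
      then show "x \<in> K" "K \<subseteq> {0..1}" using D(2,3)[OF I(1)] by blast+
    qed
  qed
qed

text \<open>The variation is built from integrals over subintervals, whose existence has to be
  derived. The new gauge keeps an interval whose tag differs from \<open>a\<close> and
  \<open>b\<close> away from both points, so it lies in \<open>{a..b}\<close> or misses it.
  Intervals tagged by an endpoint have small total length, and the values there are bounded over
  \<open>D\<close>.\<close>

lemma uniform_integral_subinterval:
  assumes U: "uniform_integral G perron_partition D h c" and G: "gauge_class G"
    and M: "\<And>t. t \<in> {0..1} \<Longrightarrow> \<exists>M. \<forall>i\<in>D. \<bar>h i t\<bar> \<le> M"
    and ab: "0 \<le> a" "a \<le> b" "b \<le> 1"
  shows "uniform_integral G perron_partition D (\<lambda>i t. if t \<in> {a..b} then h i t else 0) (\<lambda>i. integral {a..b} (h i))"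
  unfolding uniform_integral_def
proof (intro allI impI)
  fix \<epsilon> :: real assume \<epsilon>: "\<epsilon> > 0"
  obtain Ma Mb where "\<forall>i\<in>D. \<bar>h i a\<bar> \<le> Ma" "\<forall>i\<in>D. \<bar>h i b\<bar> \<le> Mb" using M[of a] M[of b] ab by auto
  define N where "N = max (max Ma Mb) 1"
  have N: "\<bar>h i t\<bar> \<le> N" if "i \<in> D" "t = a \<or> t = b" for i t
    using that \<open>\<forall>i\<in>D. \<bar>h i a\<bar> \<le> Ma\<close> \<open>\<forall>i\<in>D. \<bar>h i b\<bar> \<le> Mb\<close> by (fastforce simp: N_def)
  have N1: "N \<ge> 1" by (simp add: N_def)
  have e2: "\<epsilon>/2 > 0" using \<epsilon> by simp
  from uniform_saks_henstock[OF U G this] obtain \<delta> where \<delta>: "G \<delta>"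
    "\<And>p i. p tagged_partial_division_of {0..1} \<Longrightarrow> gauge_fine \<delta> p \<Longrightarrow> i \<in> D \<Longrightarrow>
       (\<Sum>(t, I)\<in>p. \<bar>measure lborel I * h i t - integral I (h i)\<bar>) \<le> \<epsilon>/2" by blast
  \<comment> \<open>Intervals tagged by \<open>a\<close> or \<open>b\<close> have total length at
    most 4 * r and values at most \<open>N\<close> there, which costs \<open>\<epsilon>/4\<close>
    besides the \<open>\<epsilon>/2\<close> from Henstock's lemma.\<close>
  define r where "r = \<epsilon> / (16 * N)"
  have r: "r > 0" using \<epsilon> N1 by (simp add: r_def)
  define \<delta>' where "\<delta>' = (\<lambda>t. if t = a \<or> t = b then min (\<delta> t) r else min (\<delta> t) (infdist t {a, b}))"
  have G': "G \<delta>'" using G \<delta>(1) r unfolding gauge_class_def \<delta>'_def by blast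
  have "\<bar>(\<Sum>(t, I)\<in>P. measure lborel I * (if t \<in> {a..b} then h i t else 0)) - integral {a..b} (h i)\<bar> < \<epsilon>"
    if P: "perron_partition P" "gauge_fine \<delta>' P" and i: "i \<in> D" for P i
  proof -
    define k where "k = (\<lambda>t. if t \<in> {a..b} then h i t else 0)"
    note hi = uniform_integral_has_integral[OF U G i]
    have Ptd: "P tagged_division_of {0..1}" using P(1) by (simp add: perron_partition_iff_tagged_division)
    have finP: "finite P" using Ptd by (rule tagged_division_of_finite)
    have I: "t \<in> I" "I \<subseteq> {0..1}" "\<exists>c d. I = {c..d}" "I \<subseteq> ball t (\<delta>' t)" if "(t, I) \<in> P" for t I
      using tagged_division_ofD(2,3,4)[OF Ptd that] P(2) that
      by (auto simp: gauge_fine_def ball_eq_greaterThanLessThan)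
    have I_sep: "I \<inter> {a..b} = {}" if tI: "(t, I) \<in> P" and "t \<notin> {a..b}" for t I
    proof -
      have "t \<noteq> a" "t \<noteq> b" using that ab by auto
      then have "I \<subseteq> ball t (infdist t {a, b})" using I(4)[OF tI] by (auto simp: \<delta>'_def)
      moreover have "infdist t {a, b} \<le> dist t a" "infdist t {a, b} \<le> dist t b"
        by (auto intro: infdist_le)
      ultimately show ?thesis using that(2) by (force simp: dist_real_def)
    qed
    have I_in: "I \<subseteq> {a..b}" if tI: "(t, I) \<in> P" and "t \<in> {a..b}" "t \<noteq> a" "t \<noteq> b" for t I
    proof -
      have "t \<noteq> a" "t \<noteq> b" using that ab by auto
      then have "I \<subseteq> ball t (infdist t {a, b})" using I(4)[OF tI] by (auto simp: \<delta>'_def)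
      moreover have "infdist t {a, b} \<le> dist t a" "infdist t {a, b} \<le> dist t b"
        by (auto intro: infdist_le)
      ultimately show ?thesis using that(2) by (force simp: dist_real_def)
    qed
    have k_at: "k t = (if t \<in> {a..b} then h i t else 0)" for t by (simp add: k_def)
    have k_int: "integral I k = integral (I \<inter> {a..b}) (h i)" for I
      unfolding k_def by (subst Int_commute) (rule integral_restrict_Int)
    have "k integrable_on {0..1}"
    proof -
      have "h i integrable_on {a..b}" using hi ab by (auto intro: integrable_on_subinterval)
      then show ?thesis unfolding k_def using ab integrable_restrict_Int[of "{a..b}" "h i" "{0..1}"]
        by (simp only: Int_absorb2 atLeastatMost_subset_iff simp_thms)
    qed
    then have "integral {0..1} k = (\<Sum>(t, I)\<in>P. integral I k)"
      using integral_combine_tagged_division_topdown[of k 0 1 P] Ptd by simp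
    moreover have "integral {0..1} k = integral {a..b} (h i)"
      using ab by (simp add: k_int Int_absorb1)
    ultimately have tot: "integral {a..b} (h i) = (\<Sum>(t, I)\<in>P. integral I k)" by simp
    define P1 where "P1 = {(t, I)\<in>P. t \<in> {a..b}}"
    define P2 where "P2 = {(t, I)\<in>P. t = a \<or> t = b}"
    have fin: "finite P1" "finite P2" unfolding P1_def P2_def using finP by (auto intro: finite_subset)
    have "\<bar>(\<Sum>(t, I)\<in>P. measure lborel I * k t) - integral {a..b} (h i)\<bar>
        \<le> (\<Sum>(t, I)\<in>P. \<bar>measure lborel I * k t - integral I k\<bar>)"
      unfolding tot sum_subtractf[symmetric] case_prod_unfold by (rule sum_abs)
    also have "\<dots> \<le> (\<Sum>(t, I)\<in>P. (if t \<in> {a..b} then \<bar>measure lborel (I \<inter> {a..b}) * h i t - integral (I \<inter> {a..b}) (h i)\<bar> else 0)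
         + (if t = a \<or> t = b then N * measure lborel I else 0))"
    proof (rule sum_mono, clarify)
      fix t I assume tI: "(t, I) \<in> P"
      show "\<bar>measure lborel I * k t - integral I k\<bar> \<le>
         (if t \<in> {a..b} then \<bar>measure lborel (I \<inter> {a..b}) * h i t - integral (I \<inter> {a..b}) (h i)\<bar> else 0)
         + (if t = a \<or> t = b then N * measure lborel I else 0)"
      proof (cases "t = a \<or> t = b")
        case False
        then show ?thesis using I_sep[OF tI] I_in[OF tI]
          by (cases "t \<in> {a..b}") (auto simp: k_int k_at Int_absorb2)
      next
        case True
        then have t: "t \<in> {a..b}" using ab by auto
        obtain u v where uv: "I = {u..v}" using I(3)[OF tI] by blast
        have "measure lborel (I \<inter> {a..b}) \<le> measure lborel I"
          unfolding uv by (intro measure_mono_fmeasurable) (auto simp: fmeasurable_def emeasure_lborel_Icc_eq)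
        then have "\<bar>(measure lborel I - measure lborel (I \<inter> {a..b})) * h i t\<bar> \<le> measure lborel I * N"
          unfolding abs_mult using N[OF i True] by (intro mult_mono) auto
        \<comment> \<open>At an endpoint tag the error is the Henstock error of the trimmed interval
          plus the value times the length cut off.\<close>
        moreover have "measure lborel I * k t - integral I k =
          (measure lborel (I \<inter> {a..b}) * h i t - integral (I \<inter> {a..b}) (h i))
           + (measure lborel I - measure lborel (I \<inter> {a..b})) * h i t"
          using t by (simp add: k_int k_at algebra_simps)
        ultimately show ?thesis using t True by (simp add: mult.commute)
      qed
    qed
    also have "\<dots> = (\<Sum>(t, I)\<in>P1. \<bar>measure lborel (I \<inter> {a..b}) * h i t - integral (I \<inter> {a..b}) (h i)\<bar>)
         + N * (\<Sum>(t, I)\<in>P2. measure lborel I)"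
      unfolding P1_def P2_def case_prod_unfold sum.distrib sum_distrib_left
      by (intro arg_cong2[where f="(+)"]) (auto intro!: sum.mono_neutral_cong_right finP split: if_splits)
    also have "(\<Sum>(t, I)\<in>P1. \<bar>measure lborel (I \<inter> {a..b}) * h i t - integral (I \<inter> {a..b}) (h i)\<bar>) \<le> \<epsilon>/2"
    proof -
      define q where "q = (\<lambda>(t, I). (t, I \<inter> {a..b})) ` P1"
      have q: "q tagged_partial_division_of {0..1}"
        unfolding q_def P1_def by (rule perron_inter_partial_division[OF P(1)])
      have "gauge_fine \<delta> q"
      proof -
        have "I \<subseteq> {t - \<delta> t<..<t + \<delta> t}" if "(t, I) \<in> P" for t I
          using I(4)[OF that] by (auto simp: \<delta>'_def ball_eq_greaterThanLessThan subset_iff split: if_splits)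
        then show ?thesis by (force simp: gauge_fine_def q_def P1_def)
      qed
      from \<delta>(2)[OF q this i]
      have "(\<Sum>(t, I)\<in>q. \<bar>measure lborel I * h i t - integral I (h i)\<bar>) \<le> \<epsilon>/2" .
      also have "(\<Sum>(t, I)\<in>q. \<bar>measure lborel I * h i t - integral I (h i)\<bar>) =
        (\<Sum>(t, I)\<in>P1. \<bar>measure lborel (I \<inter> {a..b}) * h i t - integral (I \<inter> {a..b}) (h i)\<bar>)"
        unfolding q_def
      \<comment> \<open>Distinct intervals may have the same trimmed part; it is then degenerate and
        its term vanishes.\<close>
      proof (subst sum.reindex_nontrivial[OF fin(1)])
        fix x y assume xy: "x \<in> P1" "y \<in> P1" "x \<noteq> y"
          "(\<lambda>(t, I). (t, I \<inter> {a..b})) x = (\<lambda>(t, I). (t, I \<inter> {a..b})) y"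
        obtain t I s J where tx: "x = (t, I)" "y = (s, J)" by (cases x, cases y)
        then have "interior I \<inter> interior J = {}"
          using tagged_division_ofD(5)[OF Ptd] xy unfolding P1_def by blast
        moreover have "I \<inter> {a..b} = J \<inter> {a..b}" using xy(4) tx by auto
        ultimately have emp: "interior (I \<inter> {a..b}) = {}"
          using interior_mono[of "I \<inter> {a..b}" I] interior_mono[of "I \<inter> {a..b}" J] by blast
        obtain u v where "I = {u..v}" using I(3)[of t I] xy(1) tx by (auto simp: P1_def)
        then have ic: "I \<inter> {a..b} = cbox (max u a) (min v b)" by auto
        have c0: "measure lborel (I \<inter> {a..b}) = 0"
          unfolding ic content_eq_0_interior by (rule emp[unfolded ic])
        moreover have "integral (I \<inter> {a..b}) (h i) = 0" using c0 unfolding ic by (rule integral_null)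
        ultimately show "(case (case x of (t, I) \<Rightarrow> (t, I \<inter> {a..b})) of
            (t, I) \<Rightarrow> \<bar>measure lborel I * h i t - integral I (h i)\<bar>) = 0"
          by (simp add: tx)
      qed (simp add: case_prod_unfold comp_def)
      finally show ?thesis .
    qed
    also have "(\<Sum>(t, I)\<in>P2. measure lborel I) \<le> 4 * r"
    proof -
      have no: "nonoverlapping P2"
        using P(1) unfolding P2_def perron_partition_def
        by (intro nonoverlapping_subset[OF tagged_partition_nonoverlapping]) auto
      have "(\<Sum>(t, I)\<in>P2. measure lborel I) \<le> measure lebesgue (ball a r \<union> ball b r)"
      proof (rule nonoverlapping_sum_measure_le[OF no])
        show "I \<subseteq> ball a r \<union> ball b r" if "(t, I) \<in> P2" for t I
          using I(4)[of t I] that by (auto simp: P2_def \<delta>'_def)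
      qed (simp add: fmeasurable.Un)
      also have "\<dots> \<le> measure lebesgue (ball a r) + measure lebesgue (ball b r)"
        by (rule measure_Un_le) auto
      also have "\<dots> \<le> 4 * r" using r by (simp add: ball_eq_greaterThanLessThan)
      finally show ?thesis .
    qed
    finally have "\<bar>(\<Sum>(t, I)\<in>P. measure lborel I * k t) - integral {a..b} (h i)\<bar> \<le> \<epsilon>/2 + N * (4 * r)"
      using N1 by (simp add: mult_left_mono)
    also have "\<dots> < \<epsilon>" using \<epsilon> N1 by (simp add: r_def field_simps)
    finally show ?thesis by (simp add: k_def)
  qed
  with G' show "\<exists>\<delta>. G \<delta> \<and> (\<forall>P. perron_partition P \<and> gauge_fine \<delta> P \<longrightarrow> (\<forall>i\<in>D.
      \<bar>(\<Sum>(t, I)\<in>P. measure lborel I * (if t \<in> {a..b} then h i t else 0)) - integral {a..b} (h i)\<bar> < \<epsilon>))"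
    by blast
qed

lemma uniform_integral_unique:
  assumes U: "uniform_integral G perron_partition D h c" "uniform_integral G perron_partition D h c'"
    and G: "gauge_class G" and i: "i \<in> D"
  shows "c i = c' i"
  using uniform_integral_has_integral[OF U(1) G i] uniform_integral_has_integral[OF U(2) G i]
  by (rule has_integral_unique)

text \<open>The definite description first has to denote. The Riemann sums of the restricted
  function have uniformly convergent support functionals, so completeness of \<open>cb\<close> gives
  a set whose support functional is the scalar integral, and support functionals determine the
  set.\<close>

lemma cb_integral_over_subinterval:
  fixes \<Gamma> :: "real \<Rightarrow> 'a::banach set"
  assumes \<Gamma>: "\<And>t. t \<in> {0..1} \<Longrightarrow> \<Gamma> t \<in> cb" and G: "gauge_class G"
    and C: "has_cb_integral G perron_partition \<Gamma> C"
    and ab: "0 \<le> a" "a \<le> b" "b \<le> 1" and l: "l \<in> dual_ball"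
  shows "\<bar>integral {a..b} (\<lambda>t. support l (\<Gamma> t))\<bar>
    \<le> set_norm (THE C. has_cb_integral G perron_partition (restrict_multi \<Gamma> {a..b}) C)"
proof -
  let ?h = "\<lambda>l t. support l (\<Gamma> t)"
  let ?s = "\<lambda>l. integral {a..b} (?h l)"
  let ?\<Gamma> = "restrict_multi \<Gamma> {a..b}"
  have Q: "perron_partition P \<Longrightarrow> tagged_partition P" for P by (simp add: perron_partition_def)
  have U: "uniform_integral G perron_partition dual_ball ?h (\<lambda>l. support l C)"
    using C has_cb_integral_iff_uniform_integral[of \<Gamma> perron_partition G C] \<Gamma> Q by blast
  have bnd: "\<exists>M. \<forall>l\<in>dual_ball. \<bar>support l (\<Gamma> t)\<bar> \<le> M" if "t \<in> {0..1}" for t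
    using support_abs_le_set_norm[of _ "\<Gamma> t"] \<Gamma>[OF that] by (auto simp: cb_def)
  have UJ: "uniform_integral G perron_partition dual_ball
      (\<lambda>l t. if t \<in> {a..b} then support l (\<Gamma> t) else 0) ?s"
    by (rule uniform_integral_subinterval[OF U G bnd ab])
  have \<Gamma>': "?\<Gamma> t \<in> cb" if "t \<in> {0..1}" for t
    using \<Gamma>[OF that] by (auto simp: restrict_multi_def cb_def)
  have h': "support l (?\<Gamma> t) = (if t \<in> {a..b} then support l (\<Gamma> t) else 0)" if "l \<in> dual_ball" for l t
    using linear_0[OF dual_ball_linear[OF that]] by (simp add: restrict_multi_def support_def)
  have UJ': "uniform_integral G perron_partition dual_ball (\<lambda>l t. support l (?\<Gamma> t)) ?s"
    using UJ unfolding uniform_integral_def by (simp only: h' cong: ball_cong)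
  have "\<exists>R. convex R \<and> R \<noteq> {} \<and> bounded R \<and> (\<forall>l\<in>dual_ball. \<bar>support l R - ?s l\<bar> \<le> (1/2)^n)" for n
  proof -
    have "(1/2::real)^n > 0" by simp
    from uniform_integralD[OF UJ' this] obtain \<delta> where \<delta>: "G \<delta>"
      "\<And>P l. perron_partition P \<Longrightarrow> gauge_fine \<delta> P \<Longrightarrow> l \<in> dual_ball \<Longrightarrow>
         \<bar>(\<Sum>(t, I)\<in>P. measure lborel I * support l (?\<Gamma> t)) - ?s l\<bar> < (1/2)^n" by blast
    obtain P where P: "perron_partition P" "gauge_fine \<delta> P"
      using fine_perron_partition_exists G \<delta>(1) unfolding gauge_class_def by blast
    have "\<bar>support l (riemann_sum ?\<Gamma> P) - ?s l\<bar> \<le> (1/2)^n" if "l \<in> dual_ball" for l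
      using \<delta>(2)[OF P that] riemann_sum_support(4)[OF \<Gamma>' Q[OF P(1)] that] by simp
    then show ?thesis
      using riemann_sum_support(1-3)[of ?\<Gamma> P, OF \<Gamma>' Q[OF P(1)]]
      by (intro exI[of _ "riemann_sum ?\<Gamma> P"] conjI ballI) auto
  qed
  then obtain R where "\<And>n. convex (R n)" "\<And>n. R n \<noteq> {}" "\<And>n. bounded (R n)"
    "\<And>n l. l \<in> dual_ball \<Longrightarrow> \<bar>support l (R n) - ?s l\<bar> \<le> (1/2)^n" by metis
  from cb_limit_exists[of R ?s, OF this]
  obtain CJ where CJ: "CJ \<in> cb" "\<And>l. l \<in> dual_ball \<Longrightarrow> support l CJ = ?s l" by blast
  have iff: "has_cb_integral G perron_partition ?\<Gamma> C \<longleftrightarrow> C \<in> cb \<and>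
      uniform_integral G perron_partition dual_ball (\<lambda>l t. support l (?\<Gamma> t)) (\<lambda>l. support l C)" for C
    by (intro has_cb_integral_iff_uniform_integral \<Gamma>' Q)
  have CJ_int: "has_cb_integral G perron_partition ?\<Gamma> CJ"
    unfolding iff using CJ UJ' unfolding uniform_integral_def by (simp cong: ball_cong)
  have "(THE C. has_cb_integral G perron_partition ?\<Gamma> C) = CJ"
  proof (rule the_equality)
    show "has_cb_integral G perron_partition ?\<Gamma> CJ" by (rule CJ_int)
    fix C' assume "has_cb_integral G perron_partition ?\<Gamma> C'"
    then have C': "C' \<in> cb" "uniform_integral G perron_partition dual_ball (\<lambda>l t. support l (?\<Gamma> t)) (\<lambda>l. support l C')"
      unfolding iff by blast+
    show "C' = CJ"
      using uniform_integral_unique[OF C'(2) UJ' G] CJ(2)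
      by (intro cb_eq_of_support_eq C'(1) CJ(1)) simp
  qed
  then show ?thesis
    using support_abs_le_set_norm[OF l, of CJ] CJ l by (simp add: cb_def)
qed

section \<open>Uniformly integrable families of bounded variation\<close>

lemma absolutely_integrable_max_real:
  fixes f g :: "real \<Rightarrow> real"
  assumes "f absolutely_integrable_on S" "g absolutely_integrable_on S"
  shows "(\<lambda>x. max (f x) (g x)) absolutely_integrable_on S"
proof -
  have "(\<lambda>x. indicator S x *\<^sub>R max (f x) (g x)) = (\<lambda>x. max (indicator S x *\<^sub>R f x) (indicator S x *\<^sub>R g x))"
    by (auto simp: indicator_def)
  then show ?thesis using assms unfolding set_integrable_def by (simp add: integrable_max)
qed

lemma absolutely_integrable_const_Icc: "(\<lambda>_. c::real) absolutely_integrable_on {a..b::real}"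
  by (intro absolutely_integrable_continuous_real continuous_intros)

lemma absolutely_integrable_imp_integrable: "f absolutely_integrable_on S \<Longrightarrow> f integrable_on S"
  for f :: "real \<Rightarrow> real"
  by (simp add: absolutely_integrable_on_def)

lemma lmeasurable_level_set:
  fixes f :: "real \<Rightarrow> real"
  assumes "f absolutely_integrable_on {a..b}"
  shows "{x\<in>{a..b}. \<bar>f x - c\<bar> > r} \<in> lmeasurable"
proof -
  have [measurable]: "f \<in> borel_measurable (lebesgue_on {a..b})"
    by (rule integrable_imp_measurable[OF absolutely_integrable_imp_integrable[OF assms]])
  have "{x\<in>space (lebesgue_on {a..b}). \<bar>f x - c\<bar> > r} \<in> sets (lebesgue_on {a..b})" by measurable
  then have "{x\<in>{a..b}. \<bar>f x - c\<bar> > r} \<in> sets lebesgue"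
    by (simp add: sets_restrict_space_iff space_restrict_space)
  then show ?thesis by (rule fmeasurableI2[of "{a..b}", rotated -1]) auto
qed

lemma sum_integral_grid:
  fixes f :: "real \<Rightarrow> real"
  assumes f: "f integrable_on {0..1}" and n: "n > 0"
  shows "(\<Sum>j<n. integral {real j / real n..(real j + 1) / real n} f) = integral {0..1} f"
proof -
  have "(\<Sum>j<m. integral {real j / real n..(real j + 1) / real n} f) = integral {0..real m / real n} f"
    if "m \<le> n" for m
    using that
  proof (induction m)
    case (Suc m)
    have "integral {0..real m / real n} f + integral {real m / real n..real (Suc m) / real n} f
      = integral {0..real (Suc m) / real n} f"
    proof (rule Henstock_Kurzweil_Integration.integral_combine)
      have "{0..real (Suc m) / real n} \<subseteq> {0..1}" using Suc.prems by auto
      then show "f integrable_on {0..real (Suc m) / real n}"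
        using integrable_on_subinterval[OF f] by blast
    qed (use n in \<open>auto simp: divide_simps\<close>)
    then show ?case using Suc by (simp add: add.commute)
  qed simp
  from this[of n] show ?thesis using n by simp
qed

text \<open>What remains of the set-valued problem: \<open>B J\<close> stands for the norm of the
  set integral over \<open>J\<close>, and \<open>V\<close> for the variation. That one
  \<open>B\<close> serves all members is stronger than bounded variation of each of them.\<close>

locale bv_family =
  fixes G :: "(real \<Rightarrow> real) \<Rightarrow> bool" and D :: "'i set" and h :: "'i \<Rightarrow> real \<Rightarrow> real" and c :: "'i \<Rightarrow> real"
    and B :: "real set \<Rightarrow> real" and V :: real
  assumes G: "gauge_class G"
    and uniform: "uniform_integral G perron_partition D h c"
    and D_ne: "D \<noteq> {}"
    and integral_le_B: "\<And>i a b. i \<in> D \<Longrightarrow> 0 \<le> a \<Longrightarrow> a \<le> b \<Longrightarrow> b \<le> 1 \<Longrightarrow> \<bar>integral {a..b} (h i)\<bar> \<le> B {a..b}"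
    and sum_B_le: "\<And>d. d division_of {0..1} \<Longrightarrow> sum B d \<le> V"
begin

lemma has_integral_c: "i \<in> D \<Longrightarrow> (h i has_integral c i) {0..1}"
  by (rule uniform_integral_has_integral[OF uniform G])

lemma division_bound:
  assumes d: "d division_of {0..1}" and K: "K \<in> d" and i: "i \<in> D"
  shows "\<bar>integral K (h i)\<bar> \<le> B K"
proof -
  obtain a b where ab: "K = cbox a b" using division_ofD(4)[OF d K] by blast
  then have "a \<le> b" "0 \<le> a" "b \<le> 1" using division_ofD(2,3)[OF d K] by auto
  then show ?thesis using integral_le_B[OF i] ab by simp
qed

lemma abs_integrable:
  assumes i: "i \<in> D"
  shows "h i absolutely_integrable_on {0..1}"
proof -
  have "h i absolutely_integrable_on cbox 0 1"
  proof (rule bounded_variation_absolutely_integrable_interval)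
    show "h i integrable_on cbox 0 1" using has_integral_c[OF i] by auto
    fix d assume "d division_of cbox (0::real) 1"
    then have d: "d division_of {0..1}" by simp
    have "(\<Sum>K\<in>d. norm (integral K (h i))) \<le> sum B d"
      using division_bound[OF d _ i] by (intro sum_mono) auto
    also have "\<dots> \<le> V" by (rule sum_B_le[OF d])
    finally show "(\<Sum>K\<in>d. norm (integral K (h i))) \<le> V" .
  qed
  then show ?thesis by simp
qed

text \<open>Used for finite nonempty subfamilies; the supremum over all of \<open>D\<close> may fail
  to be measurable.\<close>

definition envelope :: "'i set \<Rightarrow> real \<Rightarrow> real" where
  "envelope K x = Max ((\<lambda>i. \<bar>h i x\<bar>) ` K)"

lemma envelope_insert: "finite K \<Longrightarrow> K \<noteq> {} \<Longrightarrow> envelope (insert i K) x = max \<bar>h i x\<bar> (envelope K x)"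
  by (simp add: envelope_def)

lemma envelope_abs_integrable:
  assumes "finite K" "K \<noteq> {}" "K \<subseteq> D"
  shows "envelope K absolutely_integrable_on {0..1}"
  using assms
proof (induction K rule: finite_ne_induct)
  case (singleton i)
  have "envelope {i} = (\<lambda>x. \<bar>h i x\<bar>)" by (auto simp: envelope_def)
  then show ?case using abs_integrable[of i] singleton by (simp add: set_integrable_abs)
next
  case (insert i K)
  then have "envelope (insert i K) = (\<lambda>x. max \<bar>h i x\<bar> (envelope K x))"
    using envelope_insert[of K i] by blast
  then show ?case using insert abs_integrable[of i]
    by (simp add: absolutely_integrable_max_real set_integrable_abs)
qed

lemma envelope_nonneg: "finite K \<Longrightarrow> K \<noteq> {} \<Longrightarrow> 0 \<le> envelope K x"
  unfolding envelope_def by (subst Max_ge_iff) auto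

text \<open>The member attaining the maximum changes from tag to tag. On each interval Henstock's
  lemma replaces its value by its integral, and \<open>B I\<close> bounds the integrals of all
  members. Hence the bound does not grow with \<open>K\<close>.\<close>

lemma integral_envelope_le:
  assumes K: "finite K" "K \<noteq> {}" "K \<subseteq> D"
  shows "integral {0..1} (envelope K) \<le> V"
proof (rule field_le_epsilon)
  fix e :: real assume e: "e > 0"
  \<comment> \<open>One Henstock error for each member of \<open>K\<close> and one for the envelope
    itself.\<close>
  define e' where "e' = e / (real (card K) + 1)"
  have e': "e' > 0" using e by (simp add: e'_def)
  have "envelope K integrable_on cbox 0 1"
    using envelope_abs_integrable[OF K] by (simp add: absolutely_integrable_imp_integrable)
  note int = integrable_integral[OF this, unfolded has_integral, rule_format, OF e']
  obtain \<gamma>0 where g0: "gauge \<gamma>0 \<and> (\<forall>p. p tagged_division_of cbox 0 1 \<and> \<gamma>0 fine p \<longrightarrow>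
       norm ((\<Sum>(t,I)\<in>p. measure lborel I *\<^sub>R envelope K t) - integral (cbox 0 1) (envelope K)) < e')"
    by (rule exE[OF int])
  have \<gamma>0: "gauge \<gamma>0"
    "\<And>p. p tagged_division_of cbox 0 1 \<Longrightarrow> \<gamma>0 fine p \<Longrightarrow>
       norm ((\<Sum>(t,I)\<in>p. measure lborel I *\<^sub>R envelope K t) - integral (cbox 0 1) (envelope K)) < e'"
    by (rule conjunct1[OF g0], rule conjunct2[OF g0, rule_format], rule conjI)
  define S where "S p i = (\<Sum>(t,I)\<in>p. \<bar>measure lborel I * h i t - integral I (h i)\<bar>)" for p i
  have "\<exists>\<gamma>. gauge \<gamma> \<and> (\<forall>p. p tagged_partial_division_of cbox 0 1 \<longrightarrow> \<gamma> fine p \<longrightarrow> S p i < e')" if "i \<in> K" for i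
  proof -
    have "h i integrable_on cbox 0 1" using has_integral_c[of i] that K by auto
    then obtain \<gamma> where "gauge \<gamma>" "\<And>p. p tagged_partial_division_of cbox 0 1 \<Longrightarrow> \<gamma> fine p \<Longrightarrow>
        (\<Sum>(t,I)\<in>p. norm (measure lborel I *\<^sub>R h i t - integral I (h i))) < e'"
      using Henstock_lemma[OF _ e', of "h i" 0 1] by (auto simp del: real_norm_def)
    then show ?thesis by (intro exI[of _ \<gamma>]) (simp add: S_def)
  qed
  then obtain \<gamma> where \<gamma>: "\<And>i. i \<in> K \<Longrightarrow> gauge (\<gamma> i)"
    "\<And>i p. i \<in> K \<Longrightarrow> p tagged_partial_division_of cbox 0 1 \<Longrightarrow> \<gamma> i fine p \<Longrightarrow> S p i < e'" by metis
  have "gauge (\<lambda>x. \<gamma>0 x \<inter> \<Inter>{\<gamma> i x | i. i \<in> K})"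
    using \<gamma>0(1) \<gamma>(1) K by (intro gauge_Int gauge_Inter) auto
  from fine_division_exists_real[OF this] obtain p where p: "p tagged_division_of {0..1}"
    and "\<gamma>0 fine p" "\<And>i. i \<in> K \<Longrightarrow> \<gamma> i fine p" unfolding fine_Int fine_Inter by metis
  have pp: "p tagged_partial_division_of cbox 0 1" using p by (simp add: tagged_division_of_def)
  note snd_p = division_of_tagged_division[OF p]
  obtain i0 where i0: "i0 \<in> K" using K by blast
  \<comment> \<open>Passing from tagged intervals to the set of intervals merges degenerate ones
    with different tags; a summand that vanishes on them makes this harmless.\<close>
  define b where "b = (\<lambda>I. if interior I = {} then 0 else B I)"
  have "integral {0..1} (envelope K) \<le> (\<Sum>(t,I)\<in>p. measure lborel I * envelope K t) + e'"
    using \<gamma>0(2)[of p] p \<open>\<gamma>0 fine p\<close> by simp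
  also have "(\<Sum>(t,I)\<in>p. measure lborel I * envelope K t)
    \<le> (\<Sum>(t,I)\<in>p. (\<Sum>i\<in>K. \<bar>measure lborel I * h i t - integral I (h i)\<bar>) + b I)"
  proof (rule sum_mono, clarify)
    fix t I assume tI: "(t, I) \<in> p"
    have "envelope K t \<in> (\<lambda>i. \<bar>h i t\<bar>) ` K" unfolding envelope_def using K by (intro Max_in) auto
    then obtain i where i: "i \<in> K" "envelope K t = \<bar>h i t\<bar>" by auto
    have "I \<in> snd ` p" using tI by force
    obtain u v where uv: "I = cbox u v" using tagged_division_ofD(4)[OF p tI] by blast
    have "\<bar>integral I (h i)\<bar> \<le> b I"
    proof (cases "interior I = {}")
      case True
      then have "measure lborel I = 0" unfolding uv content_eq_0_interior .
      then have "integral I (h i) = 0" unfolding uv by (rule integral_null)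
      then show ?thesis using True by (simp add: b_def)
    next
      case False
      then show ?thesis using division_bound[OF snd_p \<open>I \<in> snd ` p\<close>, of i] i K by (auto simp: b_def)
    qed
    moreover have "\<bar>measure lborel I * h i t - integral I (h i)\<bar>
        \<le> (\<Sum>i\<in>K. \<bar>measure lborel I * h i t - integral I (h i)\<bar>)"
      using i K by (intro member_le_sum[where f="\<lambda>i. \<bar>measure lborel I * h i t - integral I (h i)\<bar>"]) auto
    moreover have "measure lborel I * envelope K t = \<bar>measure lborel I * h i t\<bar>"
      by (simp add: i abs_mult)
    ultimately show "measure lborel I * envelope K t
        \<le> (\<Sum>i\<in>K. \<bar>measure lborel I * h i t - integral I (h i)\<bar>) + b I" by linarith
  qed
  also have "\<dots> = (\<Sum>i\<in>K. \<Sum>(t,I)\<in>p. \<bar>measure lborel I * h i t - integral I (h i)\<bar>) + (\<Sum>(t,I)\<in>p. b I)"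
    unfolding case_prod_unfold sum.distrib by (subst sum.swap) simp
  also have "(\<Sum>i\<in>K. \<Sum>(t,I)\<in>p. \<bar>measure lborel I * h i t - integral I (h i)\<bar>) \<le> (\<Sum>i\<in>K. e')"
    using \<gamma>(2)[OF _ pp] \<open>\<And>i. i \<in> K \<Longrightarrow> \<gamma> i fine p\<close> by (intro sum_mono less_imp_le) (simp add: S_def)
  also have "(\<Sum>(t,I)\<in>p. b I) = sum b (snd ` p)"
    by (rule sum.over_tagged_division_lemma[OF p]) (simp add: b_def)
  also have "sum b (snd ` p) \<le> sum B (snd ` p)"
  proof (rule sum_mono)
    fix I assume "I \<in> snd ` p"
    from division_bound[OF snd_p this, of i0] i0 K show "b I \<le> B I" by (auto simp: b_def)
  qed
  also have "sum B (snd ` p) \<le> V" by (rule sum_B_le[OF snd_p])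
  finally have "integral {0..1} (envelope K) \<le> (real (card K) + 1) * e' + V" by (simp add: algebra_simps)
  then show "integral {0..1} (envelope K) \<le> V + e" by (simp add: e'_def)
qed

text \<open>A finite subfamily whose envelope nearly maximises the integral
  dominates every member of the family up to a small error.\<close>

lemma uniformly_integrable:
  assumes e: "e > 0"
  obtains M where "M > 0" "\<And>i. i \<in> D \<Longrightarrow> integral {0..1} (\<lambda>x. max (\<bar>h i x\<bar> - M) 0) \<le> e"
proof -
  define F where "F = {K. finite K \<and> K \<noteq> {} \<and> K \<subseteq> D}"
  define W where "W = (SUP K\<in>F. integral {0..1} (envelope K))"
  obtain i0 where "i0 \<in> D" using D_ne by blast
  then have Fne: "F \<noteq> {}" by (auto simp: F_def intro!: exI[of _ "{i0}"])
  have bdd: "bdd_above ((\<lambda>K. integral {0..1} (envelope K)) ` F)"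
    by (intro bdd_aboveI2[of _ _ V]) (auto simp: F_def intro: integral_envelope_le)
  obtain K where K: "K \<in> F" "W - e/2 < integral {0..1} (envelope K)"
    using less_cSUP_iff[OF Fne bdd, of "W - e/2"] e by (auto simp: W_def)
  define w where "w = envelope K"
  have K': "finite K" "K \<noteq> {}" "K \<subseteq> D" using K by (auto simp: F_def)
  have w: "w absolutely_integrable_on {0..1}" unfolding w_def by (rule envelope_abs_integrable[OF K'])
  have w0: "w x \<ge> 0" for x unfolding w_def by (rule envelope_nonneg[OF K'(1,2)])
  have wint: "(\<lambda>x. max (w x - c) 0) absolutely_integrable_on {0..1}" for c
    by (intro absolutely_integrable_max_real absolutely_integrable_const_Icc set_integral_diff(1) w)
  \<comment> \<open>Uniformity over the family is reduced to truncating the single integrable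
    function \<open>w\<close>.\<close>
  have "(\<lambda>k. integral {0..1} (\<lambda>x. max (w x - real k) 0)) \<longlonglongrightarrow> integral {0..1::real} (\<lambda>x. 0::real)"
  proof (rule Equivalence_Lebesgue_Henstock_Integration.dominated_convergence(2)[where h = w])
    show "(\<lambda>k. max (w x - real k) 0) \<longlonglongrightarrow> 0" if "x \<in> {0..1}" for x
    proof (rule tendsto_eventually)
      show "\<forall>\<^sub>F k in sequentially. max (w x - real k) 0 = 0"
        using eventually_ge_at_top[of "nat \<lceil>w x\<rceil>"] by eventually_elim linarith
    qed
  qed (use w wint w0 in \<open>auto simp: absolutely_integrable_imp_integrable\<close>)
  then have "\<forall>\<^sub>F k in sequentially. integral {0..1} (\<lambda>x. max (w x - real k) 0) < e/2"
    using e by (intro order_tendstoD(2)) auto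
  then have "\<forall>\<^sub>F k in sequentially. integral {0..1} (\<lambda>x. max (w x - real k) 0) < e/2 \<and> k \<ge> 1"
    using eventually_ge_at_top[of "1::nat"] by (rule eventually_conj)
  then obtain k :: nat where k: "integral {0..1} (\<lambda>x. max (w x - real k) 0) < e/2" "k \<ge> 1"
    unfolding eventually_sequentially by blast
  have "integral {0..1} (\<lambda>x. max (\<bar>h i x\<bar> - real k) 0) \<le> e" if i: "i \<in> D" for i
  proof -
    have hi: "(\<lambda>x. \<bar>h i x\<bar>) absolutely_integrable_on {0..1}"
      by (rule set_integrable_abs[OF abs_integrable[OF i]])
    have m: "(\<lambda>x. max \<bar>h i x\<bar> (w x)) absolutely_integrable_on {0..1}"
      by (rule absolutely_integrable_max_real[OF hi w])
    have "envelope (insert i K) = (\<lambda>x. max \<bar>h i x\<bar> (w x))"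
      using envelope_insert[OF K'(1,2), of i] unfolding w_def by blast
    moreover have "insert i K \<in> F" using K' i by (auto simp: F_def)
    ultimately have "integral {0..1} (\<lambda>x. max \<bar>h i x\<bar> (w x)) \<le> W"
      unfolding W_def using cSUP_upper[OF _ bdd, of "insert i K"] by simp
    \<comment> \<open>The enlarged envelope cannot exceed the supremum \<open>W\<close>, of which
      \<open>w\<close> falls short by less than e/2.\<close>
    then have le: "integral {0..1} (\<lambda>x. max \<bar>h i x\<bar> (w x)) - integral {0..1} w \<le> e/2"
      using K(2) unfolding w_def by simp
    have "integral {0..1} (\<lambda>x. max (\<bar>h i x\<bar> - real k) 0)
        \<le> integral {0..1} (\<lambda>x. (max \<bar>h i x\<bar> (w x) - w x) + max (w x - real k) 0)"
    proof (rule integral_le)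
      show "(\<lambda>x. max (\<bar>h i x\<bar> - real k) 0) integrable_on {0..1}"
        by (intro absolutely_integrable_imp_integrable absolutely_integrable_max_real
            absolutely_integrable_const_Icc set_integral_diff(1) hi)
      show "(\<lambda>x. (max \<bar>h i x\<bar> (w x) - w x) + max (w x - real k) 0) integrable_on {0..1}"
        by (intro integrable_add integrable_diff absolutely_integrable_imp_integrable m w wint)
    qed auto
    also have "\<dots> = integral {0..1} (\<lambda>x. max \<bar>h i x\<bar> (w x)) - integral {0..1} w
        + integral {0..1} (\<lambda>x. max (w x - real k) 0)"
      using absolutely_integrable_imp_integrable[OF m] absolutely_integrable_imp_integrable[OF w]
        absolutely_integrable_imp_integrable[OF wint[of "real k"]]
      by (simp add: integral_add integral_diff integrable_diff)
    finally show ?thesis using le k(1) by simp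
  qed
  then show ?thesis using that[of "real k"] k(2) by auto
qed

end

section \<open>Approximation by averages\<close>

definition grid_cell :: "nat \<Rightarrow> nat \<Rightarrow> real set" where
  "grid_cell n j = {real j / real n..(real j + 1) / real n}"

lemma measure_grid_cell: "n > 0 \<Longrightarrow> measure lborel (grid_cell n j) = 1 / real n"
  by (simp add: grid_cell_def divide_right_mono add_divide_distrib)

lemma grid_cell_subset: "j < n \<Longrightarrow> grid_cell n j \<subseteq> {0..1}"
  by (auto simp: grid_cell_def divide_simps)

lemma interior_grid_cells_disjoint:
  assumes "j \<noteq> k" "n > 0"
  shows "interior (grid_cell n j) \<inter> interior (grid_cell n k) = {}"
proof -
  have *: "interior (grid_cell n j) \<inter> interior (grid_cell n k) = {}" if "j < k" for j k
  proof -
    have "(real j + 1) / real n \<le> real k / real n" using that by (intro divide_right_mono) auto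
    then show ?thesis by (auto simp: grid_cell_def)
  qed
  show ?thesis using assms *[of j k] *[of k j] by (cases "j < k") auto
qed

lemma negligible_grid_cells_Int: "j \<noteq> k \<Longrightarrow> n > 0 \<Longrightarrow> negligible (grid_cell n j \<inter> grid_cell n k)"
  using interior_grid_cells_disjoint[of j k n]
  by (subst negligible_convex_interior) (auto simp: grid_cell_def intro!: convex_Int)

lemma integral_le_by_excess:
  fixes f :: "real \<Rightarrow> real"
  assumes f: "f absolutely_integrable_on S" and T: "T \<in> lmeasurable" "T \<subseteq> S" and M: "M \<ge> 0"
  shows "integral T (\<lambda>x. \<bar>f x\<bar>) \<le> M * measure lebesgue T + integral T (\<lambda>x. max (\<bar>f x\<bar> - M) 0)"
proof -
  have fT: "f absolutely_integrable_on T" using set_integrable_subset[OF f _ T(2)] T(1) by auto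
  have c: "(\<lambda>_. c::real) absolutely_integrable_on T" for c
    using T(1) by (simp add: absolutely_integrable_on_def integrable_on_const)
  have u: "(\<lambda>x. max (\<bar>f x\<bar> - M) 0) integrable_on T"
    by (intro absolutely_integrable_imp_integrable absolutely_integrable_max_real
        set_integral_diff(1) set_integrable_abs fT c)
  have "integral T (\<lambda>x. \<bar>f x\<bar>) \<le> integral T (\<lambda>x. M + max (\<bar>f x\<bar> - M) 0)"
    using absolutely_integrable_imp_integrable[OF set_integrable_abs[OF fT]] c[of M] u
    by (intro integral_le) (auto intro: integrable_add absolutely_integrable_imp_integrable)
  also have "\<dots> = integral T (\<lambda>x. M * 1) + integral T (\<lambda>x. max (\<bar>f x\<bar> - M) 0)"
    using absolutely_integrable_imp_integrable[OF c[of M]] u by (simp add: integral_add)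
  also have "integral T (\<lambda>x. M * 1) = M * measure lebesgue T"
    using T(1) by (simp only: integral_mult_right lmeasure_integral)
  finally show ?thesis .
qed

context bv_family
begin

lemma excess_abs_integrable:
  assumes "i \<in> D"
  shows "(\<lambda>x. max (\<bar>h i x\<bar> - M) 0) absolutely_integrable_on {0..1}"
  by (intro absolutely_integrable_max_real absolutely_integrable_const_Icc set_integral_diff(1)
      set_integrable_abs abs_integrable assms)

lemma uniformly_absolutely_continuous:
  assumes e: "e > 0"
  obtains \<eta> where "\<eta> > 0"
    "\<And>i S. i \<in> D \<Longrightarrow> S \<in> lmeasurable \<Longrightarrow> S \<subseteq> {0..1} \<Longrightarrow> measure lebesgue S \<le> \<eta> \<Longrightarrow>
       integral S (\<lambda>x. \<bar>h i x\<bar>) \<le> e"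
proof -
  have "e/2 > 0" using e by simp
  from uniformly_integrable[OF this] obtain M where M: "M > 0"
    "\<And>i. i \<in> D \<Longrightarrow> integral {0..1} (\<lambda>x. max (\<bar>h i x\<bar> - M) 0) \<le> e/2" by blast
  show ?thesis
  proof
    \<comment> \<open>On a set of this measure the part below the level \<open>M\<close> contributes
      at most e/2, and the excess over \<open>M\<close> another e/2.\<close>
    show "e / (2 * M) > 0" using e M by simp
    fix i and S :: "real set"
    assume i: "i \<in> D" and S: "S \<in> lmeasurable" "S \<subseteq> {0..1}" "measure lebesgue S \<le> e / (2 * M)"
    note u = excess_abs_integrable[OF i, of M]
    have "integral S (\<lambda>x. max (\<bar>h i x\<bar> - M) 0) \<le> integral {0..1} (\<lambda>x. max (\<bar>h i x\<bar> - M) 0)"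
      using u S set_integrable_subset[OF u _ S(2)]
      by (intro integral_subset_le) (auto simp: absolutely_integrable_imp_integrable)
    moreover have "M * measure lebesgue S \<le> e/2" using S(3) M(1) by (simp add: field_simps)
    ultimately show "integral S (\<lambda>x. \<bar>h i x\<bar>) \<le> e"
      using integral_le_by_excess[OF abs_integrable[OF i] S(1,2), of M] M(1) M(2)[OF i] by simp
  qed
qed

definition average :: "nat \<Rightarrow> 'i \<Rightarrow> nat \<Rightarrow> real" where
  "average n i j = real n * integral (grid_cell n j) (h i)"

text \<open>On the points where the gauge exceeds the mesh, Henstock's lemma compares the values
  of the function with its averages. These points need not form a measurable set, but for a fine
  mesh they have almost full outer measure.\<close>

lemma grid_approximation:
  assumes \<kappa>: "\<kappa> > 0"
  obtains n where "n > 0"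
    "\<And>i. i \<in> D \<Longrightarrow> (\<Sum>j<n. integral (grid_cell n j) (\<lambda>x. \<bar>h i x - average n i j\<bar>)) \<le> \<kappa>"
proof -
  \<comment> \<open>The budget is 2 * e for the points of \<open>A m\<close>, 2 * e for the excess
    over \<open>M\<close> and 2 * e for the sets \<open>Q j\<close>.\<close>
  define e where "e = \<kappa>/8"
  have e: "e > 0" using \<kappa> by (simp add: e_def)
  obtain M where M: "M > 0" "\<And>i. i \<in> D \<Longrightarrow> integral {0..1} (\<lambda>x. max (\<bar>h i x\<bar> - M) 0) \<le> e"
    using uniformly_integrable[OF e] by blast
  define \<eta> where "\<eta> = e / M"
  have \<eta>: "\<eta> > 0" using e M by (simp add: \<eta>_def)
  obtain \<delta> where \<delta>: "G \<delta>"
    "\<And>p i. p tagged_partial_division_of {0..1} \<Longrightarrow> gauge_fine \<delta> p \<Longrightarrow> i \<in> D \<Longrightarrow>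
       (\<Sum>(t, I)\<in>p. \<bar>measure lborel I * h i t - integral I (h i)\<bar>) \<le> e"
    using uniform_saks_henstock[OF uniform G e] by blast
  have \<delta>pos: "\<delta> t > 0" if "t \<in> {0..1}" for t using \<delta>(1) G that by (auto simp: gauge_class_def gauge01_def)
  \<comment> \<open>Outer measure is continuous along increasing sequences of arbitrary sets; this
    yields \<open>m\<close>, and the mesh is then 1 / Suc m.\<close>
  define A where "A = (\<lambda>n. {t\<in>{0..1}. \<delta> t > 1 / real (Suc n)})"
  have "(SUP n. outer_measure_of lebesgue (A n)) = outer_measure_of lebesgue (\<Union>n. A n)"
  proof (rule SUP_outer_measure_of_incseq)
    show "incseq A"
    proof (rule incseq_SucI, rule subsetI)
      fix n t assume t: "t \<in> A n"
      have "1 / real (Suc (Suc n)) \<le> 1 / real (Suc n)" by (simp add: divide_simps)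
      then show "t \<in> A (Suc n)" using t by (auto simp: A_def)
    qed
  qed simp
  also have "(\<Union>n. A n) = {0..1}"
  proof -
    have "\<exists>n. t \<in> A n" if "t \<in> {0..1}" for t
      using reals_Archimedean[OF \<delta>pos[OF that]] that by (auto simp: A_def inverse_eq_divide)
    then show ?thesis by (auto simp: A_def)
  qed
  finally have "(SUP n. outer_measure_of lebesgue (A n)) = 1" by simp
  moreover have "ennreal (1 - \<eta>) < 1" using \<eta> by (simp add: ennreal_less_one_iff)
  ultimately obtain m where m: "ennreal (1 - \<eta>) < outer_measure_of lebesgue (A m)"
    by (metis less_SUP_iff)
  define n where "n = Suc m"
  have n: "n > 0" by (simp add: n_def)
  let ?J = "grid_cell n"
  have J: "?J j \<in> lmeasurable" "?J j \<subseteq> {0..1}" if "j < n" for j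
    using grid_cell_subset[OF that] by (auto simp: grid_cell_def)
  have "(\<Sum>j<n. integral (?J j) (\<lambda>x. \<bar>h i x - average n i j\<bar>)) \<le> \<kappa>" if i: "i \<in> D" for i
  proof -
    let ?a = "average n i"
    \<comment> \<open>A cell tagged by one of its points in \<open>A m\<close> is fine for the
      gauge, so Henstock's lemma adds up the deviations, with one tag per cell.\<close>
    have part: "(\<Sum>j\<in>K. \<bar>h i (s j) - ?a j\<bar> / n) \<le> e"
      if K: "K \<subseteq> {..<n}" and s: "\<And>j. j \<in> K \<Longrightarrow> s j \<in> A m \<inter> ?J j" for s K
    proof -
      define p where "p = (\<lambda>j. (s j, ?J j)) ` K"
      have inj: "inj_on (\<lambda>j. (s j, ?J j)) K"
        using n by (auto simp: inj_on_def grid_cell_def Icc_eq_Icc divide_simps)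
      have "p tagged_partial_division_of {0..1}"
        unfolding tagged_partial_division_of_def
      proof (intro conjI allI impI; (elim conjE)?)
        show "finite p" using K by (auto simp: p_def intro: finite_subset)
        show "x \<in> I" "I \<subseteq> {0..1}" "\<exists>a b. I = cbox a b" if xI: "(x, I) \<in> p" for x I
        proof -
          obtain j where j: "j \<in> K" "x = s j" "I = ?J j" using xI by (auto simp: p_def)
          then show "x \<in> I" "I \<subseteq> {0..1}" using s[OF j(1)] J(2) K by auto
          show "\<exists>a b. I = cbox a b" using j by (auto simp: grid_cell_def)
        qed
        show "interior I1 \<inter> interior I2 = {}"
          if "(x1, I1) \<in> p" "(x2, I2) \<in> p" "(x1, I1) \<noteq> (x2, I2)" for x1 I1 x2 I2
        proof -
          from that obtain j k where "I1 = ?J j" "I2 = ?J k" "j \<noteq> k" by (auto simp: p_def)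
          then show ?thesis using interior_grid_cells_disjoint[of j k n] n by simp
        qed
      qed
      moreover have "gauge_fine \<delta> p"
      proof -
        have "?J j \<subseteq> {s j - \<delta> (s j)<..<s j + \<delta> (s j)}" if "j \<in> K" for j
        proof -
          have "\<delta> (s j) > 1 / real n" "s j \<in> ?J j" using s[OF that] by (auto simp: A_def n_def)
          then show ?thesis by (auto simp: grid_cell_def add_divide_distrib)
        qed
        then show ?thesis by (auto simp: gauge_fine_def p_def)
      qed
      ultimately have "(\<Sum>(t, I)\<in>p. \<bar>measure lborel I * h i t - integral I (h i)\<bar>) \<le> e"
        using \<delta>(2) i by blast
      also have "(\<Sum>(t, I)\<in>p. \<bar>measure lborel I * h i t - integral I (h i)\<bar>)
          = (\<Sum>j\<in>K. \<bar>measure lborel (?J j) * h i (s j) - integral (?J j) (h i)\<bar>)"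
        unfolding p_def by (subst sum.reindex[OF inj]) simp
      also have "\<dots> = (\<Sum>j\<in>K. \<bar>h i (s j) - ?a j\<bar> / n)"
      proof (rule sum.cong[OF refl])
        fix j
        have "measure lborel (?J j) * h i (s j) - integral (?J j) (h i) = (h i (s j) - ?a j) / n"
          using n by (simp add: measure_grid_cell average_def field_simps)
        then show "\<bar>measure lborel (?J j) * h i (s j) - integral (?J j) (h i)\<bar> = \<bar>h i (s j) - ?a j\<bar> / n"
          by simp
      qed
      finally show ?thesis .
    qed
    \<comment> \<open>A crude bound that makes the supremum of the deviations over a cell
      finite.\<close>
    have single: "\<bar>h i x - ?a j\<bar> \<le> n * e" if "j < n" "x \<in> A m \<inter> ?J j" for x j
      using part[of "{j}" "\<lambda>_. x"] that n by (simp add: field_simps)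
    \<comment> \<open>The tag nearly attains the supremum over its cell, so that
      \<open>part\<close>, although it admits one tag per cell, controls all points of
      \<open>A m\<close> at once.\<close>
    have "\<exists>s. s \<in> A m \<inter> ?J j \<and> (\<forall>x\<in>A m \<inter> ?J j. \<bar>h i x - ?a j\<bar> \<le> \<bar>h i s - ?a j\<bar> + e)"
      if j: "j < n" and ne: "A m \<inter> ?J j \<noteq> {}" for j
    proof -
      let ?X = "(\<lambda>x. \<bar>h i x - ?a j\<bar>) ` (A m \<inter> ?J j)"
      have bdd: "bdd_above ?X" using single[OF j] by (intro bdd_aboveI2)
      then obtain s where "s \<in> A m \<inter> ?J j" "Sup ?X - e < \<bar>h i s - ?a j\<bar>"
        using less_cSUP_iff[OF ne bdd, of "Sup ?X - e"] e by auto
      moreover have "\<bar>h i x - ?a j\<bar> \<le> Sup ?X" if "x \<in> A m \<inter> ?J j" for x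
        by (rule cSUP_upper[OF that bdd])
      ultimately show ?thesis by (intro exI[of _ s]) fastforce
    qed
    then obtain s where s: "\<And>j. j < n \<Longrightarrow> A m \<inter> ?J j \<noteq> {} \<Longrightarrow> s j \<in> A m \<inter> ?J j"
      "\<And>j x. j < n \<Longrightarrow> x \<in> A m \<inter> ?J j \<Longrightarrow> \<bar>h i x - ?a j\<bar> \<le> \<bar>h i (s j) - ?a j\<bar> + e"
      by (metis empty_iff)
    define K where "K = {j. j < n \<and> A m \<inter> ?J j \<noteq> {}}"
    define r where "r = (\<lambda>j. if j \<in> K then \<bar>h i (s j) - ?a j\<bar> + e else 0)"
    have r0: "r j \<ge> 0" for j using e by (simp add: r_def)
    have r_sum: "(\<Sum>j<n. r j / n) \<le> 2 * e"
    proof -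
      have "(\<Sum>j<n. r j / n) = (\<Sum>j\<in>K. \<bar>h i (s j) - ?a j\<bar> / n + e / n)"
        by (rule sum.mono_neutral_cong_right) (auto simp: K_def r_def add_divide_distrib)
      also have "\<dots> = (\<Sum>j\<in>K. \<bar>h i (s j) - ?a j\<bar> / n) + card K * (e / n)" by (simp add: sum.distrib)
      also have "(\<Sum>j\<in>K. \<bar>h i (s j) - ?a j\<bar> / n) \<le> e" using s(1) by (intro part) (auto simp: K_def)
      also have "card K * (e / n) \<le> n * (e / n)"
        using card_mono[of "{..<n}" K] e by (intro mult_right_mono) (auto simp: K_def)
      finally show ?thesis using n by simp
    qed
    \<comment> \<open>Where the cellwise bound \<open>r j\<close> fails. This set is measurable and
      disjoint from \<open>A m\<close>, so the large outer measure of \<open>A m\<close> forces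
      these sets to have total measure at most \<open>\<eta>\<close>.\<close>
    define Q where "Q = (\<lambda>j. {x\<in>?J j. \<bar>h i x - ?a j\<bar> > r j})"
    have hJ: "h i absolutely_integrable_on ?J j" if "j < n" for j
      using absolutely_integrable_on_subinterval[OF abs_integrable[OF i]] J(2)[OF that] by (simp add: grid_cell_def)
    have Q: "Q j \<in> lmeasurable" "Q j \<subseteq> ?J j" "Q j \<inter> A m = {}" if j: "j < n" for j
    proof -
      show "Q j \<in> lmeasurable"
        using lmeasurable_level_set[OF hJ[OF j, unfolded grid_cell_def]] by (simp add: Q_def grid_cell_def)
      show "Q j \<inter> A m = {}"
        using s(2)[OF j] j by (force simp: Q_def r_def K_def)
    qed (auto simp: Q_def)
    have Q_sum: "(\<Sum>j<n. measure lebesgue (Q j)) \<le> \<eta>"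
    proof -
      define T where "T = (\<Union>j<n. Q j)"
      have T: "T \<in> lmeasurable" unfolding T_def using Q(1) by (intro fmeasurable.finite_UN) auto
      have "Q j \<subseteq> {0..1}" if "j < n" for j using Q(2)[OF that] J(2)[OF that] by (rule subset_trans)
      then have T01: "T \<subseteq> {0..1}" by (auto simp: T_def)
      have TA: "T \<inter> A m = {}" unfolding T_def using Q(3) by blast
      have "measure lebesgue T = (\<Sum>j<n. measure lebesgue (Q j))"
        unfolding T_def
      proof (rule measure_negligible_finite_Union_image)
        show "pairwise (\<lambda>j k. negligible (Q j \<inter> Q k)) {..<n}"
        proof (rule pairwiseI)
          fix j k :: nat assume "j \<in> {..<n}" "k \<in> {..<n}" "j \<noteq> k"
          then show "negligible (Q j \<inter> Q k)"
            using Q(2)[of j] Q(2)[of k] n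
            by (intro negligible_subset[OF negligible_grid_cells_Int[of j k n]]) auto
        qed
      qed (use Q in auto)
      moreover have "measure lebesgue T \<le> \<eta>"
      proof (rule ccontr)
        assume "\<not> measure lebesgue T \<le> \<eta>"
        have "outer_measure_of lebesgue (A m) \<le> outer_measure_of lebesgue ({0..1} - T)"
          using TA by (intro outer_measure_of_mono) (auto simp: A_def)
        also have "\<dots> = emeasure lebesgue ({0..1} - T)" using T by (intro outer_measure_of_eq) auto
        also have "\<dots> = ennreal (measure lebesgue ({0..1} - T))"
          using T by (intro emeasure_eq_measure2) (auto intro: fmeasurable_Diff)
        also have "measure lebesgue ({0..1} - T) = 1 - measure lebesgue T"
          using T T01 by (subst measurable_measure_Diff) auto
        also have "ennreal (1 - measure lebesgue T) \<le> ennreal (1 - \<eta>)"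
          using \<open>\<not> measure lebesgue T \<le> \<eta>\<close> by (intro ennreal_leI) simp
        finally show False using m by simp
      qed
      ultimately show ?thesis by simp
    qed
    define u where "u = (\<lambda>x. max (\<bar>h i x\<bar> - M) 0)"
    have u: "u absolutely_integrable_on {0..1}" unfolding u_def by (rule excess_abs_integrable[OF i])
    have uJ: "u absolutely_integrable_on ?J j" if "j < n" for j
      using absolutely_integrable_on_subinterval[OF u] J(2)[OF that] by (simp add: grid_cell_def)
    \<comment> \<open>Off \<open>Q j\<close> the deviation is at most \<open>r j\<close>. On
      \<open>Q j\<close> it is at most \<open>M\<close>, plus \<open>u\<close>, plus the modulus of
      the average, which is at most \<open>M\<close> plus the mean of \<open>u\<close>. Since
      \<open>Q j\<close> is no larger than its cell, this mean costs at most one more integral of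
      \<open>u\<close>; hence both factors 2.\<close>
    have cell: "integral (?J j) (\<lambda>x. \<bar>h i x - ?a j\<bar>)
        \<le> r j / n + 2 * integral (?J j) u + 2 * M * measure lebesgue (Q j)" if j: "j < n" for j
    proof -
      let ?q = "measure lebesgue (Q j)"
      have mJ: "measure lebesgue (?J j) = 1 / n" using measure_grid_cell[OF n, of j] by (simp add: grid_cell_def)
      have u0: "integral (?J j) u \<ge> 0"
        using uJ[OF j] by (intro integral_nonneg absolutely_integrable_imp_integrable) (auto simp: u_def)
      have "\<bar>integral (?J j) (h i)\<bar> \<le> integral (?J j) (\<lambda>x. \<bar>h i x\<bar>)"
        using integral_norm_bound_integral[of "h i" "?J j" "\<lambda>x. \<bar>h i x\<bar>"] hJ[OF j]
        by (simp add: absolutely_integrable_on_def)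
      also have "\<dots> \<le> M * measure lebesgue (?J j) + integral (?J j) u"
        unfolding u_def using M(1) J(1)[OF j] by (intro integral_le_by_excess[OF hJ[OF j]]) auto
      finally have a: "\<bar>?a j\<bar> \<le> M + n * integral (?J j) u"
        using n by (simp add: mJ average_def abs_mult field_simps)
      have "?q \<le> 1 / n" unfolding mJ[symmetric] using Q[OF j] J(1)[OF j]
        by (intro measure_mono_fmeasurable) auto
      then have "?q * (n * integral (?J j) u) \<le> integral (?J j) u"
        using n u0 mult_right_mono[of ?q "1/n" "n * integral (?J j) u"] by simp
      moreover have "?q * \<bar>?a j\<bar> \<le> ?q * (M + n * integral (?J j) u)" using a by (intro mult_left_mono) auto
      ultimately have qa: "?q * \<bar>?a j\<bar> \<le> ?q * M + integral (?J j) u" by (simp add: algebra_simps)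
      have ind: "indicat_real (Q j) integrable_on ?J j"
        unfolding integrable_on_indicator using Q(1,2)[OF j] by (simp add: Int_absorb2)
      have "integral (?J j) (\<lambda>x. \<bar>h i x - ?a j\<bar>)
          \<le> integral (?J j) (\<lambda>x. (r j + u x) + indicat_real (Q j) x * (M + \<bar>?a j\<bar>))"
      proof (rule integral_le)
        show "(\<lambda>x. \<bar>h i x - ?a j\<bar>) integrable_on ?J j"
          unfolding grid_cell_def
          by (intro absolutely_integrable_imp_integrable set_integrable_abs set_integral_diff(1)
            absolutely_integrable_const_Icc hJ[OF j, unfolded grid_cell_def])
        show "(\<lambda>x. (r j + u x) + indicat_real (Q j) x * (M + \<bar>?a j\<bar>)) integrable_on ?J j"
          using absolutely_integrable_imp_integrable[OF uJ[OF j]] ind J(1)[OF j]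
          by (intro integrable_add integrable_on_mult_left integrable_on_const) auto
        show "\<bar>h i x - ?a j\<bar> \<le> (r j + u x) + indicat_real (Q j) x * (M + \<bar>?a j\<bar>)" if "x \<in> ?J j" for x
          using that r0[of j] by (auto simp: Q_def u_def indicator_def)
      qed
      also have "\<dots> = r j / n + integral (?J j) u + ?q * (M + \<bar>?a j\<bar>)"
      proof -
        have "integral (?J j) (indicat_real (Q j)) = ?q"
          using Q(1,2)[OF j] by (subst Equivalence_Lebesgue_Henstock_Integration.integral_indicator)
            (auto simp: Int_absorb2)
        moreover have "integral (?J j) (\<lambda>_. r j) = r j / n"
          using measure_grid_cell[OF n, of j] by (simp add: grid_cell_def)
        ultimately show ?thesis
          using absolutely_integrable_imp_integrable[OF uJ[OF j]] ind J(1)[OF j]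
          by (simp add: integral_add integrable_add integrable_on_mult_left integrable_on_const)
      qed
      finally show ?thesis using qa by (simp add: algebra_simps)
    qed
    have "(\<Sum>j<n. integral (?J j) (\<lambda>x. \<bar>h i x - ?a j\<bar>))
        \<le> (\<Sum>j<n. r j / n + 2 * integral (?J j) u + 2 * M * measure lebesgue (Q j))"
      using cell by (intro sum_mono) auto
    also have "\<dots> = (\<Sum>j<n. r j / n) + 2 * (\<Sum>j<n. integral (?J j) u) + 2 * M * (\<Sum>j<n. measure lebesgue (Q j))"
      by (simp add: sum.distrib sum_distrib_left)
    also have "(\<Sum>j<n. integral (?J j) u) = integral {0..1} u"
      unfolding grid_cell_def using u n by (intro sum_integral_grid absolutely_integrable_imp_integrable)
    also have "integral {0..1} u \<le> e" unfolding u_def by (rule M(2)[OF i])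
    also have "2 * M * (\<Sum>j<n. measure lebesgue (Q j)) \<le> 2 * M * \<eta>"
      using Q_sum M(1) by (intro mult_left_mono) auto
    finally show ?thesis using r_sum M(1) \<kappa> by (simp add: \<eta>_def e_def)
  qed
  with n that show ?thesis by blast
qed

end

section \<open>From Perron partitions to free tags\<close>

lemma nonoverlapping_Icc: "nonoverlapping P \<Longrightarrow> (t, I) \<in> P \<Longrightarrow> \<exists>a b. I = {a..b}"
  by (auto simp: nonoverlapping_def)

context bv_family
begin

lemma integrable_on_Icc:
  assumes "i \<in> D" "I = {a..b}" "I \<subseteq> {0..1}"
  shows "h i integrable_on I" "(\<lambda>x. \<bar>h i x\<bar>) integrable_on I" "(\<lambda>x. \<bar>h i x - s\<bar>) integrable_on I"
    "(\<lambda>x. \<bar>s - h i x\<bar>) integrable_on I"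
proof -
  have *: "h i absolutely_integrable_on I"
    using absolutely_integrable_on_subinterval[OF abs_integrable[OF assms(1)]] assms by simp
  have s: "(\<lambda>_. s) absolutely_integrable_on I"
    unfolding assms(2) by (rule absolutely_integrable_const_Icc)
  show "h i integrable_on I" "(\<lambda>x. \<bar>h i x\<bar>) integrable_on I" "(\<lambda>x. \<bar>h i x - s\<bar>) integrable_on I"
    "(\<lambda>x. \<bar>s - h i x\<bar>) integrable_on I"
    by (intro absolutely_integrable_imp_integrable set_integrable_abs set_integral_diff(1) * s)+
qed

text \<open>Both terms of the difference are harmless on a small set: the values at the tags are
  bounded by \<open>N\<close>, and the function itself has a small integral there. Applied to tags
  near grid points and to bad tags.\<close>

lemma sum_deviation_small_support:
  assumes P: "nonoverlapping P" and i: "i \<in> D" and N: "N \<ge> 0"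
    and tags: "\<And>t I. (t, I) \<in> P \<Longrightarrow> \<bar>h i t\<bar> \<le> N \<and> I \<subseteq> {0..1} \<and> I \<subseteq> S"
    and S: "S \<in> lmeasurable" "measure lebesgue S \<le> \<eta>"
    and \<eta>: "\<And>T. T \<in> lmeasurable \<Longrightarrow> T \<subseteq> {0..1} \<Longrightarrow> measure lebesgue T \<le> \<eta> \<Longrightarrow> integral T (\<lambda>x. \<bar>h i x\<bar>) \<le> e"
  shows "(\<Sum>(t, I)\<in>P. integral I (\<lambda>x. \<bar>h i t - h i x\<bar>)) \<le> N * \<eta> + e"
proof -
  define T where "T = (\<Union>(t, I)\<in>P. I)"
  have int: "(\<lambda>x. \<bar>h i x\<bar>) integrable_on I" "(\<lambda>x. \<bar>h i t - h i x\<bar>) integrable_on I" "I \<in> lmeasurable"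
    if tI: "(t, I) \<in> P" for t I
  proof -
    obtain a b where I: "I = {a..b}" using nonoverlapping_Icc[OF P tI] by blast
    have "I \<subseteq> {0..1}" using tags[OF tI] by blast
    then show "(\<lambda>x. \<bar>h i x\<bar>) integrable_on I" "(\<lambda>x. \<bar>h i t - h i x\<bar>) integrable_on I" "I \<in> lmeasurable"
      using integrable_on_Icc[OF i I] by (auto simp: I)
  qed
  have T: "T \<in> lmeasurable"
    unfolding T_def using P int(3) by (intro fmeasurable.finite_UN) (auto simp: nonoverlapping_def)
  have "(\<Sum>(t, I)\<in>P. integral I (\<lambda>x. \<bar>h i t - h i x\<bar>))
      \<le> (\<Sum>(t, I)\<in>P. N * measure lborel I + integral I (\<lambda>x. \<bar>h i x\<bar>))"
  proof (rule sum_mono, clarify)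
    fix t I assume tI: "(t, I) \<in> P"
    obtain a b where I: "I = {a..b}" using nonoverlapping_Icc[OF P tI] by blast
    have "integral I (\<lambda>x. \<bar>h i t - h i x\<bar>) \<le> integral I (\<lambda>x. N + \<bar>h i x\<bar>)"
      using tags[OF tI] int[OF tI] I
      by (intro integral_le integrable_add) (auto intro: integrable_const_ivl)
    also have "\<dots> = integral I (\<lambda>_. N) + integral I (\<lambda>x. \<bar>h i x\<bar>)"
      using int(1)[OF tI] I by (intro integral_add) auto
    also have "integral I (\<lambda>_. N) = N * measure lborel I" using I by simp
    finally show "integral I (\<lambda>x. \<bar>h i t - h i x\<bar>) \<le> N * measure lborel I + integral I (\<lambda>x. \<bar>h i x\<bar>)" .
  qed
  also have "\<dots> = N * (\<Sum>(t, I)\<in>P. measure lborel I) + (\<Sum>(t, I)\<in>P. integral I (\<lambda>x. \<bar>h i x\<bar>))"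
    by (simp add: case_prod_unfold sum.distrib sum_distrib_left)
  also have "(\<Sum>(t, I)\<in>P. integral I (\<lambda>x. \<bar>h i x\<bar>)) = integral T (\<lambda>x. \<bar>h i x\<bar>)"
    unfolding T_def by (rule integral_unique[symmetric, OF nonoverlapping_has_integral[OF P int(1)]])
  also have "integral T (\<lambda>x. \<bar>h i x\<bar>) \<le> e"
  proof (rule \<eta>[OF T])
    have "I \<subseteq> {0..1}" if "(t, I) \<in> P" for t I using tags[OF that] by blast
    then show "T \<subseteq> {0..1}" unfolding T_def by blast
    have "measure lebesgue T \<le> measure lebesgue S"
      using tags T S(1) by (intro measure_mono_fmeasurable) (auto simp: T_def)
    then show "measure lebesgue T \<le> \<eta>" using S(2) by simp
  qed
  also have "(\<Sum>(t, I)\<in>P. measure lborel I) \<le> \<eta>"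
    using nonoverlapping_sum_measure_le[OF P _ S(1)] tags S(2) by (meson order_trans)
  finally show ?thesis using N by (simp add: mult_left_mono)
qed

text \<open>Every interval stays in the cell attached to its tag, so grouping by cells compares
  nonoverlapping pieces with the whole cell.\<close>

lemma sum_grid_deviation_le:
  assumes P: "nonoverlapping P" and i: "i \<in> D"
    and k: "\<And>t I. (t, I) \<in> P \<Longrightarrow> k t < n \<and> I \<subseteq> grid_cell n (k t)"
  shows "(\<Sum>(t, I)\<in>P. integral I (\<lambda>x. \<bar>h i x - average n i (k t)\<bar>))
    \<le> (\<Sum>j<n. integral (grid_cell n j) (\<lambda>x. \<bar>h i x - average n i j\<bar>))"
proof -
  have fin: "finite P" using P by (simp add: nonoverlapping_def)
  have "(\<Sum>(t, I)\<in>P. integral I (\<lambda>x. \<bar>h i x - average n i (k t)\<bar>))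
    = (\<Sum>j<n. \<Sum>(t, I)\<in>{p\<in>P. k (fst p) = j}. integral I (\<lambda>x. \<bar>h i x - average n i (k t)\<bar>))"
    using k by (subst sum.group[OF fin]) force+
  also have "\<dots> \<le> (\<Sum>j<n. integral (grid_cell n j) (\<lambda>x. \<bar>h i x - average n i j\<bar>))"
  proof (rule sum_mono)
    fix j assume "j \<in> {..<n}"
    then have j: "j < n" by simp
    define R where "R = {p\<in>P. k (fst p) = j}"
    let ?f = "\<lambda>x. \<bar>h i x - average n i j\<bar>"
    have R: "nonoverlapping R" unfolding R_def using P by (rule nonoverlapping_subset) auto
    have sub: "I \<subseteq> grid_cell n j" if "(t, I) \<in> R" for t I using k[of t I] that by (auto simp: R_def)
    have int: "?f integrable_on I" if tI: "(t, I) \<in> R" for t I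
    proof -
      obtain a b where "I = {a..b}" using nonoverlapping_Icc[OF R tI] by blast
      moreover have "I \<subseteq> {0..1}" using sub[OF tI] grid_cell_subset[OF j] by (rule subset_trans)
      ultimately show ?thesis by (rule integrable_on_Icc(3)[OF i])
    qed
    have "(\<Sum>(t, I)\<in>R. integral I (\<lambda>x. \<bar>h i x - average n i (k t)\<bar>)) = (\<Sum>(t, I)\<in>R. integral I ?f)"
      by (rule sum.cong) (auto simp: R_def)
    also have "\<dots> \<le> integral (grid_cell n j) ?f"
    proof (rule has_integral_subset_le[OF _ nonoverlapping_has_integral[OF R int]])
      show "(?f has_integral integral (grid_cell n j) ?f) (grid_cell n j)"
        using integrable_on_Icc(3)[OF i grid_cell_def grid_cell_subset[OF j]] by (rule integrable_integral)
    qed (use sub in auto)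
    finally show "(\<Sum>(t, I)\<in>{p\<in>P. k (fst p) = j}. integral I (\<lambda>x. \<bar>h i x - average n i (k t)\<bar>))
      \<le> integral (grid_cell n j) ?f" unfolding R_def .
  qed
  finally show ?thesis .
qed

lemma cball_subset_grid_cell:
  assumes t: "t \<in> {0..1}" and n: "n > 0" and r: "r > 0" and far: "\<And>j. j \<le> n \<Longrightarrow> \<bar>t - real j / real n\<bar> > r"
  shows "nat \<lfloor>t * real n\<rfloor> < n" "cball t r \<subseteq> grid_cell n (nat \<lfloor>t * real n\<rfloor>)"
proof -
  define j where "j = nat \<lfloor>t * real n\<rfloor>"
  \<comment> \<open>The grid point 1 is among those in \<open>far\<close>; at t = 1 the floor would
    give the index n, one past the last cell.\<close>
  have "t \<noteq> 1" using far[of n] n r by auto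
  then have "t * real n < real n" using t n by simp
  moreover have jt: "real j \<le> t * real n" "t * real n < real j + 1"
    using t by (simp_all add: j_def)
  ultimately have j: "j < n" by linarith
  have "\<bar>t - real j / real n\<bar> > r" "\<bar>t - real (Suc j) / real n\<bar> > r" using far[of j] far[of "Suc j"] j by auto
  moreover have "real j / real n \<le> t" "t \<le> (real j + 1) / real n" using jt n by (simp_all add: field_simps)
  ultimately show "nat \<lfloor>t * real n\<rfloor> < n" "cball t r \<subseteq> grid_cell n (nat \<lfloor>t * real n\<rfloor>)"
    using j unfolding j_def[symmetric] by (auto simp: grid_cell_def cball_eq_atLeastAtMost add.commute)
qed

text \<open>A tag whose value differs much from the average over its grid cell is bad. By Vitali's
  covering lemma the intervals with bad tags lie in enlargements of finitely many disjoint
  intervals that contain their tags, and to the latter Henstock's lemma applies.\<close>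

lemma bad_tags_cover:
  assumes i: "i \<in> D" and e: "e > 0" and \<kappa>: "\<kappa> > 0" and n: "n > 0"
    and \<delta>: "\<And>p. p tagged_partial_division_of {0..1} \<Longrightarrow> gauge_fine \<delta> p \<Longrightarrow>
       (\<Sum>(t, I)\<in>p. \<bar>measure lborel I * h i t - integral I (h i)\<bar>) \<le> e"
    and grid: "(\<Sum>j<n. integral (grid_cell n j) (\<lambda>x. \<bar>h i x - average n i j\<bar>)) \<le> e"
    and T: "finite T" "T \<subseteq> {0..1}"
    and r: "\<And>t. t \<in> T \<Longrightarrow> 0 < r t \<and> r t < \<delta> t"
    and far: "\<And>t j. t \<in> T \<Longrightarrow> j \<le> n \<Longrightarrow> \<bar>t - real j / real n\<bar> > r t"
    and bad: "\<And>t. t \<in> T \<Longrightarrow> \<bar>h i t - average n i (nat \<lfloor>t * real n\<rfloor>)\<bar> > \<kappa>"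
  obtains S where "S \<in> lmeasurable" "\<And>t. t \<in> T \<Longrightarrow> cball t (r t) \<subseteq> S" "measure lebesgue S \<le> 10 * e / \<kappa>"
proof -
  let ?k = "\<lambda>t. nat \<lfloor>t * real n\<rfloor>"
  let ?a = "average n i"
  have cell: "?k t < n" "cball t (r t) \<subseteq> grid_cell n (?k t)" if "t \<in> T" for t
    using that T(2) n r[OF that] far[OF that] by (intro cball_subset_grid_cell; auto)+
  \<comment> \<open>Vitali's lemma asks for bounded radii; the inserted 0 keeps the maximum defined
    when \<open>T\<close> is empty.\<close>
  have rM: "0 < r t \<and> r t \<le> Max (insert 0 (r ` T))" if "t \<in> T" for t using r[OF that] T(1) that by simp
  obtain C where "countable C" and C: "C \<subseteq> T" "pairwise (\<lambda>s t. disjnt (cball s (r s)) (cball t (r t))) C"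
    and cover: "\<And>t. t \<in> T \<Longrightarrow> \<exists>s. s \<in> C \<and> \<not> disjnt (cball t (r t)) (cball s (r s)) \<and>
      cball t (r t) \<subseteq> ball s (5 * r s)"
    by (rule Vitali_covering_lemma_cballs_balls[of T r "Max (insert 0 (r ` T))" "\<lambda>t. t"]) (erule rM, blast)
  have finC: "finite C" using C(1) T(1) by (rule finite_subset)
  have rC: "r t > 0" "r t < \<delta> t" if "t \<in> C" for t using r[of t] that C(1) by auto
  define p where "p = (\<lambda>t. (t, cball t (r t))) ` C"
  have inj: "inj_on (\<lambda>t. (t, cball t (r t))) C" by (auto simp: inj_on_def)
  have sub01: "cball t (r t) \<subseteq> {0..1}" if "t \<in> C" for t
    using cell[of t] grid_cell_subset[of "?k t" n] that C(1) by blast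
  have disj: "interior (cball s (r s)) \<inter> interior (cball t (r t)) = {}"
    if "s \<in> C" "t \<in> C" "s \<noteq> t" for s t
    using C(2) that interior_subset[of "cball s (r s)"] interior_subset[of "cball t (r t)"]
    unfolding pairwise_def disjnt_def by blast
  have part: "p tagged_partial_division_of {0..1}"
    unfolding tagged_partial_division_of_def
  proof (intro conjI allI impI; (elim conjE)?)
    show "finite p" using finC by (simp add: p_def)
    show "x \<in> I" "I \<subseteq> {0..1}" "\<exists>a b. I = cbox a b" if xI: "(x, I) \<in> p" for x I
    proof -
      have x: "x \<in> C" "I = cball x (r x)" using xI by (auto simp: p_def)
      then show "x \<in> I" "I \<subseteq> {0..1}" using sub01 rC(1)[OF x(1)] by auto
      show "\<exists>a b. I = cbox a b" using x by (auto simp: cball_eq_atLeastAtMost)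
    qed
    show "interior I1 \<inter> interior I2 = {}"
      if "(x1, I1) \<in> p" "(x2, I2) \<in> p" "(x1, I1) \<noteq> (x2, I2)" for x1 I1 x2 I2
    proof -
      have "x1 \<in> C" "x2 \<in> C" "I1 = cball x1 (r x1)" "I2 = cball x2 (r x2)" "x1 \<noteq> x2"
        using that by (auto simp: p_def)
      then show ?thesis using disj[of x1 x2] by blast
    qed
  qed
  have no: "nonoverlapping p"
    unfolding nonoverlapping_def using finC disj by (auto simp: p_def cball_eq_atLeastAtMost)
  have "{t - r t..t + r t} \<subseteq> {t - \<delta> t<..<t + \<delta> t}" if "t \<in> C" for t using rC[OF that] by auto
  then have "gauge_fine \<delta> p"
    unfolding gauge_fine_def p_def by (simp add: cball_eq_atLeastAtMost)
  from \<delta>[OF part this]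
  have sh: "(\<Sum>t\<in>C. \<bar>measure lborel (cball t (r t)) * h i t - integral (cball t (r t)) (h i)\<bar>) \<le> e"
    unfolding p_def by (subst (asm) sum.reindex[OF inj]) simp
  have "(\<Sum>(t, I)\<in>p. integral I (\<lambda>x. \<bar>h i x - ?a (?k t)\<bar>)) \<le> e"
  proof (rule order_trans[OF sum_grid_deviation_le[OF no i] grid])
    show "?k t < n \<and> I \<subseteq> grid_cell n (?k t)" if "(t, I) \<in> p" for t I
      using that cell[of t] C(1) by (auto simp: p_def)
  qed
  then have dev: "(\<Sum>t\<in>C. integral (cball t (r t)) (\<lambda>x. \<bar>h i x - ?a (?k t)\<bar>)) \<le> e"
    unfolding p_def by (subst (asm) sum.reindex[OF inj]) simp
  \<comment> \<open>On the ball the constants \<open>h i t\<close> and the average differ by more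
    than \<open>\<kappa>\<close>. Both are compared with \<open>h i\<close>, the first by Henstock's
    lemma and the second by the grid estimate, so the total length of the disjoint balls is at most
    2 * e / \<open>\<kappa>\<close>.\<close>
  have one: "\<kappa> * (2 * r t) \<le> \<bar>measure lborel (cball t (r t)) * h i t - integral (cball t (r t)) (h i)\<bar>
      + integral (cball t (r t)) (\<lambda>x. \<bar>h i x - ?a (?k t)\<bar>)" if t: "t \<in> C" for t
  proof -
    let ?I = "cball t (r t)" and ?s = "?a (?k t)"
    have I: "?I = {t - r t..t + r t}" by (simp add: cball_eq_atLeastAtMost)
    have m: "measure lborel ?I = 2 * r t" using rC[OF t] by (simp add: I)
    note int = integrable_on_Icc[OF i I sub01[OF t]]
    have const: "(\<lambda>_. ?s) integrable_on ?I" unfolding I by (rule integrable_const_ivl)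
    have "integral ?I (\<lambda>x. h i x - ?s) = integral ?I (h i) - integral ?I (\<lambda>_. ?s)"
      by (intro integral_diff int const)
    also have "integral ?I (\<lambda>_. ?s) = measure lborel ?I * ?s" by (simp add: I)
    finally have eq: "integral ?I (\<lambda>x. h i x - ?s) = integral ?I (h i) - measure lborel ?I * ?s" .
    have "\<bar>integral ?I (\<lambda>x. h i x - ?s)\<bar> \<le> integral ?I (\<lambda>x. \<bar>h i x - ?s\<bar>)"
      using integral_norm_bound_integral[of "\<lambda>x. h i x - ?s" ?I "\<lambda>x. \<bar>h i x - ?s\<bar>"] int(1) int(3)[of ?s] const
      by (simp add: integrable_diff)
    moreover have "\<kappa> * (2 * r t) \<le> \<bar>h i t - ?s\<bar> * (2 * r t)"
      using bad[of t] t C(1) rC[OF t] by (intro mult_right_mono) auto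
    moreover have "\<bar>h i t - ?s\<bar> * (2 * r t) = \<bar>measure lborel ?I * h i t - measure lborel ?I * ?s\<bar>"
      using rC[OF t] by (simp add: m abs_mult flip: right_diff_distrib)
    ultimately show ?thesis using eq by linarith
  qed
  have "\<kappa> * (\<Sum>t\<in>C. 2 * r t) = (\<Sum>t\<in>C. \<kappa> * (2 * r t))" by (rule sum_distrib_left)
  also have "\<dots> \<le> (\<Sum>t\<in>C. \<bar>measure lborel (cball t (r t)) * h i t - integral (cball t (r t)) (h i)\<bar>
      + integral (cball t (r t)) (\<lambda>x. \<bar>h i x - ?a (?k t)\<bar>))"
    by (intro sum_mono one)
  also have "\<dots> \<le> 2 * e" using sh dev by (simp add: sum.distrib)
  finally have "\<kappa> * (\<Sum>t\<in>C. 2 * r t) \<le> 2 * e" .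
  then have total: "(\<Sum>t\<in>C. 2 * r t) \<le> 2 * e / \<kappa>" using \<kappa> by (simp add: field_simps)
  \<comment> \<open>The Vitali enlargement by 5 is the origin of the constant 10.\<close>
  define S where "S = (\<Union>t\<in>C. ball t (5 * r t))"
  have "measure lebesgue S \<le> (\<Sum>t\<in>C. measure lebesgue (ball t (5 * r t)))"
    unfolding S_def using finC by (intro measure_UNION_le) auto
  also have "\<dots> = (\<Sum>t\<in>C. 5 * (2 * r t))"
    using rC by (intro sum.cong) (auto simp: ball_eq_greaterThanLessThan less_imp_le)
  also have "\<dots> \<le> 5 * (2 * e / \<kappa>)" using total by (simp flip: sum_distrib_left)
  finally have "measure lebesgue S \<le> 10 * e / \<kappa>" by simp
  moreover have "S \<in> lmeasurable" unfolding S_def using finC by (intro fmeasurable.finite_UN) auto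
  moreover have "cball t (r t) \<subseteq> S" if "t \<in> T" for t using cover[OF that] unfolding S_def by blast
  ultimately show ?thesis using that by blast
qed

text \<open>There are three kinds of tags: near a grid point, where the interval may leave its cell;
  bad ones; and the rest. The first two have their intervals in sets of measure at most
  \<open>\<eta>\<close>, where the bound \<open>N\<close> and uniform absolute continuity apply.
  Which tags are bad depends on \<open>i\<close>, but the gauge does not. The gauge is halved so
  that closed balls of that radius are still fine for \<open>\<delta>\<close>.\<close>

lemma bounded_tags_estimate:
  assumes N: "N \<ge> 0" and \<kappa>: "\<kappa> > 0"
  obtains \<delta> \<rho> where "G \<delta>" "\<rho> > 0"
    "\<And>P i. nonoverlapping P \<Longrightarrow> i \<in> D \<Longrightarrow>
       (\<And>t I. (t, I) \<in> P \<Longrightarrow> t \<in> {0..1} \<and> \<bar>h i t\<bar> \<le> N \<and> I \<subseteq> {0..1} \<and> I \<subseteq> ball t (min (\<delta> t / 2) \<rho>)) \<Longrightarrow>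
       (\<Sum>(t, I)\<in>P. integral I (\<lambda>x. \<bar>h i t - h i x\<bar>)) \<le> \<kappa>"
proof -
  have "\<kappa>/8 > 0" using \<kappa> by simp
  from uniformly_absolutely_continuous[OF this] obtain \<eta>0 where \<eta>0: "\<eta>0 > 0"
    "\<And>i S. i \<in> D \<Longrightarrow> S \<in> lmeasurable \<Longrightarrow> S \<subseteq> {0..1} \<Longrightarrow> measure lebesgue S \<le> \<eta>0 \<Longrightarrow>
       integral S (\<lambda>x. \<bar>h i x\<bar>) \<le> \<kappa>/8" by blast
  define \<eta> where "\<eta> = min \<eta>0 (\<kappa> / (8 * (N + 1)))"
  have \<eta>: "\<eta> > 0" "\<eta> \<le> \<eta>0" using \<eta>0 \<kappa> N by (auto simp: \<eta>_def)
  have N\<eta>: "N * \<eta> \<le> \<kappa>/8"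
  proof -
    have "N * \<eta> \<le> (N + 1) * (\<kappa> / (8 * (N + 1)))" using N \<eta>(1) by (intro mult_mono) (auto simp: \<eta>_def)
    also have "\<dots> = \<kappa>/8" using N by (simp add: field_simps)
    finally show ?thesis .
  qed
  \<comment> \<open>With the threshold \<open>\<kappa>/4\<close> in \<open>bad_tags_cover\<close>,
    the bad intervals lie in a set of measure at most \<open>\<eta>\<close>. The costs are
    \<open>\<kappa>/4\<close> for tags near the grid, \<open>\<kappa>/4\<close> for bad tags and at
    most 3/8 of \<open>\<kappa>\<close> for the rest.\<close>
  define e where "e = min (\<kappa>/8) (\<eta> * (\<kappa>/4) / 10)"
  have e: "e > 0" "e \<le> \<kappa>/8" "10 * e / (\<kappa>/4) \<le> \<eta>" using \<kappa> \<eta> by (auto simp: e_def field_simps min_def)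
  obtain n where n: "n > 0"
    "\<And>i. i \<in> D \<Longrightarrow> (\<Sum>j<n. integral (grid_cell n j) (\<lambda>x. \<bar>h i x - average n i j\<bar>)) \<le> e"
    using grid_approximation[OF e(1)] by blast
  obtain \<delta> where \<delta>: "G \<delta>"
    "\<And>p i. p tagged_partial_division_of {0..1} \<Longrightarrow> gauge_fine \<delta> p \<Longrightarrow> i \<in> D \<Longrightarrow>
       (\<Sum>(t, I)\<in>p. \<bar>measure lborel I * h i t - integral I (h i)\<bar>) \<le> e"
    using uniform_saks_henstock[OF uniform G e(1)] by blast
  have \<delta>pos: "\<delta> t > 0" if "t \<in> {0..1}" for t using \<delta>(1) G that by (auto simp: gauge_class_def gauge01_def)
  \<comment> \<open>A tag within \<open>\<rho>\<close> of a grid point has its interval within twice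
    that distance; the n + 1 balls of this radius have total length \<open>\<eta>\<close>.\<close>
  define \<rho> where "\<rho> = \<eta> / (4 * (real n + 1))"
  have \<rho>: "\<rho> > 0" using \<eta> by (simp add: \<rho>_def)
  define r where "r = (\<lambda>t. min (\<delta> t / 2) \<rho>)"
  have r: "0 < r t" "r t < \<delta> t" "r t \<le> \<rho>" if "t \<in> {0..1}" for t
    using \<delta>pos[OF that] \<rho> by (auto simp: r_def)
  define Y where "Y = (\<Union>j\<le>n. cball (real j / real n) (2 * \<rho>))"
  have Y: "Y \<in> lmeasurable" "measure lebesgue Y \<le> \<eta>"
  proof -
    show "Y \<in> lmeasurable" unfolding Y_def by (intro fmeasurable.finite_UN) auto
    have "measure lebesgue Y \<le> (\<Sum>j\<le>n. measure lebesgue (cball (real j / real n) (2 * \<rho>)))"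
      unfolding Y_def by (intro measure_UNION_le) auto
    also have "\<dots> = (real n + 1) * (4 * \<rho>)" using \<rho> by (simp add: cball_eq_atLeastAtMost algebra_simps)
    also have "\<dots> = \<eta>" unfolding \<rho>_def by (simp add: field_simps)
    finally show "measure lebesgue Y \<le> \<eta>" .
  qed
  have "(\<Sum>(t, I)\<in>P. integral I (\<lambda>x. \<bar>h i t - h i x\<bar>)) \<le> \<kappa>"
    if P: "nonoverlapping P" and i: "i \<in> D"
      and tags: "\<And>t I. (t, I) \<in> P \<Longrightarrow> t \<in> {0..1} \<and> \<bar>h i t\<bar> \<le> N \<and> I \<subseteq> {0..1} \<and> I \<subseteq> ball t (min (\<delta> t / 2) \<rho>)"
    for P i
  proof -
    let ?k = "\<lambda>t. nat \<lfloor>t * real n\<rfloor>"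
    let ?a = "average n i"
    let ?F = "\<lambda>(t, I). integral I (\<lambda>x. \<bar>h i t - h i x\<bar>)"
    define near where "near t \<longleftrightarrow> (\<exists>j\<le>n. \<bar>t - real j / real n\<bar> \<le> r t)" for t
    define wild where "wild t \<longleftrightarrow> \<bar>h i t - ?a (?k t)\<bar> > \<kappa>/4" for t
    define Pn where "Pn = {p\<in>P. near (fst p)}"
    define Pb where "Pb = {p\<in>P. \<not> near (fst p) \<and> wild (fst p)}"
    define Pg where "Pg = {p\<in>P. \<not> near (fst p) \<and> \<not> wild (fst p)}"
    have no: "nonoverlapping Pn" "nonoverlapping Pb" "nonoverlapping Pg"
      using P by (auto simp: Pn_def Pb_def Pg_def intro: nonoverlapping_subset)
    have tagr: "t \<in> {0..1}" "\<bar>h i t\<bar> \<le> N" "I \<subseteq> {0..1}" "I \<subseteq> cball t (r t)" if "(t, I) \<in> P" for t I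
      using tags[OF that] by (auto simp: r_def)
    have \<eta>i: "integral T (\<lambda>x. \<bar>h i x\<bar>) \<le> \<kappa>/8"
      if "T \<in> lmeasurable" "T \<subseteq> {0..1}" "measure lebesgue T \<le> \<eta>" for T
      using \<eta>0(2)[OF i that(1,2)] that(3) \<eta>(2) by simp
    have "sum ?F Pn \<le> N * \<eta> + \<kappa>/8"
    proof (rule sum_deviation_small_support[OF no(1) i N _ Y \<eta>i])
      fix t I assume "(t, I) \<in> Pn"
      then have tI: "(t, I) \<in> P" "near t" by (auto simp: Pn_def)
      then obtain j where j: "j \<le> n" "\<bar>t - real j / real n\<bar> \<le> r t" by (auto simp: near_def)
      have "cball t (r t) \<subseteq> cball (real j / real n) (2 * \<rho>)"
        using j(2) r(3)[OF tagr(1)[OF tI(1)]] by (auto simp: cball_eq_atLeastAtMost)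
      then have "I \<subseteq> Y" using tagr(4)[OF tI(1)] j(1) by (auto simp: Y_def)
      then show "\<bar>h i t\<bar> \<le> N \<and> I \<subseteq> {0..1} \<and> I \<subseteq> Y" using tagr[OF tI(1)] by blast
    qed
    moreover have "sum ?F Pb \<le> N * \<eta> + \<kappa>/8"
    proof -
      have T: "finite (fst ` Pb)" "fst ` Pb \<subseteq> {0..1}"
        using no(2) tagr(1) by (auto simp: nonoverlapping_def Pb_def)
      have far: "\<bar>t - real j / real n\<bar> > r t" if "t \<in> fst ` Pb" "j \<le> n" for t j
      proof -
        have "\<not> near t" using that(1) by (auto simp: Pb_def)
        then show ?thesis using that(2) unfolding near_def by force
      qed
      have bad: "\<bar>h i t - ?a (?k t)\<bar> > \<kappa>/4" if "t \<in> fst ` Pb" for t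
        using that by (auto simp: Pb_def wild_def)
      have rT: "0 < r t \<and> r t < \<delta> t" if "t \<in> fst ` Pb" for t
        using that r tagr(1) by (auto simp: Pb_def)
      have "\<exists>S\<in>lmeasurable. (\<forall>t\<in>fst ` Pb. cball t (r t) \<subseteq> S) \<and> measure lebesgue S \<le> 10 * e / (\<kappa>/4)"
      proof (rule bad_tags_cover[where i = i and e = e and \<kappa> = "\<kappa>/4" and n = n and \<delta> = \<delta>
            and T = "fst ` Pb" and r = r])
        show "(\<Sum>(t, I)\<in>p. \<bar>measure lborel I * h i t - integral I (h i)\<bar>) \<le> e"
          if "p tagged_partial_division_of {0..1}" "gauge_fine \<delta> p" for p
          by (rule \<delta>(2)[OF that i])
        show "\<exists>S\<in>lmeasurable. (\<forall>t\<in>fst ` Pb. cball t (r t) \<subseteq> S) \<and> measure lebesgue S \<le> 10 * e / (\<kappa>/4)"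
          if "S \<in> lmeasurable" "\<And>t. t \<in> fst ` Pb \<Longrightarrow> cball t (r t) \<subseteq> S" "measure lebesgue S \<le> 10 * e / (\<kappa>/4)" for S
          using that by (intro bexI[of _ S] conjI ballI)
        show "\<kappa>/4 > 0" using \<kappa> by simp
      qed (fact i e(1) n(1) n(2)[OF i] T rT far bad)+
      then obtain S where S: "S \<in> lmeasurable" "\<And>t. t \<in> fst ` Pb \<Longrightarrow> cball t (r t) \<subseteq> S"
          "measure lebesgue S \<le> 10 * e / (\<kappa>/4)" by blast
      show ?thesis
      proof (rule sum_deviation_small_support[OF no(2) i N _ S(1) _ \<eta>i])
        fix t I assume tI: "(t, I) \<in> Pb"
        then have "(t, I) \<in> P" "t \<in> fst ` Pb" by (auto simp: Pb_def image_iff)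
        then show "\<bar>h i t\<bar> \<le> N \<and> I \<subseteq> {0..1} \<and> I \<subseteq> S" using tagr[of t I] S(2)[of t] by blast
      qed (use S(3) e(3) in auto)
    qed
    moreover have "sum ?F Pg \<le> \<kappa>/4 + e"
    proof -
      have tame: "?k t < n \<and> I \<subseteq> grid_cell n (?k t)" if tI: "(t, I) \<in> Pg" for t I
      proof -
        have tI': "(t, I) \<in> P" "\<not> near t" using tI by (auto simp: Pg_def)
        have far: "r t < \<bar>t - real j / real n\<bar>" if "j \<le> n" for j
          using tI'(2) that unfolding near_def by force
        have t: "t \<in> {0..1}" by (rule tagr(1)[OF tI'(1)])
        have "?k t < n"
          by (rule cball_subset_grid_cell(1)[OF t n(1) r(1)[OF t]]) (rule far)
        moreover have "cball t (r t) \<subseteq> grid_cell n (?k t)"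
          by (rule cball_subset_grid_cell(2)[OF t n(1) r(1)[OF t]]) (rule far)
        ultimately show ?thesis using tagr(4)[OF tI'(1)] by blast
      qed
      have "sum ?F Pg \<le> (\<Sum>(t, I)\<in>Pg. \<kappa>/4 * measure lborel I + integral I (\<lambda>x. \<bar>h i x - ?a (?k t)\<bar>))"
      proof (rule sum_mono, clarify)
        fix t I assume tI: "(t, I) \<in> Pg"
        then have tI': "(t, I) \<in> P" "\<bar>h i t - ?a (?k t)\<bar> \<le> \<kappa>/4" by (auto simp: Pg_def wild_def)
        obtain a b where I: "I = {a..b}" using nonoverlapping_Icc[OF P tI'(1)] by blast
        note int = integrable_on_Icc[OF i I tagr(3)[OF tI'(1)]]
        have const: "(\<lambda>_. \<kappa>/4) integrable_on I" unfolding I by (rule integrable_const_ivl)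
        have "integral I (\<lambda>x. \<bar>h i t - h i x\<bar>) \<le> integral I (\<lambda>x. \<kappa>/4 + \<bar>h i x - ?a (?k t)\<bar>)"
        proof (rule integral_le[OF int(4)])
          show "(\<lambda>x. \<kappa>/4 + \<bar>h i x - ?a (?k t)\<bar>) integrable_on I"
            by (intro integrable_add int(3) const)
          show "\<bar>h i t - h i x\<bar> \<le> \<kappa>/4 + \<bar>h i x - ?a (?k t)\<bar>" for x using tI'(2) by linarith
        qed
        also have "\<dots> = integral I (\<lambda>_. \<kappa>/4) + integral I (\<lambda>x. \<bar>h i x - ?a (?k t)\<bar>)"
          by (intro integral_add int(3) const)
        also have "integral I (\<lambda>_. \<kappa>/4) = \<kappa>/4 * measure lborel I" by (simp add: I)
        finally show "integral I (\<lambda>x. \<bar>h i t - h i x\<bar>)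
          \<le> \<kappa>/4 * measure lborel I + integral I (\<lambda>x. \<bar>h i x - ?a (?k t)\<bar>)" .
      qed
      also have "\<dots> = \<kappa>/4 * (\<Sum>(t, I)\<in>Pg. measure lborel I)
          + (\<Sum>(t, I)\<in>Pg. integral I (\<lambda>x. \<bar>h i x - ?a (?k t)\<bar>))"
        by (simp add: case_prod_unfold sum.distrib sum_distrib_left)
      also have "(\<Sum>(t, I)\<in>Pg. integral I (\<lambda>x. \<bar>h i x - ?a (?k t)\<bar>)) \<le> e"
        by (rule order_trans[OF sum_grid_deviation_le[OF no(3) i tame] n(2)[OF i]])
      also have "(\<Sum>(t, I)\<in>Pg. measure lborel I) \<le> measure lebesgue {0..1::real}"
        using tagr(3) by (intro nonoverlapping_sum_measure_le no(3)) (auto simp: Pg_def)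
      finally show ?thesis using \<kappa> by simp
    qed
    moreover have "sum ?F P = sum ?F Pn + sum ?F Pb + sum ?F Pg"
    proof -
      have fin: "finite Pn" "finite Pb" "finite Pg" using no by (auto simp: nonoverlapping_def)
      have "P = (Pn \<union> Pb) \<union> Pg" by (auto simp: Pn_def Pb_def Pg_def)
      then have "sum ?F P = sum ?F (Pn \<union> Pb) + sum ?F Pg"
        using fin by (simp only:) (intro sum.union_disjoint, auto simp: Pn_def Pb_def Pg_def)
      also have "sum ?F (Pn \<union> Pb) = sum ?F Pn + sum ?F Pb"
        using fin by (intro sum.union_disjoint) (auto simp: Pn_def Pb_def)
      finally show ?thesis .
    qed
    ultimately show ?thesis using N\<eta> e(2) \<kappa> by linarith
  qed
  with \<delta>(1) \<rho> that show ?thesis by blast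
qed

text \<open>Henstock's lemma with error 1 is used for a single interval of length \<open>L\<close>
  that contains \<open>t\<close>: the value times \<open>L\<close> is within 1 of an integral of
  modulus at most \<open>V\<close>. Rounding 1 / \<open>\<delta> t\<close> up makes the bound take
  countably many values; the summand 2 covers \<open>\<delta> t > 1\<close>, where \<open>L\<close>
  is 1/2.\<close>

lemma tag_bound:
  obtains \<delta> where "G \<delta>"
    "\<And>i t. i \<in> D \<Longrightarrow> t \<in> {0..1} \<Longrightarrow> \<bar>h i t\<bar> \<le> (V + 1) * (2 * real (nat \<lceil>1 / \<delta> t\<rceil>) + 2)"
proof -
  have "(1::real) > 0" by simp
  from uniform_saks_henstock[OF uniform G this] obtain \<delta> where \<delta>: "G \<delta>"
    "\<And>p i. p tagged_partial_division_of {0..1} \<Longrightarrow> gauge_fine \<delta> p \<Longrightarrow> i \<in> D \<Longrightarrow>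
       (\<Sum>(t, I)\<in>p. \<bar>measure lborel I * h i t - integral I (h i)\<bar>) \<le> 1" by blast
  have "\<bar>h i t\<bar> \<le> (V + 1) * (2 * real (nat \<lceil>1 / \<delta> t\<rceil>) + 2)" if i: "i \<in> D" and t: "t \<in> {0..1}" for i t
  proof -
    have \<delta>t: "\<delta> t > 0" using \<delta>(1) G t by (auto simp: gauge_class_def gauge01_def)
    define L where "L = min (\<delta> t / 2) (1 / 2)"
    have L: "L > 0" "L < \<delta> t" "L \<le> 1/2" using \<delta>t by (auto simp: L_def)
    \<comment> \<open>The interval extends to the side on which [0,1] has room for the length
      \<open>L\<close>, which is at most 1/2.\<close>
    define a where "a = (if t \<le> 1/2 then t else t - L)"
    have a: "0 \<le> a" "a \<le> t" "t \<le> a + L" "a + L \<le> 1" using t L by (auto simp: a_def)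
    let ?I = "{a..a + L}"
    have sub: "?I \<subseteq> {0..1}" using a by auto
    have "{(t, ?I)} tagged_partial_division_of {0..1}"
      using a unfolding tagged_partial_division_of_def by auto
    moreover have "gauge_fine \<delta> {(t, ?I)}" using a L by (auto simp: gauge_fine_def)
    ultimately have "\<bar>measure lborel ?I * h i t - integral ?I (h i)\<bar> \<le> 1" using \<delta>(2)[of "{(t, ?I)}" i] i by simp
    moreover have "\<bar>integral ?I (h i)\<bar> \<le> V"
    proof -
      note int = integrable_on_Icc[OF i refl sub]
      have "\<bar>integral ?I (h i)\<bar> \<le> integral ?I (\<lambda>x. \<bar>h i x\<bar>)"
        using integral_norm_bound_integral[of "h i" ?I "\<lambda>x. \<bar>h i x\<bar>"] int by simp
      also have "\<dots> \<le> integral {0..1} (\<lambda>x. \<bar>h i x\<bar>)"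
        using sub int(2) integrable_on_Icc(2)[OF i refl subset_refl] by (intro integral_subset_le) auto
      also have "\<dots> = integral {0..1} (envelope {i})" by (simp add: envelope_def[abs_def])
      also have "\<dots> \<le> V" using i by (intro integral_envelope_le) auto
      finally show ?thesis .
    qed
    moreover have "\<bar>measure lborel ?I * h i t\<bar> = L * \<bar>h i t\<bar>" using L(1) by (simp add: abs_mult)
    ultimately have "L * \<bar>h i t\<bar> \<le> V + 1" by linarith
    moreover have V: "V + 1 > 0" using \<open>\<bar>integral ?I (h i)\<bar> \<le> V\<close> by linarith
    ultimately have "\<bar>h i t\<bar> \<le> (V + 1) * (1 / L)" using L(1) by (simp add: field_simps)
    also have "1 / L \<le> 2 * real (nat \<lceil>1 / \<delta> t\<rceil>) + 2"
    proof (cases "\<delta> t \<le> 1")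
      case True
      then have "1 / L = 2 * (1 / \<delta> t)" using \<delta>t by (simp add: L_def)
      moreover have "1 / \<delta> t \<le> real (nat \<lceil>1 / \<delta> t\<rceil>)" by (rule real_nat_ceiling_ge)
      ultimately show ?thesis by linarith
    next
      case False
      then have "1 / L = 2" by (simp add: L_def)
      then show ?thesis by simp
    qed
    finally show ?thesis using V by (simp add: mult_left_mono)
  qed
  with \<delta>(1) that show ?thesis by blast
qed

text \<open>The tags are sorted by the size of the gauge for error 1, which bounds the values
  at the tags of each class. So every class gets its own error and gauge, and if the gauges are
  measurable then so are the classes.\<close>

theorem uniform_mcshane: "uniform_integral G tagged_partition D h c"
  unfolding uniform_integral_def
proof (intro allI impI)
  fix \<epsilon> :: real assume \<epsilon>: "\<epsilon> > 0"
  obtain \<delta>1 where \<delta>1: "G \<delta>1"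
    "\<And>i t. i \<in> D \<Longrightarrow> t \<in> {0..1} \<Longrightarrow> \<bar>h i t\<bar> \<le> (V + 1) * (2 * real (nat \<lceil>1 / \<delta>1 t\<rceil>) + 2)"
    using tag_bound by blast
  define k where "k = (\<lambda>t. nat \<lceil>1 / \<delta>1 t\<rceil>)"
  define N where "N = (\<lambda>k::nat. (V + 1) * (2 * real k + 2))"
  \<comment> \<open>Geometric weights, so that all classes together cost at most
    \<open>\<epsilon>/2\<close>.\<close>
  define \<kappa> where "\<kappa> = (\<lambda>k::nat. \<epsilon> / 4 * (1/2)^k)"
  obtain i0 where i0: "i0 \<in> D" using D_ne by blast
  have "0 \<le> integral {0..1} (envelope {i0})"
    using envelope_nonneg[of "{i0}"] envelope_abs_integrable[of "{i0}"] i0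
    by (intro integral_nonneg absolutely_integrable_imp_integrable) auto
  then have "V \<ge> 0" using integral_envelope_le[of "{i0}"] i0 by simp
  then have N: "N k \<ge> 0" for k by (simp add: N_def)
  have \<kappa>: "\<kappa> k > 0" for k using \<epsilon> by (simp add: \<kappa>_def)
  \<comment> \<open>Stated as a predicate of the gauge and the radius, so that both can be chosen as
    functions of the class.\<close>
  define good where "good j \<delta> \<rho> \<longleftrightarrow> (\<forall>P i. nonoverlapping P \<longrightarrow> i \<in> D \<longrightarrow>
       (\<forall>(t, I)\<in>P. t \<in> {0..1} \<and> \<bar>h i t\<bar> \<le> N j \<and> I \<subseteq> {0..1} \<and> I \<subseteq> ball t (min (\<delta> t / 2) \<rho>)) \<longrightarrow>
       (\<Sum>(t, I)\<in>P. integral I (\<lambda>x. \<bar>h i t - h i x\<bar>)) \<le> \<kappa> j)" for j \<delta> \<rho>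
  have "\<exists>\<delta> \<rho>. G \<delta> \<and> \<rho> > 0 \<and> good j \<delta> \<rho>" for j
  proof -
    obtain \<delta> \<rho> where "G \<delta>" "\<rho> > 0" "\<And>P i. nonoverlapping P \<Longrightarrow> i \<in> D \<Longrightarrow>
       (\<And>t I. (t, I) \<in> P \<Longrightarrow> t \<in> {0..1} \<and> \<bar>h i t\<bar> \<le> N j \<and> I \<subseteq> {0..1} \<and> I \<subseteq> ball t (min (\<delta> t / 2) \<rho>)) \<Longrightarrow>
       (\<Sum>(t, I)\<in>P. integral I (\<lambda>x. \<bar>h i t - h i x\<bar>)) \<le> \<kappa> j"
      using bounded_tags_estimate[OF N \<kappa>, of j j] by blast
    note * = this
    have "good j \<delta> \<rho>" unfolding good_def
    proof (intro allI impI)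
      fix P i assume P: "nonoverlapping P" "i \<in> D" "\<forall>(t, I)\<in>P. t \<in> {0..1} \<and> \<bar>h i t\<bar> \<le> N j \<and> I \<subseteq> {0..1} \<and>
          I \<subseteq> ball t (min (\<delta> t / 2) \<rho>)"
      show "(\<Sum>(t, I)\<in>P. integral I (\<lambda>x. \<bar>h i t - h i x\<bar>)) \<le> \<kappa> j"
        by (rule *(3)[OF P(1,2)]) (use P(3) in \<open>blast dest: bspec\<close>)
    qed
    with *(1,2) show ?thesis by blast
  qed
  then obtain \<delta>s \<rho> where \<delta>s: "\<And>j. G (\<delta>s j)" "\<And>j. \<rho> j > 0" "\<And>j. good j (\<delta>s j) (\<rho> j)" by metis
  define \<delta> where "\<delta> = (\<lambda>t. min (\<delta>s (k t) t / 2) (\<rho> (k t)))"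
  have "G \<delta>" using G \<delta>1(1) \<delta>s(1,2) unfolding gauge_class_def \<delta>_def k_def by blast
  moreover have "\<bar>(\<Sum>(t, I)\<in>P. measure lborel I * h i t) - c i\<bar> < \<epsilon>"
    if P: "tagged_partition P" "gauge_fine \<delta> P" and i: "i \<in> D" for P i
  proof -
    have no: "nonoverlapping P" by (rule tagged_partition_nonoverlapping[OF P(1)])
    then have fin: "finite P" by (simp add: nonoverlapping_def)
    have tag: "t \<in> {0..1}" "I \<subseteq> {0..1}" if "(t, I) \<in> P" for t I
    proof -
      have "\<forall>(t, I)\<in>P. t \<in> {0..1} \<and> I \<subseteq> {0..1} \<and> (\<exists>a b. a \<le> b \<and> I = {a..b})"
        using P(1) unfolding tagged_partition_def by (elim conjE)
      then show "t \<in> {0..1}" "I \<subseteq> {0..1}" using that by auto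
    qed
    have un: "(\<Union>(t, I)\<in>P. I) = {0..1}" using P(1) unfolding tagged_partition_def by (elim conjE)
    have int: "h i integrable_on I" "(\<lambda>x. \<bar>h i t - h i x\<bar>) integrable_on I" if tI: "(t, I) \<in> P" for t I
    proof -
      obtain a b where I: "I = {a..b}" using nonoverlapping_Icc[OF no tI] by blast
      show "h i integrable_on I" "(\<lambda>x. \<bar>h i t - h i x\<bar>) integrable_on I"
        by (intro integrable_on_Icc[OF i I tag(2)[OF tI]])+
    qed
    have "(h i has_integral (\<Sum>(t, I)\<in>P. integral I (h i))) {0..1}"
      using nonoverlapping_has_integral[OF no int(1)] un by simp
    then have ci: "c i = (\<Sum>(t, I)\<in>P. integral I (h i))"
      by (rule has_integral_unique[OF has_integral_c[OF i]])
    have "\<bar>(\<Sum>(t, I)\<in>P. measure lborel I * h i t) - c i\<bar>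
        \<le> (\<Sum>(t, I)\<in>P. \<bar>measure lborel I * h i t - integral I (h i)\<bar>)"
      unfolding ci sum_subtractf[symmetric] case_prod_unfold by (rule sum_abs)
    also have "\<dots> \<le> (\<Sum>(t, I)\<in>P. integral I (\<lambda>x. \<bar>h i t - h i x\<bar>))"
    proof (rule sum_mono, clarify)
      fix t I assume tI: "(t, I) \<in> P"
      obtain a b where I: "I = {a..b}" using nonoverlapping_Icc[OF no tI] by blast
      have "integral I (\<lambda>x. h i t - h i x) = integral I (\<lambda>_. h i t) - integral I (h i)"
        unfolding I by (intro integral_diff integrable_const_ivl int(1)[OF tI, unfolded I])
      also have "integral I (\<lambda>_. h i t) = measure lborel I * h i t" by (simp add: I)
      finally have "\<bar>measure lborel I * h i t - integral I (h i)\<bar> = norm (integral I (\<lambda>x. h i t - h i x))" by simp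
      also have "\<dots> \<le> integral I (\<lambda>x. \<bar>h i t - h i x\<bar>)"
        using int[OF tI] integrable_const_ivl[of "h i t" a b]
        by (intro integral_norm_bound_integral integrable_diff) (auto simp: I)
      finally show "\<bar>measure lborel I * h i t - integral I (h i)\<bar> \<le> integral I (\<lambda>x. \<bar>h i t - h i x\<bar>)" .
    qed
    \<comment> \<open>Each class of tags is only a partial family of intervals, which is why the
      estimate for one class asks for \<open>nonoverlapping\<close> and not for a partition.\<close>
    also have "\<dots> = (\<Sum>j\<in>k ` fst ` P. \<Sum>(t, I)\<in>{p\<in>P. k (fst p) = j}. integral I (\<lambda>x. \<bar>h i t - h i x\<bar>))"
      using fin by (subst sum.group) (auto simp: image_image)
    also have "\<dots> \<le> sum \<kappa> (k ` fst ` P)"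
    proof (rule sum_mono)
      fix j
      have "\<forall>(t, I)\<in>{p\<in>P. k (fst p) = j}. t \<in> {0..1} \<and> \<bar>h i t\<bar> \<le> N j \<and> I \<subseteq> {0..1} \<and>
          I \<subseteq> ball t (min (\<delta>s j t / 2) (\<rho> j))"
      proof
        fix p assume p: "p \<in> {p\<in>P. k (fst p) = j}"
        obtain t I where pair: "p = (t, I)" by (cases p)
        have tI: "(t, I) \<in> P" and j: "k t = j" using p by (auto simp: pair)
        have "I \<subseteq> ball t (\<delta> t)"
          using P(2) tI by (auto simp: gauge_fine_def ball_eq_greaterThanLessThan)
        then show "case p of (t, I) \<Rightarrow> t \<in> {0..1} \<and> \<bar>h i t\<bar> \<le> N j \<and> I \<subseteq> {0..1} \<and>
            I \<subseteq> ball t (min (\<delta>s j t / 2) (\<rho> j))"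
          unfolding pair prod.case using tag[OF tI] \<delta>1(2)[OF i tag(1)[OF tI]] j by (simp add: N_def \<delta>_def k_def)
      qed
      moreover have "nonoverlapping {p\<in>P. k (fst p) = j}" using no by (rule nonoverlapping_subset) auto
      ultimately show "(\<Sum>(t, I)\<in>{p\<in>P. k (fst p) = j}. integral I (\<lambda>x. \<bar>h i t - h i x\<bar>)) \<le> \<kappa> j"
        using \<delta>s(3)[of j] i unfolding good_def by blast
    qed
    \<comment> \<open>Classes that do not occur are added to reach an initial segment, where the
      geometric sum is explicit.\<close>
    also have "\<dots> \<le> sum \<kappa> {..Max (insert 0 (k ` fst ` P))}"
      using fin \<kappa> by (intro sum_mono2) (auto intro!: Max_ge intro: less_imp_le simp del: Max_insert)
    also have "\<dots> \<le> \<epsilon> / 4 * 2"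
    proof -
      have "(\<Sum>j\<le>m. (1/2::real)^j) \<le> 2" for m
        using sum_gp_basic[of "1/2::real" m] zero_le_power[of "1/2::real" "Suc m"] by simp
      then show ?thesis using \<epsilon> unfolding \<kappa>_def sum_distrib_left[symmetric] by (intro mult_left_mono) auto
    qed
    also have "\<dots> < \<epsilon>" using \<epsilon> by simp
    finally show ?thesis .
  qed
  ultimately show "\<exists>\<delta>. G \<delta> \<and> (\<forall>P. tagged_partition P \<and> gauge_fine \<delta> P \<longrightarrow>
      (\<forall>i\<in>D. \<bar>(\<Sum>(t, I)\<in>P. measure lborel I * h i t) - c i\<bar> < \<epsilon>))" by blast
qed

end

section \<open>Return to set-valued functions\<close>

theorem cb_tagged_integral_of_perron:
  fixes \<Gamma> :: "real \<Rightarrow> 'a::banach set"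
  assumes \<Gamma>: "\<And>t. t \<in> {0..1} \<Longrightarrow> \<Gamma> t \<in> cb" and G: "gauge_class G"
    and C: "has_cb_integral G perron_partition \<Gamma> C"
    and var: "set_variation (\<lambda>I. THE C. has_cb_integral G perron_partition (restrict_multi \<Gamma> I) C) {0..1} < \<infinity>"
  shows "has_cb_integral G tagged_partition \<Gamma> C"
proof -
  define \<Phi> where "\<Phi> = (\<lambda>I. THE C. has_cb_integral G perron_partition (restrict_multi \<Gamma> I) C)"
  have iff: "has_cb_integral G Q \<Gamma> C \<longleftrightarrow> C \<in> cb \<and>
      uniform_integral G Q dual_ball (\<lambda>l t. support l (\<Gamma> t)) (\<lambda>l. support l C)"
    if "\<And>P. Q P \<Longrightarrow> tagged_partition P" for Q
    by (intro has_cb_integral_iff_uniform_integral \<Gamma> that)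
  have C': "C \<in> cb" "uniform_integral G perron_partition dual_ball (\<lambda>l t. support l (\<Gamma> t)) (\<lambda>l. support l C)"
    using C iff[of perron_partition] by (auto simp: perron_partition_def)
  have sum_le: "ereal (sum (\<lambda>J. set_norm (\<Phi> J)) d) \<le> set_variation \<Phi> {0..1}" if "d division_of {0..1}" for d
    unfolding set_variation_def using that by (intro SUP_upper) auto
  \<comment> \<open>The trivial division keeps the supremum above minus infinity, so a variation
    below infinity is a real number \<open>V\<close>.\<close>
  have "{{0..1::real}} division_of {0..1}" using division_of_self[of 0 "1::real"] by simp
  from sum_le[OF this] have "set_variation \<Phi> {0..1} \<noteq> -\<infinity>" by auto
  then obtain V where V: "set_variation \<Phi> {0..1} = ereal V"
    using var unfolding \<Phi>_def[symmetric] by (cases "set_variation \<Phi> {0..1}") auto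
  interpret bv_family G dual_ball "\<lambda>l t. support l (\<Gamma> t)" "\<lambda>l. support l C" "\<lambda>J. set_norm (\<Phi> J)" V
  proof
    show "dual_ball \<noteq> ({} :: ('a \<Rightarrow> real) set)" using zero_in_dual_ball by blast
    show "\<bar>integral {a..b} (\<lambda>t. support l (\<Gamma> t))\<bar> \<le> set_norm (\<Phi> {a..b})"
      if "l \<in> dual_ball" "0 \<le> a" "a \<le> b" "b \<le> 1" for l a b
      unfolding \<Phi>_def by (rule cb_integral_over_subinterval[OF \<Gamma> G C that(2-4,1)])
    show "sum (\<lambda>J. set_norm (\<Phi> J)) d \<le> V" if "d division_of {0..1}" for d
      using sum_le[OF that] V by simp
  qed (rule G, rule C')
  \<comment> \<open>The scalar theorem keeps the integrals, so the same set \<open>C\<close> is the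
    integral for free tags.\<close>
  show ?thesis using iff[of tagged_partition] C'(1) uniform_mcshane by blast
qed

theorem theorem4p5:
  fixes \<Gamma> :: "real \<Rightarrow> 'a::banach set"
  assumes "\<And>t. t \<in> {0..1} \<Longrightarrow> \<Gamma> t \<in> cb"
  shows "(henstock_integrable \<Gamma> \<and> set_variation (henstock_integral \<Gamma>) {0..1} < \<infinity>
            \<longrightarrow> mcshane_integrable \<Gamma>) \<and>
         (H_integrable \<Gamma> \<and> set_variation (H_integral \<Gamma>) {0..1} < \<infinity>
            \<longrightarrow> birkhoff_integrable \<Gamma>)"
  using cb_tagged_integral_of_perron[of \<Gamma>, OF assms gauge_class_gauge01]
    cb_tagged_integral_of_perron[of \<Gamma>, OF assms gauge_class_measurable_gauge01]
  unfolding henstock_integrable_def mcshane_integrable_def H_integrable_def birkhoff_integrable_def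
    has_henstock_integral_def has_mcshane_integral_def has_H_integral_def has_birkhoff_integral_def
    henstock_integral_def[abs_def] H_integral_def[abs_def]
  by blast

end
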